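(* Let $\mathbf{A}=\mathbf{A}^{(n)}$ be adjacency matrices from a sequence of degree-corrected stochastic blockmodels satisfying the weakly distinguishable community structure and mild degree heterogeneity conditions given in the context, let $\mathbf{L}_\alpha$ be the normalized adjacency matrix, and let $\widetilde{\mathbf{L}}_\alpha=\mathbf{U}\boldsymbol{\Lambda}\mathbf{U}'+\frac{1}{\sqrt n}\mathbf{D}_q^{-\alpha}\mathbf{X}\mathbf{D}_q^{-\alpha}$ be the signal-plus-noise matrix defined in the context. Then for any $\alpha\in\mathbb{R}$ and any positive integer $p$, $$\Big\|\,\|\mathbf{L}_\alpha-\widetilde{\mathbf{L}}_\alpha\|_2\,\Big\|_{\mathsf{L}_p}\lesssim\left(\frac{\log n}{n}\right)^{1/2}.$$ Moreover, for any $\alpha\in\mathbb{R}$ and any positive integer $p$, $$\sup_{\mathbf{R}\in\{-1,1\}^{n\times n}:\ \mathbf{R}=\mathbf{R}'}\ \Big\|\,\|\mathbf{R}\circ\mathbf{L}_\alpha-\mathbf{R}\circ\widetilde{\mathbf{L}}_\alpha\|_2\,\Big\|_{\mathsf{L}_p}\lesssim\left(\frac{\log n}{n}\right)^{1/2},$$ where the supremum is over deterministic symmetric sign matrices.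
   Context: Model. For each $n$, let $K=K(n)\ge 1$ be an integer (allowed to depend on $n$ arbitrarily), let $\mathbf{g}\in\{1,\dots,K\}^n$ (community memberships), $\mathbf{q}\in(0,1)^n$ (node degree parameters), and let $\mathbf{C}\in\mathbb{R}^{K\times K}$ be symmetric, all deterministic. The matrix $\mathbf{A}\in\{0,1\}^{n\times n}$ is symmetric with $A_{ij}=A_{ji}\sim\mathrm{Bernoulli}(q_iq_jC_{g_ig_j})$ independently for $1\le i\le j\le n$ (these parameters are valid probabilities). Let $\mathbf{M}\in\mathbb{R}^{K\times K}$ be the symmetric matrix with $C_{kl}=1+M_{kl}/\sqrt n$. Assumption. There are positive constants $M_{\max}$, $q_{\min}$, $q_{\max}$, not depending on $n$ or $K$, with $[q_{\min},q_{\max}]\subset(0,1)$, such that for all $i,j\in\{1,\dots,n\}$: $|M_{g_ig_j}|\le M_{\max}$ and $q_i\in[q_{\min},q_{\max}]$. Notation. $'$ is transpose; $\mathbf{1}_k\in\mathbb{R}^k$ is the all-ones vector; $\mathbf{D}_q=\mathrm{diag}(\mathbf{q})$; $\mathbf{J}\in\{0,1\}^{n\times K}$ has $J_{ik}=1$ if $g_i=k$ and $0$ otherwise. Normalized adjacency matrix: with $\mathbf{d}=\mathbf{A}\mathbf{1}_n$, $\mathbf{D}=\mathrm{diag}(\mathbf{d})$, $m=\frac12\mathbf{d}'\mathbf{1}_n$, $$\mathbf{L}_\alpha=(2m)^\alpha\tfrac{1}{\sqrt n}\mathbf{D}^{-\alpha}\left(\mathbf{A}-\tfrac{1}{2m}\mathbf{d}\mathbf{d}'\right)\mathbf{D}^{-\alpha},$$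 with the convention $0^s=0$ for every $s\in\mathbb{R}$ (powers of diagonal matrices are taken entrywise on the diagonal with this convention). Signal-plus-noise matrix: $\mathbf{X}=\mathbf{A}-\mathbb{E}[\mathbf{A}]$, where $\mathbb{E}[\mathbf{A}]=\mathbf{D}_q\mathbf{J}\mathbf{C}\mathbf{J}'\mathbf{D}_q=\mathbf{q}\mathbf{q}'+\frac{1}{\sqrt n}\mathbf{D}_q\mathbf{J}\mathbf{M}\mathbf{J}'\mathbf{D}_q$, and $$\mathbf{U}=\begin{bmatrix}\frac{\mathbf{D}_q^{1-\alpha}\mathbf{J}}{\sqrt n}&\frac{\mathbf{D}_q^{-\alpha}\mathbf{X}\mathbf{1}_n}{\mathbf{q}'\mathbf{1}_n}\end{bmatrix}\in\mathbb{R}^{n\times(K+1)},\qquad \boldsymbol{\Lambda}=\begin{bmatrix}(\mathbf{I}_K-\mathbf{1}_K\bar{\mathbf{c}}')\mathbf{M}(\mathbf{I}_K-\bar{\mathbf{c}}\mathbf{1}_K')&-\mathbf{1}_K\\-\mathbf{1}_K'&0\end{bmatrix},\qquad \bar{\mathbf{c}}=\frac{\mathbf{J}'\mathbf{q}}{\mathbf{1}_n'\mathbf{q}}.$$ $\circ$ is the Hadamard (entrywise) product; $\|\cdot\|_2$ of a matrix is the operator (spectral) norm; $\|Y\|_{\mathsf{L}_p}=(\mathbb{E}|Y|^p)^{1/p}$. $f(n)\lesssim g(n)$ means there exist $C,N>0$ such that $|f(n)|\le C g(n)$ for all $n\ge N$; the constants may depend on $\alpha$, $p$, $q_{\min}$,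 $q_{\max}$, $M_{\max}$. *)

theory Defs
  imports "HOL-Probability.Probability" "Jordan_Normal_Form.Matrix"
begin

hide_const (open) Finite_Cartesian_Product.mat Finite_Cartesian_Product.vec
no_notation Finite_Cartesian_Product.vec_nth (infixl "$" 90)
no_notation Inner_Product.real_inner_class.inner (infix "\<bullet>" 70)

definition ones :: "nat \<Rightarrow> real vec" where
  "ones k = vec k (\<lambda>_. 1)"

definition mat_of_col :: "real vec \<Rightarrow> real mat" where
  "mat_of_col v = (mat_of_row v)\<^sup>T"

text \<open>The real power \<^term>\<open>(powr)\<close> satisfies \<open>0 powr s = 0\<close> for every real \<open>s\<close> (also for
  \<open>s = 0\<close>), and \<open>1 / 0 = 0\<close>. This implements the convention \<open>0^s = 0\<close>, needed for isolated
  vertices and for the empty graph.\<close>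

definition diag_powr :: "real vec \<Rightarrow> real \<Rightarrow> real mat" where
  "diag_powr v s = mat_diag (dim_vec v) (\<lambda>i. v $ i powr s)"

definition append_cols :: "real mat \<Rightarrow> real mat \<Rightarrow> real mat" (infixr \<open>@\<^sub>c\<close> 65) where
  "B @\<^sub>c E = four_block_mat B E (0\<^sub>m 0 (dim_col B)) (0\<^sub>m 0 (dim_col E))"

definition hadamard :: "real mat \<Rightarrow> real mat \<Rightarrow> real mat" (infixl \<open>\<circ>\<^sub>H\<close> 70) where
  "B \<circ>\<^sub>H E = mat (dim_row B) (dim_col B) (\<lambda>(i,j). B $$ (i,j) * E $$ (i,j))"

definition vec_l2_norm :: "real vec \<Rightarrow> real" where
  "vec_l2_norm v = L2_set (\<lambda>i. v $ i) {..<dim_vec v}"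

definition op_norm :: "real mat \<Rightarrow> real" where
  "op_norm B = (SUP v \<in> {v \<in> carrier_vec (dim_col B). vec_l2_norm v \<le> 1}. vec_l2_norm (B *\<^sub>v v))"

definition Lp_norm :: "'a measure \<Rightarrow> nat \<Rightarrow> ('a \<Rightarrow> real) \<Rightarrow> real" where
  "Lp_norm P p Y = (\<integral>\<omega>. \<bar>Y \<omega>\<bar> ^ p \<partial>P) powr (1 / real p)"

definition sign_matrices :: "nat \<Rightarrow> real mat set" where
  "sign_matrices n = {R \<in> carrier_mat n n. elements_mat R \<subseteq> {-1, 1} \<and> R\<^sup>T = R}"

text \<open>The degree-corrected stochastic blockmodel on \<open>n\<close> nodes. Nodes and communities are numbered
  from \<open>0\<close>, so that \<open>g\<close> maps \<open>{..<n}\<close> into \<open>{..<K}\<close>; communities may be empty, and self-loops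
  are allowed.\<close>

locale dcsbm = prob_space P for P :: "'a measure" +
  fixes n K :: nat and g :: "nat \<Rightarrow> nat" and q :: "real vec" and C M :: "real mat"
    and A :: "'a \<Rightarrow> real mat"
  assumes K_ge_1: "1 \<le> K"
    and g_less: "\<And>i. i < n \<Longrightarrow> g i < K"
    and q_carrier: "q \<in> carrier_vec n"
    and q_range: "\<And>i. i < n \<Longrightarrow> q $ i \<in> {0<..<1}"
    and C_carrier: "C \<in> carrier_mat K K"
    and C_sym: "C\<^sup>T = C"
    and M_carrier: "M \<in> carrier_mat K K"
    and M_sym: "M\<^sup>T = M"
    and C_M: "\<And>k l. k < K \<Longrightarrow> l < K \<Longrightarrow> C $$ (k,l) = 1 + M $$ (k,l) / sqrt (real n)"
    and valid_prob: "\<And>i j. i \<le> j \<Longrightarrow> j < n \<Longrightarrow> q $ i * q $ j * C $$ (g i, g j) \<in> {0..1}"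
    and A_carrier: "\<And>\<omega>. \<omega> \<in> space P \<Longrightarrow> A \<omega> \<in> carrier_mat n n"
    and A_01: "\<And>\<omega>. \<omega> \<in> space P \<Longrightarrow> elements_mat (A \<omega>) \<subseteq> {0, 1}"
    and A_sym: "\<And>\<omega>. \<omega> \<in> space P \<Longrightarrow> (A \<omega>)\<^sup>T = A \<omega>"
    and A_bernoulli: "\<And>i j. i \<le> j \<Longrightarrow> j < n \<Longrightarrow>
      distr P (count_space UNIV) (\<lambda>\<omega>. A \<omega> $$ (i,j) = 1)
        = measure_pmf (bernoulli_pmf (q $ i * q $ j * C $$ (g i, g j)))"
    and A_indep: "indep_vars (\<lambda>_. borel) (\<lambda>(i,j) \<omega>. A \<omega> $$ (i,j)) {(i,j). i \<le> j \<and> j < n}"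

definition weakly_distinguishable :: "real \<Rightarrow> nat \<Rightarrow> (nat \<Rightarrow> nat) \<Rightarrow> real mat \<Rightarrow> bool" where
  "weakly_distinguishable Mmax n g M \<longleftrightarrow> (\<forall>i<n. \<forall>j<n. \<bar>M $$ (g i, g j)\<bar> \<le> Mmax)"

definition mild_degree_heterogeneity :: "real \<Rightarrow> real \<Rightarrow> nat \<Rightarrow> real vec \<Rightarrow> bool" where
  "mild_degree_heterogeneity qmin qmax n q \<longleftrightarrow> (\<forall>i<n. q $ i \<in> {qmin..qmax})"

text \<open>All data, including the probability space, may depend on \<open>n\<close> arbitrarily; nothing is
  required for \<open>n = 0\<close>.\<close>

definition dcsbm_sequence ::
  "real \<Rightarrow> real \<Rightarrow> real \<Rightarrow> (nat \<Rightarrow> 'a measure) \<Rightarrow> (nat \<Rightarrow> nat) \<Rightarrow> (nat \<Rightarrow> nat \<Rightarrow> nat) \<Rightarrow>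
   (nat \<Rightarrow> real vec) \<Rightarrow> (nat \<Rightarrow> real mat) \<Rightarrow> (nat \<Rightarrow> real mat) \<Rightarrow> (nat \<Rightarrow> 'a \<Rightarrow> real mat) \<Rightarrow> bool" where
  "dcsbm_sequence Mmax qmin qmax P K g q C M A \<longleftrightarrow>
     (\<forall>n\<ge>1. dcsbm (P n) n (K n) (g n) (q n) (C n) (M n) (A n) \<and>
             weakly_distinguishable Mmax n (g n) (M n) \<and>
             mild_degree_heterogeneity qmin qmax n (q n))"

definition norm_adj :: "real \<Rightarrow> nat \<Rightarrow> real mat \<Rightarrow> real mat" where
  "norm_adj \<alpha> n A =
     (let d = A *\<^sub>v ones n; m = (1/2) * (d \<bullet> ones n) in
      ((2 * m) powr \<alpha> * (1 / sqrt (real n))) \<cdot>\<^sub>m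
        (diag_powr d (-\<alpha>) * (A - (1 / (2 * m)) \<cdot>\<^sub>m (mat_of_col d * mat_of_row d)) * diag_powr d (-\<alpha>)))"

definition membership_mat :: "nat \<Rightarrow> nat \<Rightarrow> (nat \<Rightarrow> nat) \<Rightarrow> real mat" where
  "membership_mat n K g = mat n K (\<lambda>(i,k). if g i = k then 1 else 0)"

definition mean_mat :: "'a measure \<Rightarrow> nat \<Rightarrow> ('a \<Rightarrow> real mat) \<Rightarrow> real mat" where
  "mean_mat P n A = mat n n (\<lambda>(i,j). \<integral>\<omega>. A \<omega> $$ (i,j) \<partial>P)"

definition U_mat :: "real \<Rightarrow> nat \<Rightarrow> nat \<Rightarrow> (nat \<Rightarrow> nat) \<Rightarrow> real vec \<Rightarrow> real mat \<Rightarrow> real mat" where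
  "U_mat \<alpha> n K g q X =
     ((1 / sqrt (real n)) \<cdot>\<^sub>m (diag_powr q (1 - \<alpha>) * membership_mat n K g)) @\<^sub>c
     mat_of_col ((1 / (q \<bullet> ones n)) \<cdot>\<^sub>v (diag_powr q (-\<alpha>) *\<^sub>v (X *\<^sub>v ones n)))"

definition c_bar :: "nat \<Rightarrow> nat \<Rightarrow> (nat \<Rightarrow> nat) \<Rightarrow> real vec \<Rightarrow> real vec" where
  "c_bar n K g q = (1 / (ones n \<bullet> q)) \<cdot>\<^sub>v ((membership_mat n K g)\<^sup>T *\<^sub>v q)"

definition Lambda_mat :: "nat \<Rightarrow> nat \<Rightarrow> (nat \<Rightarrow> nat) \<Rightarrow> real vec \<Rightarrow> real mat \<Rightarrow> real mat" where
  "Lambda_mat n K g q M =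
     (let c = c_bar n K g q in
      four_block_mat
        ((1\<^sub>m K - mat_of_col (ones K) * mat_of_row c) * M * (1\<^sub>m K - mat_of_col c * mat_of_row (ones K)))
        (- mat_of_col (ones K))
        (- mat_of_row (ones K))
        (0\<^sub>m 1 1))"

definition signal_plus_noise ::
  "real \<Rightarrow> 'a measure \<Rightarrow> nat \<Rightarrow> nat \<Rightarrow> (nat \<Rightarrow> nat) \<Rightarrow> real vec \<Rightarrow> real mat \<Rightarrow> ('a \<Rightarrow> real mat) \<Rightarrow>
   'a \<Rightarrow> real mat" where
  "signal_plus_noise \<alpha> P n K g q M A \<omega> =
     (let X = A \<omega> - mean_mat P n A; U = U_mat \<alpha> n K g q X in
      U * Lambda_mat n K g q M * U\<^sup>T
      + (1 / sqrt (real n)) \<cdot>\<^sub>m (diag_powr q (-\<alpha>) * X * diag_powr q (-\<alpha>)))"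

end

theory Submission
  imports Defs
begin

text \<open>Write \<open>d i = q i S (1 + e i)\<close> for the degrees, \<open>2 m = S\<^sup>2 (1 + \<eta>)\<close> with \<open>S = \<Sum>q\<close>, and \<open>X = A - E[A]\<close>.
  Then \<open>L - L'\<close> has entries \<open>n\<^sup>-\<^sup>1\<^sup>/\<^sup>2 (q i q j)\<^sup>-\<^sup>\<alpha> ((F - 1) X + q i q j (F G - G0))\<close>, where
  \<open>F = (1 + \<eta>)\<^sup>\<alpha> (1 + e i)\<^sup>-\<^sup>\<alpha> (1 + e j)\<^sup>-\<^sup>\<alpha>\<close>, \<open>G = 1 + M / sqrt n - (1 + e i) (1 + e j) / (1 + \<eta>)\<close> and \<open>G0\<close> is the
  linearization of \<open>G\<close>. Since \<open>F\<close> has product form, \<open>(F - 1) X\<close> is controlled by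
  \<open>max \<bar>e i\<bar>\<close>, of order \<open>sqrt (ln n / n)\<close>, times the operator norm of \<open>X\<close>, of order \<open>sqrt n\<close>; the remaining term is
  bounded in Frobenius norm. There it is essential to use the \<open>l\<^sup>2\<close> norm of \<open>e\<close>, which is \<open>O(1)\<close>: the
  maximum of \<open>\<bar>e i\<bar>\<close> alone would lose a factor \<open>sqrt (ln n)\<close>. Entrywise signs change none of these norms except
  that of \<open>X\<close>, and \<open>R \<circ> X\<close> satisfies the same moment bounds as \<open>X\<close>, by Hoeffding's lemma and a net of the unit ball.
  When some \<open>e i\<close> exceeds \<open>1/2\<close>, a crude polynomial bound suffices.\<close>

section \<open>Bilinear forms and operator norms\<close>

text \<open>All randomness is compressed into one factor \<open>T\<close> (see
  \<open>noise_scale\<close>), which bounds at once the operator norms of X and of R \<circ> X, the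
  row sums of X and its total sum, each relative to its natural order. For a fixed outcome the
  comparison of the two matrices is deterministic: the error is at most a constant times sqrt (ln n
  / n) times a fixed power of \<open>T\<close>. It remains to bound the moments of \<open>T\<close>
  uniformly in n and R.

  Both operator norms are needed because the signs act on the final difference but not on the
  degrees: \<open>e\<close> is built from the row sums of X itself, while the noise term contains R
  \<circ> X.

  The linearization \<open>G0\<close> carries \<kappa> / sqrt n where expanding 1 / (1 + \<eta>)
  would give \<eta>. The two differ by the total noise divided by S^2, which is of order 1/n, so the
  replacement is within the claimed rate.

  Maxima over finite families of bilinear forms are handled by an explicit integrable majorant, a
  sum of exponentials, so that all moment bounds pass through pointwise inequalities.\<close>

definition blf :: "nat \<Rightarrow> (nat \<Rightarrow> nat \<Rightarrow> real) \<Rightarrow> (nat \<Rightarrow> real) \<Rightarrow> (nat \<Rightarrow> real) \<Rightarrow> real" where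
  "blf n f y z = (\<Sum>i<n. \<Sum>j<n. y i * f i j * z j)"

text \<open>This is "operator norm at most c" in bilinear form. Arrays are functions on all of nat,
  so no dimension conditions arise until \<open>op_norm_le_of_blf_bound\<close> returns to
  matrices.\<close>

definition blf_bound :: "nat \<Rightarrow> (nat \<Rightarrow> nat \<Rightarrow> real) \<Rightarrow> real \<Rightarrow> bool" where
  "blf_bound n f c \<longleftrightarrow> (\<forall>y z. \<bar>blf n f y z\<bar> \<le> c * L2_set y {..<n} * L2_set z {..<n})"

lemma blf_cong:
  assumes "\<And>i j. i < n \<Longrightarrow> j < n \<Longrightarrow> f i j = h i j"
  shows "blf n f y z = blf n h y z"
  unfolding blf_def using assms by (intro sum.cong) auto

lemma blf_bound_cong:
  assumes "\<And>i j. i < n \<Longrightarrow> j < n \<Longrightarrow> f i j = h i j"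
  shows "blf_bound n f c \<longleftrightarrow> blf_bound n h c"
  unfolding blf_bound_def using blf_cong[OF assms] by simp

lemma blf_add: "blf n (\<lambda>i j. f i j + h i j) y z = blf n f y z + blf n h y z"
  unfolding blf_def by (simp add: algebra_simps sum.distrib)

lemma blf_cmult: "blf n (\<lambda>i j. a * f i j) y z = a * blf n f y z"
  unfolding blf_def by (simp add: sum_distrib_left algebra_simps)

lemma blf_diff_left: "blf n f (\<lambda>i. y i - y' i) z = blf n f y z - blf n f y' z"
  unfolding blf_def by (simp add: algebra_simps sum_subtractf)

lemma blf_diff_right: "blf n f y (\<lambda>i. z i - z' i) = blf n f y z - blf n f y z'"
  unfolding blf_def by (simp add: algebra_simps sum_subtractf)

lemma blf_scale: "blf n f (\<lambda>i. a * y i) (\<lambda>i. b * z i) = a * b * blf n f y z"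
  unfolding blf_def by (simp add: sum_distrib_left algebra_simps)

lemma L2_set_cmult: "L2_set (\<lambda>i. a * y i) S = \<bar>a\<bar> * L2_set y S"
  unfolding L2_set_def by (simp add: power_mult_distrib real_sqrt_mult flip: sum_distrib_left)

lemma L2_set_abs_le_mult:
  assumes "\<And>i. i \<in> S \<Longrightarrow> \<bar>u i\<bar> \<le> a * \<bar>y i\<bar>" "0 \<le> a"
  shows "L2_set u S \<le> a * L2_set y S"
proof -
  have "L2_set u S = L2_set (\<lambda>i. \<bar>u i\<bar>) S" unfolding L2_set_def by simp
  also have "\<dots> \<le> L2_set (\<lambda>i. a * \<bar>y i\<bar>) S" by (rule L2_set_mono) (use assms in auto)
  also have "\<dots> = a * L2_set y S"
    using assms(2) unfolding L2_set_cmult by (simp add: L2_set_def)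
  finally show ?thesis .
qed

lemma L2_set_le_of_abs_le:
  assumes "\<And>i. i \<in> S \<Longrightarrow> \<bar>u i\<bar> \<le> y i"
  shows "L2_set u S \<le> L2_set y S"
proof -
  have "L2_set u S = L2_set (\<lambda>i. \<bar>u i\<bar>) S" unfolding L2_set_def by simp
  also have "\<dots> \<le> L2_set y S" by (rule L2_set_mono) (use assms in auto)
  finally show ?thesis .
qed

lemma L2_set_const: "L2_set (\<lambda>_. c) {..<n} = \<bar>c\<bar> * sqrt (real n)"
  unfolding L2_set_def by (simp add: real_sqrt_mult)

lemma blf_bound_mono: "blf_bound n f c \<Longrightarrow> c \<le> c' \<Longrightarrow> blf_bound n f c'"
  unfolding blf_bound_def
  by (meson L2_set_nonneg mult_right_mono order_trans)

lemma blf_bound_add: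
  assumes "blf_bound n f c" "blf_bound n h c'"
  shows "blf_bound n (\<lambda>i j. f i j + h i j) (c + c')"
  unfolding blf_bound_def
proof (intro allI)
  fix y z
  have "\<bar>blf n f y z\<bar> \<le> c * L2_set y {..<n} * L2_set z {..<n}"
    "\<bar>blf n h y z\<bar> \<le> c' * L2_set y {..<n} * L2_set z {..<n}"
    using assms unfolding blf_bound_def by auto
  then show "\<bar>blf n (\<lambda>i j. f i j + h i j) y z\<bar> \<le> (c + c') * L2_set y {..<n} * L2_set z {..<n}"
    unfolding blf_add by (simp add: algebra_simps)
qed

lemma blf_bound_cmult:
  assumes "blf_bound n f c"
  shows "blf_bound n (\<lambda>i j. a * f i j) (\<bar>a\<bar> * c)"
  using assms unfolding blf_bound_def blf_cmult by (simp add: abs_mult mult_left_mono mult.assoc)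

text \<open>An entrywise product with the rank-one array u i * v j is a two-sided diagonal scaling,
  and the diagonals can be moved onto the test vectors. This is where a product structure of the
  entries is exploited.\<close>

lemma blf_bound_diag:
  assumes f: "blf_bound n f c" and c: "0 \<le> c"
    and u: "\<And>i. i < n \<Longrightarrow> \<bar>u i\<bar> \<le> a" and v: "\<And>i. i < n \<Longrightarrow> \<bar>v i\<bar> \<le> b"
    and ab: "0 \<le> a" "0 \<le> b"
  shows "blf_bound n (\<lambda>i j. u i * v j * f i j) (a * b * c)"
  unfolding blf_bound_def
proof (intro allI)
  fix y z
  have "blf n (\<lambda>i j. u i * v j * f i j) y z = blf n f (\<lambda>i. u i * y i) (\<lambda>j. v j * z j)"
    unfolding blf_def by (simp add: algebra_simps)
  moreover have "\<bar>blf n f (\<lambda>i. u i * y i) (\<lambda>j. v j * z j)\<bar>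
      \<le> c * L2_set (\<lambda>i. u i * y i) {..<n} * L2_set (\<lambda>j. v j * z j) {..<n}"
    using f unfolding blf_bound_def by blast
  moreover have "L2_set (\<lambda>i. u i * y i) {..<n} \<le> a * L2_set y {..<n}"
    by (rule L2_set_abs_le_mult) (use u ab in \<open>auto simp: abs_mult mult_right_mono\<close>)
  moreover have "L2_set (\<lambda>i. v i * z i) {..<n} \<le> b * L2_set z {..<n}"
    by (rule L2_set_abs_le_mult) (use v ab in \<open>auto simp: abs_mult mult_right_mono\<close>)
  ultimately have "\<bar>blf n (\<lambda>i j. u i * v j * f i j) y z\<bar>
      \<le> c * (a * L2_set y {..<n}) * (b * L2_set z {..<n})"
    by (smt (verit) mult_mono mult_nonneg_nonneg L2_set_nonneg c ab)
  then show "\<bar>blf n (\<lambda>i j. u i * v j * f i j) y z\<bar> \<le> a * b * c * L2_set y {..<n} * L2_set z {..<n}"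
    by (simp add: algebra_simps)
qed

text \<open>Cauchy-Schwarz is applied twice, in j for each fixed row and then in i.\<close>

lemma blf_bound_Frobenius:
  "blf_bound n f (L2_set (\<lambda>i. L2_set (f i) {..<n}) {..<n})"
  unfolding blf_bound_def
proof (intro allI)
  fix y z
  let ?F = "L2_set (\<lambda>i. L2_set (f i) {..<n}) {..<n}"
  have "\<bar>blf n f y z\<bar> \<le> (\<Sum>i<n. \<bar>y i\<bar> * \<bar>\<Sum>j<n. f i j * z j\<bar>)"
    unfolding blf_def
    by (rule order_trans[OF sum_abs]) (simp add: abs_mult mult.assoc flip: sum_distrib_left)
  also have "\<dots> \<le> (\<Sum>i<n. \<bar>y i\<bar> * (L2_set (f i) {..<n} * L2_set z {..<n}))"
  proof (rule sum_mono, rule mult_left_mono)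
    fix i
    have "\<bar>\<Sum>j<n. f i j * z j\<bar> \<le> (\<Sum>j<n. \<bar>f i j\<bar> * \<bar>z j\<bar>)"
      by (rule order_trans[OF sum_abs]) (simp add: abs_mult)
    also have "\<dots> \<le> L2_set (f i) {..<n} * L2_set z {..<n}"
      by (rule L2_set_mult_ineq)
    finally show "\<bar>\<Sum>j<n. f i j * z j\<bar> \<le> L2_set (f i) {..<n} * L2_set z {..<n}" .
  qed simp
  also have "\<dots> = (\<Sum>i<n. \<bar>y i\<bar> * \<bar>L2_set (f i) {..<n}\<bar>) * L2_set z {..<n}"
    by (simp add: sum_distrib_right mult.assoc)
  also have "\<dots> \<le> (L2_set y {..<n} * ?F) * L2_set z {..<n}"
    by (rule mult_right_mono[OF L2_set_mult_ineq]) simp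
  finally show "\<bar>blf n f y z\<bar> \<le> ?F * L2_set y {..<n} * L2_set z {..<n}"
    by (simp add: algebra_simps)
qed

text \<open>Keeping the \<open>l\<^sup>2\<close> norm of \<open>u\<close> instead of \<open>sqrt n\<close> times its maximum is what saves the factor \<open>sqrt (ln n)\<close>.\<close>

lemma blf_bound_of_abs_le_sum:
  assumes f: "\<And>i j. i < n \<Longrightarrow> j < n \<Longrightarrow> \<bar>f i j\<bar> \<le> s + u i + u j"
    and s: "0 \<le> s" and u: "\<And>i. i < n \<Longrightarrow> 0 \<le> u i"
  shows "blf_bound n f (real n * s + 2 * sqrt (real n) * L2_set u {..<n})"
proof -
  have row: "L2_set (f i) {..<n} \<le> (s * sqrt n + L2_set u {..<n}) + sqrt n * u i" if "i < n" for i
  proof -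
    have "L2_set (f i) {..<n} \<le> L2_set (\<lambda>j. (s + u i) + u j) {..<n}"
      by (rule L2_set_le_of_abs_le) (use f that in auto)
    also have "\<dots> \<le> L2_set (\<lambda>j. s + u i) {..<n} + L2_set u {..<n}"
      by (rule L2_set_triangle_ineq)
    finally show ?thesis
      unfolding L2_set_const using s u[OF that] by (simp add: algebra_simps)
  qed
  have "L2_set (\<lambda>i. L2_set (f i) {..<n}) {..<n}
      \<le> L2_set (\<lambda>i. (s * sqrt n + L2_set u {..<n}) + sqrt n * u i) {..<n}"
    by (rule L2_set_mono) (use row in auto)
  also have "\<dots> \<le> L2_set (\<lambda>i. s * sqrt n + L2_set u {..<n}) {..<n}
      + L2_set (\<lambda>i. sqrt n * u i) {..<n}"
    by (rule L2_set_triangle_ineq)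
  also have "\<dots> = (s * sqrt n + L2_set u {..<n}) * sqrt n + sqrt n * L2_set u {..<n}"
    unfolding L2_set_const L2_set_cmult using s by simp
  also have "\<dots> = real n * s + 2 * sqrt (real n) * L2_set u {..<n}"
    by (simp add: algebra_simps)
  finally show ?thesis
    using blf_bound_Frobenius blf_bound_mono by blast
qed

lemma blf_bound_of_abs_le:
  assumes "\<And>i j. i < n \<Longrightarrow> j < n \<Longrightarrow> \<bar>f i j\<bar> \<le> s" "0 \<le> s"
  shows "blf_bound n f (real n * s)"
  using blf_bound_of_abs_le_sum[of n f s "\<lambda>_. 0"] assms by (simp add: L2_set_const)

lemma blf_bound_nonneg_exists: "\<exists>c\<ge>0. blf_bound n f c"
  using blf_bound_Frobenius L2_set_nonneg by blast

text \<open>Testing the form at w = Bv and v gives |w|^2 \<le> c |w| |v|, and one factor |w|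
  cancels. Nonnegativity is proved alongside because \<open>op_norm\<close> is a supremum of reals,
  and it is the same bound that makes the set bounded above.\<close>

lemma op_norm_le_of_blf_bound:
  assumes B: "B \<in> carrier_mat n n" and b: "blf_bound n (\<lambda>i j. B $$ (i,j)) c" and c: "0 \<le> c"
  shows "op_norm B \<le> c" "0 \<le> op_norm B"
proof -
  let ?V = "{v \<in> carrier_vec (dim_col B). vec_l2_norm v \<le> 1}"
  have le: "vec_l2_norm (B *\<^sub>v v) \<le> c" if v: "v \<in> ?V" for v
  proof -
    define w where "w = (\<lambda>i. (B *\<^sub>v v) $ i)"
    have dv: "v \<in> carrier_vec n" "L2_set (\<lambda>i. v $ i) {..<n} \<le> 1"
      using v B unfolding vec_l2_norm_def by auto
    have w: "w i = (\<Sum>j<n. B $$ (i,j) * v $ j)" if "i < n" for i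
      unfolding w_def using B dv that by (auto simp: scalar_prod_def lessThan_atLeast0)
    have eq: "vec_l2_norm (B *\<^sub>v v) = L2_set w {..<n}"
      unfolding vec_l2_norm_def w_def using B by simp
    have "(L2_set w {..<n})\<^sup>2 = (\<Sum>i<n. w i * w i)"
      unfolding L2_set_def by (simp add: sum_nonneg power2_eq_square)
    also have "\<dots> = blf n (\<lambda>i j. B $$ (i,j)) w (\<lambda>j. v $ j)"
      unfolding blf_def by (rule sum.cong) (auto simp: w sum_distrib_left algebra_simps)
    also have "\<dots> \<le> c * L2_set w {..<n} * L2_set (\<lambda>j. v $ j) {..<n}"
      using b unfolding blf_bound_def by (smt (verit))
    also have "\<dots> \<le> c * L2_set w {..<n} * 1"
      using dv c by (intro mult_left_mono) auto
    finally have "L2_set w {..<n} * L2_set w {..<n} \<le> c * L2_set w {..<n}"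
      by (simp add: power2_eq_square)
    then show ?thesis
      unfolding eq using c by (smt (verit) L2_set_nonneg mult_right_mono mult_right_le_imp_le mult_le_cancel_right)
  qed
  have zero: "0\<^sub>v n \<in> ?V"
    using B by (auto simp: vec_l2_norm_def L2_set_def)
  show "op_norm B \<le> c" unfolding op_norm_def
    by (rule cSUP_least) (use zero le in auto)
  have "vec_l2_norm (B *\<^sub>v 0\<^sub>v n) \<le> op_norm B" unfolding op_norm_def
    by (rule cSUP_upper[OF zero]) (use le in \<open>auto intro!: bdd_aboveI2\<close>)
  then show "0 \<le> op_norm B"
    by (rule order_trans[rotated]) (simp add: vec_l2_norm_def)
qed

text \<open>The points of the grid \<open>(1 / (4 sqrt n)) Z\<^sup>n\<close> in the unit ball form a quarter-net there.\<close>

definition ball_net :: "nat \<Rightarrow> (nat \<Rightarrow> real) set" where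
  "ball_net n = (\<lambda>k i. real_of_int (k i) / (4 * sqrt n)) `
     {k \<in> {..<n} \<rightarrow>\<^sub>E {-4 * int n..4 * int n}. (\<Sum>i<n. (k i)\<^sup>2) \<le> 16 * int n}"

lemma finite_ball_net: "finite (ball_net n)"
proof -
  have "finite ({..<n} \<rightarrow>\<^sub>E {-4 * int n..4 * int n})" by (rule finite_PiE) auto
  then show ?thesis unfolding ball_net_def by (simp add: finite_subset)
qed

lemma ball_net_norm_le:
  assumes "y \<in> ball_net n"
  shows "L2_set y {..<n} \<le> 1"
proof -
  obtain k where k: "(\<Sum>i<n. (k i)\<^sup>2) \<le> 16 * int n"
    and y: "y = (\<lambda>i. real_of_int (k i) / (4 * sqrt n))"
    using assms unfolding ball_net_def by auto
  have "(\<Sum>i<n. (y i)\<^sup>2) = real_of_int (\<Sum>i<n. (k i)\<^sup>2) / (16 * n)"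
    unfolding y by (simp add: power_divide power_mult_distrib sum_divide_distrib)
  also have "\<dots> \<le> real_of_int (16 * int n) / (16 * n)"
    by (rule divide_right_mono) (use k of_int_le_iff in blast, simp)
  also have "\<dots> \<le> 1" by simp
  finally show ?thesis unfolding L2_set_def by simp
qed

text \<open>Each coordinate of a grid point contributes one such geometric series to the count in
  \<open>card_ball_net\<close>.\<close>

lemma sum_half_powers_le: "(\<Sum>k=-int m..int m. (1/2::real) ^ nat \<bar>k\<bar>) \<le> 3"
proof -
  have "(\<Sum>k=-int m..int m. (1/2::real) ^ nat \<bar>k\<bar>) = 3 - 2 * (1/2) ^ m"
  proof (induction m)
    case (Suc m)
    have "{-int (Suc m)..int (Suc m)} = insert (-int (Suc m)) (insert (int (Suc m)) {-int m..int m})"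
      by auto
    then show ?case using Suc by (simp add: nat_add_distrib)
  qed simp
  then show ?thesis by simp
qed

text \<open>Counting by a generating function: for integers \<bar>k\<bar> \<le> k^2, so every
  admissible k satisfies 1 \<le> 2^(16 n) times the product of the weights 2^(-\<bar>k i\<bar>).
  Summing the weights over the whole box factorizes into n series, each at most 3. The constant 18
  comes from 2^16 * 3 \<le> 2^18 and 2 \<le> exp 1.\<close>

lemma card_ball_net: "real (card (ball_net n)) \<le> exp (18 * real n)"
proof -
  let ?P = "{..<n} \<rightarrow>\<^sub>E {-4 * int n..4 * int n}"
  let ?K = "{k \<in> ?P. (\<Sum>i<n. (k i)\<^sup>2) \<le> 16 * int n}"
  have fin: "finite ?P" by (rule finite_PiE) auto
  have "real (card (ball_net n)) \<le> real (card ?K)"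
    unfolding ball_net_def using fin by (intro of_nat_mono card_image_le) simp
  also have "\<dots> = (\<Sum>k\<in>?K. 1)" by simp
  also have "\<dots> \<le> (\<Sum>k\<in>?K. 2 ^ (16 * n) * (\<Prod>i<n. (1/2) ^ nat \<bar>k i\<bar>))"
  proof (rule sum_mono)
    fix k assume k: "k \<in> ?K"
    have "(\<Sum>i<n. \<bar>k i\<bar>) \<le> (\<Sum>i<n. (k i)\<^sup>2)"
    proof (rule sum_mono)
      fix i
      have "\<bar>k i\<bar> * 1 \<le> \<bar>k i\<bar> * \<bar>k i\<bar>"
        by (cases "k i = 0") (simp, intro mult_left_mono, auto)
      then show "\<bar>k i\<bar> \<le> (k i)\<^sup>2" by (simp add: power2_eq_square)
    qed
    also have "\<dots> \<le> 16 * int n" using k by auto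
    finally have "int (\<Sum>i<n. nat \<bar>k i\<bar>) \<le> int (16 * n)" by simp
    then have "(\<Sum>i<n. nat \<bar>k i\<bar>) \<le> 16 * n" by (simp only: of_nat_le_iff)
    then have "(1/2::real) ^ (16 * n) \<le> (1/2) ^ (\<Sum>i<n. nat \<bar>k i\<bar>)"
      by (intro power_decreasing) auto
    then have "1 \<le> (2::real) ^ (16 * n) * (1/2) ^ (\<Sum>i<n. nat \<bar>k i\<bar>)"
      by (simp add: power_one_over field_simps)
    then show "1 \<le> (2::real) ^ (16 * n) * (\<Prod>i<n. (1/2) ^ nat \<bar>k i\<bar>)"
      by (simp add: power_sum)
  qed
  also have "\<dots> \<le> (\<Sum>k\<in>?P. 2 ^ (16 * n) * (\<Prod>i<n. (1/2) ^ nat \<bar>k i\<bar>))"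
    by (rule sum_mono2[OF fin]) (blast, simp add: prod_nonneg)
  also have "\<dots> = 2 ^ (16 * n) * (\<Prod>i<n. \<Sum>k=-4 * int n..4 * int n. (1/2) ^ nat \<bar>k\<bar>)"
    by (subst prod_sum_PiE) (simp_all add: sum_distrib_left)
  also have "\<dots> \<le> 2 ^ (16 * n) * (\<Prod>i<n. 3)"
    using sum_half_powers_le[of "4 * n"]
    by (intro mult_left_mono prod_mono) (auto intro!: sum_nonneg)
  also have "\<dots> = (2 ^ 16 * 3) ^ n" by (simp only: power_mult_distrib power_mult prod_constant card_lessThan)
  also have "\<dots> \<le> (exp 18) ^ n"
  proof (rule power_mono)
    have "(2::real) ^ 18 \<le> exp 1 ^ 18" by (rule power_mono) (use exp_ge_add_one_self[of 1] in auto)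
    then show "(2::real) ^ 16 * 3 \<le> exp 18" by (simp flip: exp_of_nat_mult)
  qed simp
  also have "\<dots> = exp (18 * real n)" by (simp add: exp_of_nat_mult[symmetric] mult.commute)
  finally show ?thesis .
qed

lemma ball_net_approx:
  assumes n: "0 < n" and y: "L2_set y {..<n} \<le> 1"
  shows "\<exists>v\<in>ball_net n. L2_set (\<lambda>i. y i - v i) {..<n} \<le> 1/4"
proof -
  define s where "s = 4 * sqrt n"
  have s: "s > 0" "s\<^sup>2 = 16 * n" using n unfolding s_def by (auto simp: power_mult_distrib)
  \<comment> \<open>Rounding towards zero never increases the modulus of a coordinate, so the
    rounded point stays in the unit ball. The coordinate error is at most 1 / s, hence the l2 error
    at most sqrt n / (4 sqrt n) = 1/4.\<close>
  define k where "k i = (if i < n then if 0 \<le> y i then \<lfloor>s * y i\<rfloor> else \<lceil>s * y i\<rceil> else undefined)" for i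
  have k_abs: "\<bar>real_of_int (k i)\<bar> \<le> \<bar>s * y i\<bar>" if "i < n" for i
  proof (cases "0 \<le> y i")
    case True
    then have "0 \<le> s * y i" using s by simp
    then show ?thesis using True that unfolding k_def by (simp; linarith)
  next
    case False
    then have "s * y i \<le> 0" using s by (simp add: mult_nonneg_nonpos)
    then show ?thesis using False that unfolding k_def by (simp; linarith)
  qed
  have k_near: "\<bar>s * y i - real_of_int (k i)\<bar> \<le> 1" if "i < n" for i
    using that unfolding k_def by (simp; linarith)
  have ysum: "(\<Sum>i<n. (y i)\<^sup>2) \<le> 1" using y unfolding L2_set_def by simp
  have "real_of_int (\<Sum>i<n. (k i)\<^sup>2) \<le> (\<Sum>i<n. (s * y i)\<^sup>2)"
    unfolding of_int_sum of_int_power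
    by (rule sum_mono, rule iffD1[OF abs_le_square_iff], rule k_abs) simp
  also have "\<dots> = 16 * n * (\<Sum>i<n. (y i)\<^sup>2)"
    by (simp add: power_mult_distrib s sum_distrib_left)
  also have "\<dots> \<le> real (16 * n) * 1" using ysum by (rule mult_left_mono) simp
  finally have "real_of_int (\<Sum>i<n. (k i)\<^sup>2) \<le> real_of_int (16 * int n)" by simp
  then have ksum: "(\<Sum>i<n. (k i)\<^sup>2) \<le> 16 * int n" by (simp only: of_int_le_iff)
  have krange: "\<bar>k i\<bar> \<le> 4 * int n" if i: "i < n" for i
  proof -
    have "(k i)\<^sup>2 \<le> (\<Sum>i<n. (k i)\<^sup>2)" by (rule member_le_sum) (use i in auto)
    also have "\<dots> \<le> 16 * int n" by (rule ksum)
    also have "\<dots> \<le> (4 * int n)\<^sup>2" using n by (simp add: power2_eq_square)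
    finally have "\<bar>k i\<bar> \<le> \<bar>4 * int n\<bar>" by (simp only: abs_le_square_iff)
    then show ?thesis by simp
  qed
  define v where "v = (\<lambda>i. real_of_int (k i) / s)"
  have "v \<in> ball_net n"
    unfolding ball_net_def v_def s_def
  proof (rule image_eqI[of _ _ k])
    have "k \<in> {..<n} \<rightarrow>\<^sub>E {-4 * int n..4 * int n}"
    proof (rule PiE_I)
      fix i assume "i \<in> {..<n}"
      then show "k i \<in> {-4 * int n..4 * int n}" using krange[of i] by (simp add: abs_le_iff)
    next
      fix i assume "i \<notin> {..<n}"
      then show "k i = undefined" unfolding k_def by simp
    qed
    then show "k \<in> {k \<in> {..<n} \<rightarrow>\<^sub>E {-4 * int n..4 * int n}. (\<Sum>i<n. (k i)\<^sup>2) \<le> 16 * int n}"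
      using ksum by blast
  qed simp
  moreover have "L2_set (\<lambda>i. y i - v i) {..<n} \<le> L2_set (\<lambda>i. 1 / s) {..<n}"
  proof (rule L2_set_le_of_abs_le)
    fix i assume "i \<in> {..<n}"
    then have "\<bar>s * y i - real_of_int (k i)\<bar> / s \<le> 1 / s"
      using k_near s by (intro divide_right_mono) auto
    moreover have "y i - v i = (s * y i - real_of_int (k i)) / s"
      unfolding v_def using s(1) by (simp add: diff_divide_distrib)
    then have "\<bar>y i - v i\<bar> = \<bar>s * y i - real_of_int (k i)\<bar> / s"
      using s(1) by (simp only: abs_divide abs_of_pos)
    ultimately show "\<bar>y i - v i\<bar> \<le> 1 / s" by simp
  qed
  moreover have "L2_set (\<lambda>i. 1 / s) {..<n} = 1/4"
    unfolding L2_set_const using n unfolding s_def by simp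
  ultimately show ?thesis by auto
qed

text \<open>Let N be the supremum of the form over pairs in the unit ball, finite by the Frobenius
  bound. Replacing each of the two vectors by a net point costs at most N / 4, so N \<le> c + N /
  2.\<close>

lemma blf_bound_of_ball_net:
  assumes n: "0 < n" and net: "\<And>v w. v \<in> ball_net n \<Longrightarrow> w \<in> ball_net n \<Longrightarrow> \<bar>blf n f v w\<bar> \<le> c"
  shows "blf_bound n f (2 * c)"
proof -
  define S where "S = {\<bar>blf n f y z\<bar> | y z. L2_set y {..<n} \<le> 1 \<and> L2_set z {..<n} \<le> 1}"
  define N where "N = Sup S"
  obtain b where b: "0 \<le> b" "blf_bound n f b" using blf_bound_nonneg_exists by blast
  have "x \<le> b" if "x \<in> S" for x
  proof -
    obtain y z where x: "x = \<bar>blf n f y z\<bar>" "L2_set y {..<n} \<le> 1" "L2_set z {..<n} \<le> 1"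
      using \<open>x \<in> S\<close> unfolding S_def by auto
    have "x \<le> b * L2_set y {..<n} * L2_set z {..<n}"
      using b x unfolding blf_bound_def by auto
    also have "\<dots> \<le> b * 1 * 1" using b x by (intro mult_mono) auto
    finally show ?thesis by simp
  qed
  then have bdd: "bdd_above S" by (rule bdd_aboveI)
  have S_ne: "S \<noteq> {}"
    unfolding S_def by (auto intro!: exI[of _ "\<lambda>_. 0"] simp: L2_set_const)
  have N: "\<bar>blf n f y z\<bar> \<le> N * L2_set y {..<n} * L2_set z {..<n}" for y z
  proof (cases "L2_set y {..<n} = 0 \<or> L2_set z {..<n} = 0")
    \<comment> \<open>A vector of norm zero cannot be normalized; here the finite bound
      \<open>b\<close> already forces the form to vanish.\<close>
    case True
    have "\<bar>blf n f y z\<bar> \<le> b * L2_set y {..<n} * L2_set z {..<n}"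
      using b unfolding blf_bound_def by auto
    then show ?thesis using True by auto
  next
    case False
    define ly lz where "ly = L2_set y {..<n}" and "lz = L2_set z {..<n}"
    have pos: "ly > 0" "lz > 0" using False unfolding ly_def lz_def
      by (auto simp: less_le L2_set_nonneg)
    have "\<bar>blf n f (\<lambda>i. 1/ly * y i) (\<lambda>i. 1/lz * z i)\<bar> \<in> S"
    proof -
      have "L2_set (\<lambda>i. 1/ly * y i) {..<n} \<le> 1" "L2_set (\<lambda>i. 1/lz * z i) {..<n} \<le> 1"
        unfolding L2_set_cmult using pos unfolding ly_def lz_def by auto
      then show ?thesis unfolding S_def by blast
    qed
    then have "\<bar>blf n f (\<lambda>i. 1/ly * y i) (\<lambda>i. 1/lz * z i)\<bar> \<le> N"
      unfolding N_def using bdd by (rule cSup_upper)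
    then have "\<bar>blf n f y z\<bar> / (ly * lz) \<le> N"
      unfolding blf_scale using pos by (simp add: abs_mult)
    then show ?thesis using pos unfolding ly_def[symmetric] lz_def[symmetric]
      by (simp add: field_simps)
  qed
  have "N \<le> c + N / 2" unfolding N_def
  proof (rule cSup_least[OF S_ne], unfold N_def[symmetric])
    fix x assume "x \<in> S"
    then obtain y z where x: "x = \<bar>blf n f y z\<bar>" "L2_set y {..<n} \<le> 1" "L2_set z {..<n} \<le> 1"
      unfolding S_def by auto
    obtain v w where v: "v \<in> ball_net n" "L2_set (\<lambda>i. y i - v i) {..<n} \<le> 1/4"
      and w: "w \<in> ball_net n" "L2_set (\<lambda>i. z i - w i) {..<n} \<le> 1/4"
      using ball_net_approx[OF n] x by meson
    have N0: "0 \<le> N"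
    proof -
      have "x \<le> N" unfolding N_def by (rule cSup_upper[OF \<open>x \<in> S\<close> bdd])
      then show ?thesis using x by linarith
    qed
    have "blf n f y z = blf n f (\<lambda>i. y i - v i) z + blf n f v (\<lambda>i. z i - w i) + blf n f v w"
      unfolding blf_diff_left blf_diff_right by simp
    moreover have "\<bar>blf n f (\<lambda>i. y i - v i) z\<bar> \<le> N * (1/4) * 1"
      using v x N0 by (intro order_trans[OF N] mult_mono) auto
    moreover have "\<bar>blf n f v (\<lambda>i. z i - w i)\<bar> \<le> N * 1 * (1/4)"
      using w v ball_net_norm_le[OF v(1)] N0 by (intro order_trans[OF N] mult_mono) auto
    moreover have "\<bar>blf n f v w\<bar> \<le> c" using net v w by auto
    ultimately show "x \<le> c + N / 2" unfolding x(1) by linarith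
  qed
  then have "N \<le> 2 * c" by simp
  moreover have "blf_bound n f N" unfolding blf_bound_def using N by auto
  ultimately show ?thesis by (rule blf_bound_mono[rotated])
qed

section \<open>Moments of a symmetric noise matrix\<close>

abbreviation upper_pairs :: "nat \<Rightarrow> (nat \<times> nat) set" where
  "upper_pairs n \<equiv> {(i, j). i \<le> j \<and> j < n}"

lemma finite_upper_pairs: "finite (upper_pairs n)"
  by (rule finite_subset[of _ "{..<n} \<times> {..<n}"]) auto

text \<open>Entries (i,j) and (j,i) of a symmetric noise matrix are the same variable. Grouping them
  leaves a sum over the independent entries only.\<close>

lemma sum_square_eq_sum_upper_pairs:
  fixes h :: "nat \<Rightarrow> nat \<Rightarrow> real"
  shows "(\<Sum>i<n. \<Sum>j<n. h i j) = (\<Sum>(i,j)\<in>upper_pairs n. if i = j then h i i else h i j + h j i)"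
proof -
  let ?L = "{(i, j). j < i \<and> i < n}"
  have split: "{..<n} \<times> {..<n} = upper_pairs n \<union> ?L" by auto
  have finL: "finite ?L" by (rule finite_subset[of _ "{..<n} \<times> {..<n}"]) auto
  have "(\<Sum>i<n. \<Sum>j<n. h i j) = (\<Sum>(i,j)\<in>upper_pairs n \<union> ?L. h i j)"
    unfolding sum.cartesian_product split ..
  also have "\<dots> = (\<Sum>(i,j)\<in>upper_pairs n. h i j) + (\<Sum>(i,j)\<in>?L. h i j)"
    by (rule sum.union_disjoint) (use finite_upper_pairs finL in auto)
  also have "(\<Sum>(i,j)\<in>?L. h i j) = (\<Sum>(i,j)\<in>{(i, j). i < j \<and> j < n}. h j i)"
    by (rule sum.reindex_bij_witness[of _ prod.swap prod.swap]) auto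
  also have "\<dots> = (\<Sum>(i,j)\<in>upper_pairs n. if i = j then 0 else h j i)"
    by (rule sum.mono_neutral_cong_left) (use finite_upper_pairs in \<open>auto split: if_splits\<close>)
  also have "(\<Sum>(i,j)\<in>upper_pairs n. h i j) + \<dots>
      = (\<Sum>(i,j)\<in>upper_pairs n. if i = j then h i i else h i j + h j i)"
    unfolding sum.distrib[symmetric] by (rule sum.cong) auto
  finally show ?thesis .
qed

text \<open>Turns an exponential moment into a power moment without integrating tails. Below the
  threshold 2 a s the ratio is at most 2 a. Above it, Z \<le> 2 (Z - a s), and u^m \<le> m! exp u at
  u = Z - a s produces the damping factor exp (- a s), which later pays for the size of the family
  over which the exponentials are summed.\<close>

lemma power_le_of_exp_le:
  fixes a s Z H :: real
  assumes a: "0 \<le> a" and s: "1 \<le> s" and Z: "0 \<le> Z" and H: "exp Z \<le> H"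
  shows "(Z / s) ^ m \<le> (2 * a) ^ m + 2 ^ m * fact m * (exp (- (a * s)) * H)"
proof (cases "Z \<le> 2 * a * s")
  case True
  have "0 \<le> H" using H by (meson exp_ge_zero order_trans)
  have "Z / s \<le> 2 * a" using True s by (simp add: field_simps)
  then have "(Z / s) ^ m \<le> (2 * a) ^ m" by (rule power_mono) (use Z s in auto)
  then show ?thesis using \<open>0 \<le> H\<close> by (smt (verit) exp_ge_zero fact_ge_zero mult_nonneg_nonneg zero_le_power)
next
  case False
  then have half: "Z \<le> 2 * (Z - a * s)" "0 \<le> Z - a * s" using Z by auto
  have "Z / s \<le> Z" using s Z by (simp add: field_simps mult_le_cancel_left1)
  then have "(Z / s) ^ m \<le> (2 * (Z - a * s)) ^ m" using half s Z by (intro power_mono) auto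
  also have "\<dots> = 2 ^ m * (Z - a * s) ^ m" by (rule power_mult_distrib)
  also have "(Z - a * s) ^ m \<le> fact m * exp (Z - a * s)"
  proof -
    \<comment> \<open>A single term of the exponential series is at most its sum.\<close>
    have "(\<Sum>k\<in>{m}. (Z - a * s) ^ k /\<^sub>R fact k) \<le> exp (Z - a * s)"
      unfolding exp_def by (rule sum_le_suminf[OF summable_exp_generic]) (use half in auto)
    then show ?thesis by (simp add: field_simps)
  qed
  also have "exp (Z - a * s) = exp (- (a * s)) * exp Z" by (simp flip: exp_add)
  also have "\<dots> \<le> exp (- (a * s)) * H" using H by simp
  finally have "(Z / s) ^ m \<le> 2 ^ m * (fact m * (exp (- (a * s)) * H))" by simp
  moreover have "0 \<le> (2 * a) ^ m" using a by simp
  ultimately show ?thesis by (simp add: mult.assoc)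
qed

text \<open>Hoeffding's lemma for a range of length one, extended from positive l to every real l by
  passing to -X. Linear forms in the noise have coefficients of both signs.\<close>

lemma (in prob_space) nn_integral_exp_mult_le:
  assumes X: "random_variable borel X" and bnd: "\<And>\<omega>. \<omega> \<in> space M \<Longrightarrow> X \<omega> \<in> {a..a + 1}"
    and mean: "expectation X = 0"
  shows "(\<integral>\<^sup>+\<omega>. ennreal (exp (l * X \<omega>)) \<partial>M) \<le> ennreal (exp (l\<^sup>2 / 8))"
proof -
  have pos: "(\<integral>\<^sup>+\<omega>. ennreal (exp (l * Y \<omega>)) \<partial>M) \<le> ennreal (exp (l\<^sup>2 / 8))"
    if "random_variable borel Y" "\<And>\<omega>. \<omega> \<in> space M \<Longrightarrow> Y \<omega> \<in> {b..b + 1}" "expectation Y = 0" "0 < l"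
    for Y b l
  proof -
    interpret interval_bounded_random_variable M Y b "b + 1"
      by unfold_locales (use that in auto)
    show ?thesis using Hoeffdings_lemma_nn_integral_0[OF that(4,3)] by simp
  qed
  consider "l = 0" | "0 < l" | "l < 0" by linarith
  then show ?thesis
  proof cases
    case 1
    then show ?thesis by (simp add: emeasure_space_1)
  next
    case 2
    then show ?thesis using pos X bnd mean by blast
  next
    case 3
    have "(\<integral>\<^sup>+\<omega>. ennreal (exp ((- l) * (- X \<omega>))) \<partial>M) \<le> ennreal (exp ((- l)\<^sup>2 / 8))"
    proof (rule pos)
      show "- X \<omega> \<in> {- a - 1..- a - 1 + 1}" if "\<omega> \<in> space M" for \<omega> using bnd[OF that] by auto
    qed (use X mean 3 in auto)
    then show ?thesis by simp
  qed
qed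

text \<open>The product formula for independent variables is used for nonnegative integrals first;
  finiteness of the result then yields integrability, which the statement on expectations
  presupposes.\<close>

lemma (in prob_space) expectation_exp_sum_le:
  fixes X :: "'i \<Rightarrow> 'a \<Rightarrow> real" and w :: "'i \<Rightarrow> real"
  assumes I: "finite I" and ind: "indep_vars (\<lambda>_. borel) X I"
    and bnd: "\<And>k \<omega>. k \<in> I \<Longrightarrow> \<omega> \<in> space M \<Longrightarrow> X k \<omega> \<in> {a k..a k + 1}"
    and mean: "\<And>k. k \<in> I \<Longrightarrow> expectation (X k) = 0"
  shows "integrable M (\<lambda>\<omega>. exp (\<Sum>k\<in>I. w k * X k \<omega>))"
    and "expectation (\<lambda>\<omega>. exp (\<Sum>k\<in>I. w k * X k \<omega>)) \<le> exp ((\<Sum>k\<in>I. (w k)\<^sup>2) / 8)"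
proof -
  let ?E = "\<lambda>\<omega>. exp (\<Sum>k\<in>I. w k * X k \<omega>)"
  have rv: "random_variable borel (X k)" if "k \<in> I" for k
    using ind that unfolding indep_vars_def by auto
  have "random_variable borel (\<lambda>\<omega>. w k * X k \<omega>)" if "k \<in> I" for k
    using rv[OF that] by measurable
  then have meas: "random_variable borel ?E"
    by (rule measurable_compose[OF borel_measurable_sum borel_measurable_exp])
  have "(\<integral>\<^sup>+\<omega>. ennreal (?E \<omega>) \<partial>M) = (\<integral>\<^sup>+\<omega>. (\<Prod>k\<in>I. ennreal (exp (w k * X k \<omega>))) \<partial>M)"
    using I by (simp add: exp_sum prod_ennreal)
  also have "\<dots> = (\<Prod>k\<in>I. \<integral>\<^sup>+\<omega>. ennreal (exp (w k * X k \<omega>)) \<partial>M)"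
  proof (rule indep_vars_nn_integral[OF I])
    show "indep_vars (\<lambda>_. borel) (\<lambda>k \<omega>. ennreal (exp (w k * X k \<omega>))) I"
      by (rule indep_vars_compose2[OF ind, where Y = "\<lambda>k x. ennreal (exp (w k * x))"]) measurable
  qed simp
  also have "\<dots> \<le> (\<Prod>k\<in>I. ennreal (exp ((w k)\<^sup>2 / 8)))"
    by (rule prod_mono_ennreal) (use nn_integral_exp_mult_le[OF rv bnd mean] in auto)
  also have "\<dots> = ennreal (exp ((\<Sum>k\<in>I. (w k)\<^sup>2) / 8))"
    using I by (simp add: prod_ennreal exp_sum sum_divide_distrib)
  finally have nn: "(\<integral>\<^sup>+\<omega>. ennreal (?E \<omega>) \<partial>M) \<le> ennreal (exp ((\<Sum>k\<in>I. (w k)\<^sup>2) / 8))" .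
  show int: "integrable M ?E"
  proof (rule integrableI_nonneg)
    show "(\<integral>\<^sup>+\<omega>. ennreal (?E \<omega>) \<partial>M) < \<infinity>" using nn by (rule le_less_trans) simp
  qed (use meas in auto)
  have "ennreal (expectation ?E) \<le> ennreal (exp ((\<Sum>k\<in>I. (w k)\<^sup>2) / 8))"
    using nn by (subst nn_integral_eq_integral[symmetric]) (use int in auto)
  then show "expectation ?E \<le> exp ((\<Sum>k\<in>I. (w k)\<^sup>2) / 8)" by simp
qed

text \<open>A centred Bernoulli variable lies in an interval of length one starting at minus its
  mean. Only this length and the zero mean enter, so the moment bounds are uniform in the edge
  probabilities.\<close>

locale symmetric_noise = prob_space P for P :: "'a measure" +
  fixes n :: nat and X :: "nat \<Rightarrow> nat \<Rightarrow> 'a \<Rightarrow> real" and a :: "nat \<Rightarrow> nat \<Rightarrow> real"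
  assumes X_sym: "\<And>i j \<omega>. \<omega> \<in> space P \<Longrightarrow> i < n \<Longrightarrow> j < n \<Longrightarrow> X i j \<omega> = X j i \<omega>"
    and X_indep: "indep_vars (\<lambda>_. borel) (\<lambda>(i, j). X i j) (upper_pairs n)"
    and X_range: "\<And>i j \<omega>. \<omega> \<in> space P \<Longrightarrow> i \<le> j \<Longrightarrow> j < n \<Longrightarrow> X i j \<omega> \<in> {a i j..a i j + 1}"
    and X_mean: "\<And>i j. i \<le> j \<Longrightarrow> j < n \<Longrightarrow> expectation (X i j) = 0"

definition sign_array :: "nat \<Rightarrow> (nat \<Rightarrow> nat \<Rightarrow> real) \<Rightarrow> bool" where
  "sign_array n r \<longleftrightarrow> (\<forall>i<n. \<forall>j<n. \<bar>r i j\<bar> = 1 \<and> r i j = r j i)"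

context symmetric_noise
begin

text \<open>The signs enter only through the squares of the coefficients, where they disappear. An
  off-diagonal pair has coefficient y i z j + y j z i up to sign, and (a + b)^2 \<le> 2 a^2 + 2 b^2
  bounds the sum of squares by 2 |y|^2 |z|^2; the constant 1/8 of Hoeffding's lemma becomes
  1/4.\<close>

lemma expectation_exp_blf_le:
  assumes r: "sign_array n r"
  shows "integrable P (\<lambda>\<omega>. exp (blf n (\<lambda>i j. r i j * X i j \<omega>) y z))"
    and "expectation (\<lambda>\<omega>. exp (blf n (\<lambda>i j. r i j * X i j \<omega>) y z))
      \<le> exp ((L2_set y {..<n})\<^sup>2 * (L2_set z {..<n})\<^sup>2 / 4)"
proof -
  define w where "w = (\<lambda>(i, j). r i j * (if i = j then y i * z i else y i * z j + y j * z i))"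
  have blf_eq: "blf n (\<lambda>i j. r i j * X i j \<omega>) y z = (\<Sum>k\<in>upper_pairs n. w k * (case k of (i, j) \<Rightarrow> X i j) \<omega>)"
    if "\<omega> \<in> space P" for \<omega>
    unfolding blf_def sum_square_eq_sum_upper_pairs
  proof (rule sum.cong, simp, clarify)
    fix i j assume ij: "i \<le> j" "j < n"
    then have "X j i \<omega> = X i j \<omega>" "r j i = r i j"
      using X_sym[OF that] r unfolding sign_array_def by auto
    then show "(if i = j then y i * (r i i * X i i \<omega>) * z i
        else y i * (r i j * X i j \<omega>) * z j + y j * (r j i * X j i \<omega>) * z i) = w (i, j) * X i j \<omega>"
      unfolding w_def by (simp add: algebra_simps)
  qed
  have w2: "(\<Sum>k\<in>upper_pairs n. (w k)\<^sup>2) \<le> 2 * ((L2_set y {..<n})\<^sup>2 * (L2_set z {..<n})\<^sup>2)"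
  proof -
    have sq: "(r i j)\<^sup>2 = 1" if "i < n" "j < n" for i j
      using r that unfolding sign_array_def by (metis power2_abs one_power2)
    have "(\<Sum>k\<in>upper_pairs n. (w k)\<^sup>2)
      \<le> (\<Sum>(i,j)\<in>upper_pairs n. if i = j then 2 * ((y i)\<^sup>2 * (z i)\<^sup>2)
          else 2 * ((y i)\<^sup>2 * (z j)\<^sup>2) + 2 * ((y j)\<^sup>2 * (z i)\<^sup>2))"
    proof (rule sum_mono, clarify)
      fix i j assume ij: "i \<le> j" "j < n"
      have "(y i * z j + y j * z i)\<^sup>2 \<le> 2 * ((y i)\<^sup>2 * (z j)\<^sup>2) + 2 * ((y j)\<^sup>2 * (z i)\<^sup>2)"
        using sum_squares_ge_zero[of "y i * z j - y j * z i" 0]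
        by (simp add: power2_eq_square algebra_simps)
      then show "(w (i, j))\<^sup>2 \<le> (if i = j then 2 * ((y i)\<^sup>2 * (z i)\<^sup>2)
          else 2 * ((y i)\<^sup>2 * (z j)\<^sup>2) + 2 * ((y j)\<^sup>2 * (z i)\<^sup>2))"
        unfolding w_def using ij sq[of i j] by (auto simp: power_mult_distrib)
    qed
    also have "\<dots> = (\<Sum>i<n. \<Sum>j<n. 2 * ((y i)\<^sup>2 * (z j)\<^sup>2))"
      by (rule sum_square_eq_sum_upper_pairs[symmetric])
    also have "\<dots> = 2 * ((\<Sum>i<n. (y i)\<^sup>2) * (\<Sum>j<n. (z j)\<^sup>2))"
      unfolding sum_product by (simp add: sum_distrib_left)
    also have "\<dots> = 2 * ((L2_set y {..<n})\<^sup>2 * (L2_set z {..<n})\<^sup>2)"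
      unfolding L2_set_def by (simp add: sum_nonneg)
    finally show ?thesis .
  qed
  have E: "integrable P (\<lambda>\<omega>. exp (\<Sum>k\<in>upper_pairs n. w k * (case k of (i, j) \<Rightarrow> X i j) \<omega>))"
    "expectation (\<lambda>\<omega>. exp (\<Sum>k\<in>upper_pairs n. w k * (case k of (i, j) \<Rightarrow> X i j) \<omega>))
      \<le> exp ((\<Sum>k\<in>upper_pairs n. (w k)\<^sup>2) / 8)"
    using X_range X_mean
    by (auto intro!: expectation_exp_sum_le[OF finite_upper_pairs X_indep, where a = "case_prod a"])
  show "integrable P (\<lambda>\<omega>. exp (blf n (\<lambda>i j. r i j * X i j \<omega>) y z))"
    using E(1) by (subst Bochner_Integration.integrable_cong[OF refl]) (simp_all add: blf_eq)
  have "expectation (\<lambda>\<omega>. exp (blf n (\<lambda>i j. r i j * X i j \<omega>) y z))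
    = expectation (\<lambda>\<omega>. exp (\<Sum>k\<in>upper_pairs n. w k * (case k of (i, j) \<Rightarrow> X i j) \<omega>))"
    by (rule Bochner_Integration.integral_cong) (simp_all add: blf_eq)
  also have "\<dots> \<le> exp ((\<Sum>k\<in>upper_pairs n. (w k)\<^sup>2) / 8)" by (rule E(2))
  also have "\<dots> \<le> exp ((L2_set y {..<n})\<^sup>2 * (L2_set z {..<n})\<^sup>2 / 4)" using w2 by simp
  finally show "expectation (\<lambda>\<omega>. exp (blf n (\<lambda>i j. r i j * X i j \<omega>) y z))
      \<le> exp ((L2_set y {..<n})\<^sup>2 * (L2_set z {..<n})\<^sup>2 / 4)" .
qed

text \<open>A union bound in integrated form: one integrable function dominates the m-th powers for
  all pairs in F at once. Adding the exponential at -y to the one at y dominates the exponential of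
  the absolute value, whence the factor 2 in front of the cardinality. The hypothesis
  \<open>card\<close> says that exp (- d s) compensates for the number of exponentials and their
  common bound.\<close>

lemma blf_moment_dominator:
  assumes r: "sign_array n r" and F: "finite F" and s: "1 \<le> s" and d: "0 \<le> d"
    and norms: "\<And>y z. (y, z) \<in> F \<Longrightarrow> (L2_set y {..<n})\<^sup>2 * (L2_set z {..<n})\<^sup>2 \<le> b"
    and card: "2 * real (card F) * exp (b / 4) \<le> exp (d * s)"
  shows "\<exists>G. integrable P G \<and> expectation G \<le> (2 * d) ^ m + 2 ^ m * fact m \<and>
    (\<forall>\<omega>\<in>space P. 0 \<le> G \<omega> \<and> (\<forall>(y, z)\<in>F. (\<bar>blf n (\<lambda>i j. r i j * X i j \<omega>) y z\<bar> / s) ^ m \<le> G \<omega>))"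
proof -
  let ?B = "\<lambda>\<omega> y z. blf n (\<lambda>i j. r i j * X i j \<omega>) y z"
  define H where "H \<omega> = (\<Sum>(y, z)\<in>F. exp (?B \<omega> y z) + exp (?B \<omega> (\<lambda>i. - y i) z))" for \<omega>
  define G where "G \<omega> = (2 * d) ^ m + 2 ^ m * fact m * (exp (- (d * s)) * H \<omega>)" for \<omega>
  have neg: "?B \<omega> (\<lambda>i. - y i) z = - ?B \<omega> y z" for \<omega> y z
    unfolding blf_def by (simp add: sum_negf)
  have Lneg: "L2_set (\<lambda>i. - y i) {..<n} = L2_set y {..<n}" for y
    unfolding L2_set_def by simp
  have int1: "integrable P (\<lambda>\<omega>. exp (?B \<omega> y z) + exp (?B \<omega> (\<lambda>i. - y i) z))" for y z
    by (intro Bochner_Integration.integrable_add expectation_exp_blf_le(1)[OF r])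
  have intH: "integrable P H" unfolding H_def
    by (rule Bochner_Integration.integrable_sum) (use int1 in auto)
  have "expectation H = (\<Sum>k\<in>F. expectation (\<lambda>\<omega>. case k of (y, z) \<Rightarrow> exp (?B \<omega> y z) + exp (?B \<omega> (\<lambda>i. - y i) z)))"
    unfolding H_def by (rule Bochner_Integration.integral_sum) (use int1 in auto)
  also have "\<dots> \<le> (\<Sum>k\<in>F. 2 * exp (b / 4))"
  proof (rule sum_mono, clarify)
    fix y z assume yz: "(y, z) \<in> F"
    have "expectation (\<lambda>\<omega>. exp (?B \<omega> y z) + exp (?B \<omega> (\<lambda>i. - y i) z))
      = expectation (\<lambda>\<omega>. exp (?B \<omega> y z)) + expectation (\<lambda>\<omega>. exp (?B \<omega> (\<lambda>i. - y i) z))"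
      by (intro Bochner_Integration.integral_add expectation_exp_blf_le(1)[OF r])
    also have "\<dots> \<le> exp (b / 4) + exp (b / 4)"
      by (intro add_mono; rule order_trans[OF expectation_exp_blf_le(2)[OF r]])
         (use norms[OF yz] in \<open>auto simp: Lneg\<close>)
    finally show "expectation (\<lambda>\<omega>. exp (?B \<omega> y z) + exp (?B \<omega> (\<lambda>i. - y i) z)) \<le> 2 * exp (b / 4)"
      by simp
  qed
  also have "\<dots> \<le> exp (d * s)" using card by (simp add: algebra_simps)
  finally have EH: "expectation H \<le> exp (d * s)" .
  have intG: "integrable P G" unfolding G_def using intH by simp
  have "expectation G = (2 * d) ^ m + 2 ^ m * fact m * (exp (- (d * s)) * expectation H)"
    unfolding G_def using intH by (simp add: prob_space)
  also have "\<dots> \<le> (2 * d) ^ m + 2 ^ m * fact m * (exp (- (d * s)) * exp (d * s))"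
    using EH by (intro add_left_mono mult_left_mono) auto
  also have "\<dots> = (2 * d) ^ m + 2 ^ m * fact m" by (simp flip: exp_add)
  finally have EG: "expectation G \<le> (2 * d) ^ m + 2 ^ m * fact m" .
  have H0: "0 \<le> H \<omega>" for \<omega> unfolding H_def by (rule sum_nonneg) (auto intro: add_nonneg_nonneg)
  have "(\<bar>?B \<omega> y z\<bar> / s) ^ m \<le> G \<omega>" if yz: "(y, z) \<in> F" for \<omega> y z
  proof -
    have "exp \<bar>?B \<omega> y z\<bar> \<le> exp (?B \<omega> y z) + exp (?B \<omega> (\<lambda>i. - y i) z)"
      unfolding neg by (auto simp: abs_if intro: add_increasing add_increasing2)
    also have "\<dots> = (case (y, z) of (y, z) \<Rightarrow> exp (?B \<omega> y z) + exp (?B \<omega> (\<lambda>i. - y i) z))" by simp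
    also have "\<dots> \<le> H \<omega>" unfolding H_def
      by (rule member_le_sum[OF yz _ F]) (auto intro: add_nonneg_nonneg)
    finally show ?thesis unfolding G_def by (intro power_le_of_exp_le d s) auto
  qed
  moreover have "0 \<le> G \<omega>" for \<omega> unfolding G_def using d H0[of \<omega>] by simp
  ultimately show ?thesis using intG EG by (intro exI[of _ G]) auto
qed

end

text \<open>The sum 1 + 4 (...) stands for the constant and the four noise statistics added up in
  \<open>noise_scale_exists\<close>. The factor 5^m comes from \<open>power_sum5_le\<close>, and 76
  = 2 * 38 from the entropy of the net in \<open>opnorm_moment_dominator\<close>, the largest of the
  four rates.\<close>

definition noise_moment :: "nat \<Rightarrow> real" where
  "noise_moment m = 5 ^ m * (1 + 4 * (76 ^ m + 2 ^ m * fact m))"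

text \<open>Every inequality is stated relative to the typical order of the quantity. Row sums and
  total sum are taken without signs, since they describe degrees. The condition 1 \<le> T lets lower
  powers of T be absorbed into higher ones.\<close>

definition noise_scale :: "nat \<Rightarrow> (nat \<Rightarrow> nat \<Rightarrow> real) \<Rightarrow> (nat \<Rightarrow> nat \<Rightarrow> real) \<Rightarrow> real \<Rightarrow> bool" where
  "noise_scale n r x T \<longleftrightarrow> 1 \<le> T \<and>
     blf_bound n x (2 * sqrt n * T) \<and> blf_bound n (\<lambda>i j. r i j * x i j) (2 * sqrt n * T) \<and>
     (\<forall>i<n. \<bar>\<Sum>j<n. x i j\<bar> \<le> sqrt (n * ln n) * T) \<and> \<bar>\<Sum>i<n. \<Sum>j<n. x i j\<bar> \<le> n * T"

lemma power_sum5_le: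
  fixes x1 x2 x3 x4 x5 :: real
  assumes "0 \<le> x1" "0 \<le> x2" "0 \<le> x3" "0 \<le> x4" "0 \<le> x5"
  shows "(x1 + x2 + x3 + x4 + x5) ^ m \<le> 5 ^ m * (x1 ^ m + x2 ^ m + x3 ^ m + x4 ^ m + x5 ^ m)"
proof -
  define y where "y = Max {x1, x2, x3, x4, x5}"
  have y: "x1 \<le> y" "x2 \<le> y" "x3 \<le> y" "x4 \<le> y" "x5 \<le> y" "y \<in> {x1, x2, x3, x4, x5}"
    unfolding y_def using Max_in[of "{x1, x2, x3, x4, x5}"] by (auto simp del: Max_insert Max_in)
  have "(x1 + x2 + x3 + x4 + x5) ^ m \<le> (5 * y) ^ m"
    using y assms by (intro power_mono) auto
  also have "\<dots> = 5 ^ m * y ^ m" by (rule power_mult_distrib)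
  also have "y ^ m \<le> x1 ^ m + x2 ^ m + x3 ^ m + x4 ^ m + x5 ^ m"
    using y(6) assms[THEN zero_le_power, of m] by auto
  finally show ?thesis by simp
qed

context symmetric_noise
begin

lemma opnorm_moment_dominator:
  assumes r: "sign_array n r" and n: "0 < n"
  shows "\<exists>\<nu>. (\<forall>\<omega>\<in>space P. 0 \<le> \<nu> \<omega> \<and> blf_bound n (\<lambda>i j. r i j * X i j \<omega>) (2 * sqrt n * \<nu> \<omega>)) \<and>
    (\<forall>m. \<exists>G. integrable P G \<and> expectation G \<le> 76 ^ m + 2 ^ m * fact m \<and>
      (\<forall>\<omega>\<in>space P. \<nu> \<omega> ^ m \<le> G \<omega>))"
proof -
  let ?N = "ball_net n \<times> ball_net n"
  \<comment> \<open>The factor sqrt n balances the scales: the exponential moment is then at most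
    exp (n / 4), comparable with the size exp (36 n) of the family of pairs, and the form divided by
    n is exactly the quantity over which \<open>\<nu>\<close> is the maximum.\<close>
  let ?F = "(\<lambda>(v, w). (\<lambda>i. sqrt n * v i, w)) ` ?N"
  let ?b = "\<lambda>\<omega> v w. \<bar>blf n (\<lambda>i j. r i j * X i j \<omega>) v w\<bar>"
  define \<nu> where "\<nu> \<omega> = Max (insert 0 ((\<lambda>(v, w). ?b \<omega> v w / sqrt n) ` ?N))" for \<omega>
  have finN: "finite ?N" using finite_ball_net by simp
  then have finI: "finite (insert 0 ((\<lambda>(v, w). ?b \<omega> v w / sqrt n) ` ?N))" for \<omega> by simp
  have \<nu>0: "0 \<le> \<nu> \<omega>" for \<omega> unfolding \<nu>_def by (rule Max_ge[OF finI]) simp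
  have \<nu>_ge: "?b \<omega> v w \<le> sqrt n * \<nu> \<omega>" if "v \<in> ball_net n" "w \<in> ball_net n" for \<omega> v w
  proof -
    have "?b \<omega> v w / sqrt n \<le> \<nu> \<omega>" unfolding \<nu>_def
      by (rule Max_ge[OF finI]) (use that in \<open>auto intro!: image_eqI[of _ _ "(v, w)"]\<close>)
    then show ?thesis using n by (simp add: field_simps)
  qed
  have bound: "blf_bound n (\<lambda>i j. r i j * X i j \<omega>) (2 * sqrt n * \<nu> \<omega>)" for \<omega>
    using blf_bound_of_ball_net[OF n, of "\<lambda>i j. r i j * X i j \<omega>" "sqrt n * \<nu> \<omega>"] \<nu>_ge
    by (simp add: mult.assoc)
  have mom: "\<exists>G. integrable P G \<and> expectation G \<le> 76 ^ m + 2 ^ m * fact m \<and>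
      (\<forall>\<omega>\<in>space P. \<nu> \<omega> ^ m \<le> G \<omega>)" for m
  \<comment> \<open>For m = 0 the value \<nu> = 0 would give 0^0 = 1, which the dominator built from
    the net need not be shown to exceed; the constant 1 serves instead.\<close>
  proof (cases "m = 0")
    case True
    then show ?thesis by (intro exI[of _ "\<lambda>_. 1"]) (simp add: prob_space)
  next
    case False
    have "\<exists>G. integrable P G \<and> expectation G \<le> (2 * 38) ^ m + 2 ^ m * fact m \<and>
      (\<forall>\<omega>\<in>space P. 0 \<le> G \<omega> \<and> (\<forall>(y, z)\<in>?F. (\<bar>blf n (\<lambda>i j. r i j * X i j \<omega>) y z\<bar> / real n) ^ m \<le> G \<omega>))"
    proof (rule blf_moment_dominator[OF r, where b = "real n"])
      fix y z assume "(y, z) \<in> ?F"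
      then obtain v where v: "v \<in> ball_net n" "z \<in> ball_net n" "y = (\<lambda>i. sqrt n * v i)" by auto
      have "(L2_set v {..<n})\<^sup>2 \<le> 1" "(L2_set z {..<n})\<^sup>2 \<le> 1"
        using ball_net_norm_le v by (auto simp: power_le_one)
      then have "real n * ((L2_set v {..<n})\<^sup>2 * (L2_set z {..<n})\<^sup>2) \<le> real n * 1"
        by (intro mult_left_mono mult_le_one) auto
      then show "(L2_set y {..<n})\<^sup>2 * (L2_set z {..<n})\<^sup>2 \<le> real n"
        unfolding v(3) L2_set_cmult by (simp add: power_mult_distrib mult.assoc)
    next
      have "real (card ?F) \<le> real (card ?N)"
        by (intro of_nat_mono card_image_le finN)
      also have "\<dots> = real (card (ball_net n)) * real (card (ball_net n))"
        by (simp add: card_cartesian_product)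
      also have "\<dots> \<le> exp (18 * real n) * exp (18 * real n)"
        by (intro mult_mono card_ball_net) auto
      finally have c: "real (card ?F) \<le> exp (36 * real n)" by (simp flip: exp_add)
      have "2 \<le> exp (real n)" using exp_ge_add_one_self[of "real n"] n by linarith
      then have "2 * real (card ?F) * exp (real n / 4) \<le> exp (real n) * exp (36 * real n) * exp (real n / 4)"
        using c by (intro mult_mono) auto
      also have "\<dots> \<le> exp (38 * real n)" by (simp flip: exp_add)
      finally show "2 * real (card ?F) * exp (real n / 4) \<le> exp (38 * real n)" .
    qed (use n finN in auto)
    then obtain G where G: "integrable P G" "expectation G \<le> 76 ^ m + 2 ^ m * fact m"
      "\<And>\<omega>. \<omega> \<in> space P \<Longrightarrow> 0 \<le> G \<omega>"
      "\<And>\<omega> v w. \<omega> \<in> space P \<Longrightarrow> v \<in> ball_net n \<Longrightarrow> w \<in> ball_net n \<Longrightarrow>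
        (?b \<omega> (\<lambda>i. sqrt n * v i) w / real n) ^ m \<le> G \<omega>"
      by auto
    have "\<nu> \<omega> ^ m \<le> G \<omega>" if \<omega>: "\<omega> \<in> space P" for \<omega>
    proof -
      have "\<nu> \<omega> \<in> insert 0 ((\<lambda>(v, w). ?b \<omega> v w / sqrt n) ` ?N)"
        unfolding \<nu>_def by (rule Max_in[OF finI]) simp
      then consider "\<nu> \<omega> = 0" | v w where "v \<in> ball_net n" "w \<in> ball_net n" "\<nu> \<omega> = ?b \<omega> v w / sqrt n"
        by auto
      then show ?thesis
      proof cases
        case 1
        then show ?thesis using G(3)[OF \<omega>] False by (simp add: zero_power)
      next
        case 2
        have "(?b \<omega> (\<lambda>i. sqrt n * v i) w / real n) ^ m \<le> G \<omega>"
          by (rule G(4)[OF \<omega> 2(1,2)])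
        moreover have "?b \<omega> (\<lambda>i. sqrt n * v i) w / real n = \<nu> \<omega>"
          unfolding 2(3) using blf_scale[of n _ "sqrt n" v 1 w] n
          by (simp add: abs_mult field_simps)
        ultimately show ?thesis by simp
      qed
    qed
    then show ?thesis using G by blast
  qed
  show ?thesis using \<nu>0 bound mom by (intro exI[of _ \<nu>]) auto
qed

lemma noise_scale_exists:
  assumes r: "sign_array n r" and n: "3 \<le> n"
  shows "\<exists>T. (\<forall>\<omega>\<in>space P. noise_scale n r (\<lambda>i j. X i j \<omega>) (T \<omega>)) \<and>
    (\<forall>m. \<exists>G. integrable P G \<and> expectation G \<le> noise_moment m \<and> (\<forall>\<omega>\<in>space P. T \<omega> ^ m \<le> G \<omega>))"
proof -
  have one: "sign_array n (\<lambda>_ _. 1)" unfolding sign_array_def by simp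
  have n0: "0 < n" "real n > 0" using n by auto
  have ln1: "1 \<le> ln (real n)"
  proof -
    have "exp 1 \<le> (3::real)" using exp_le by simp
    also have "\<dots> \<le> real n" using n by simp
    finally show ?thesis using n0 by (simp add: ln_ge_iff)
  qed
  obtain \<nu> where \<nu>: "\<And>\<omega>. \<omega> \<in> space P \<Longrightarrow> 0 \<le> \<nu> \<omega>"
    "\<And>\<omega>. \<omega> \<in> space P \<Longrightarrow> blf_bound n (\<lambda>i j. X i j \<omega>) (2 * sqrt n * \<nu> \<omega>)"
    "\<And>m. \<exists>G. integrable P G \<and> expectation G \<le> 76 ^ m + 2 ^ m * fact m \<and> (\<forall>\<omega>\<in>space P. \<nu> \<omega> ^ m \<le> G \<omega>)"
    using opnorm_moment_dominator[OF one n0(1)] by auto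
  obtain \<rho> where \<rho>: "\<And>\<omega>. \<omega> \<in> space P \<Longrightarrow> 0 \<le> \<rho> \<omega>"
    "\<And>\<omega>. \<omega> \<in> space P \<Longrightarrow> blf_bound n (\<lambda>i j. r i j * X i j \<omega>) (2 * sqrt n * \<rho> \<omega>)"
    "\<And>m. \<exists>G. integrable P G \<and> expectation G \<le> 76 ^ m + 2 ^ m * fact m \<and> (\<forall>\<omega>\<in>space P. \<rho> \<omega> ^ m \<le> G \<omega>)"
    using opnorm_moment_dominator[OF r n0(1)] by auto
  define \<xi> where "\<xi> \<omega> = Max ((\<lambda>i. \<bar>\<Sum>j<n. X i j \<omega>\<bar> / sqrt (n * ln n)) ` {..<n})" for \<omega>
  define \<zeta> where "\<zeta> \<omega> = \<bar>\<Sum>i<n. \<Sum>j<n. X i j \<omega>\<bar> / n" for \<omega>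
  have root_pos: "0 < sqrt (n * ln n)" using n0 ln1 by (simp only: real_sqrt_gt_0_iff) (rule mult_pos_pos, linarith+)
  have \<xi>_ge: "\<bar>\<Sum>j<n. X i j \<omega>\<bar> / sqrt (n * ln n) \<le> \<xi> \<omega>" if "i < n" for i \<omega>
    unfolding \<xi>_def using that by (intro Max_ge) auto
  have \<xi>0: "0 \<le> \<xi> \<omega>" for \<omega>
    by (rule order_trans[OF _ \<xi>_ge[of 0 \<omega>]]) (use n0 ln1 in auto)
  have \<xi>_mom: "\<exists>G. integrable P G \<and> expectation G \<le> 76 ^ m + 2 ^ m * fact m \<and> (\<forall>\<omega>\<in>space P. \<xi> \<omega> ^ m \<le> G \<omega>)" for m
  proof -
    \<comment> \<open>With this scaling the test vectors have |y|^2 |z|^2 = ln n, so the exponential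
      moment is at most n^(1/4) and matches the number n of rows on a logarithmic scale. The form
      divided by ln n is the row sum divided by sqrt (n ln n): the maximum over rows costs exactly
      sqrt (ln n).\<close>
    let ?c = "sqrt (ln n) / sqrt n"
    let ?F = "(\<lambda>i. (\<lambda>k. if k = i then ?c else 0, \<lambda>_::nat. 1::real)) ` {..<n}"
    have unit: "blf n (\<lambda>i j. x i j) (\<lambda>k. if k = i then ?c else 0) (\<lambda>_. 1) = ?c * (\<Sum>j<n. x i j)"
      if "i < n" for i x
    proof -
      have "blf n (\<lambda>i j. x i j) (\<lambda>k. if k = i then ?c else 0) (\<lambda>_. 1)
        = (\<Sum>k<n. if k = i then ?c * (\<Sum>j<n. x k j) else 0)"
        unfolding blf_def by (rule sum.cong) (auto simp: sum_distrib_left)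
      then show ?thesis using that by simp
    qed
    have "\<exists>G. integrable P G \<and> expectation G \<le> (2 * 3) ^ m + 2 ^ m * fact m \<and>
      (\<forall>\<omega>\<in>space P. 0 \<le> G \<omega> \<and> (\<forall>(y, z)\<in>?F. (\<bar>blf n (\<lambda>i j. 1 * X i j \<omega>) y z\<bar> / ln (real n)) ^ m \<le> G \<omega>))"
    proof (rule blf_moment_dominator[OF one, where b = "ln (real n)"])
      fix y z :: "nat \<Rightarrow> real" assume "(y, z) \<in> ?F"
      then obtain i where i: "i < n" "y = (\<lambda>k. if k = i then ?c else 0)" "z = (\<lambda>_. 1)" by auto
      have "(L2_set y {..<n})\<^sup>2 = (\<Sum>k<n. if k = i then ?c\<^sup>2 else 0)"
        unfolding L2_set_def i(2) by (simp add: sum_nonneg if_distrib[of "\<lambda>x. x\<^sup>2"] cong: if_cong)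
      then have "(L2_set y {..<n})\<^sup>2 = ln n / n"
        using i(1) ln1 by (simp add: power_divide)
      then show "(L2_set y {..<n})\<^sup>2 * (L2_set z {..<n})\<^sup>2 \<le> ln (real n)"
        unfolding i(3) L2_set_const using n0 by simp
    next
      have "real (card ?F) \<le> exp (ln (real n))"
        using card_image_le[of "{..<n}" "\<lambda>i. (\<lambda>k. if k = i then ?c else 0, \<lambda>_::nat. 1::real)"] n0 by simp
      moreover have "2 \<le> exp (ln (real n))" using n by simp
      ultimately have "2 * real (card ?F) * exp (ln n / 4) \<le> exp (ln n) * exp (ln n) * exp (ln n / 4)"
        by (intro mult_mono) auto
      also have "\<dots> \<le> exp (3 * ln n)" using ln1 by (simp flip: exp_add)
      finally show "2 * real (card ?F) * exp (ln (real n) / 4) \<le> exp (3 * ln (real n))" .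
    qed (use ln1 in auto)
    then obtain G where G: "integrable P G" "expectation G \<le> 6 ^ m + 2 ^ m * fact m"
      "\<And>\<omega> y z. \<omega> \<in> space P \<Longrightarrow> (y, z) \<in> ?F \<Longrightarrow> (\<bar>blf n (\<lambda>i j. 1 * X i j \<omega>) y z\<bar> / ln (real n)) ^ m \<le> G \<omega>"
      by fastforce
    have "\<xi> \<omega> ^ m \<le> G \<omega>" if \<omega>: "\<omega> \<in> space P" for \<omega>
    proof -
      have "\<xi> \<omega> \<in> (\<lambda>i. \<bar>\<Sum>j<n. X i j \<omega>\<bar> / sqrt (n * ln n)) ` {..<n}"
        unfolding \<xi>_def by (rule Max_in) (use n0 in auto)
      then obtain i where i: "i < n" "\<xi> \<omega> = \<bar>\<Sum>j<n. X i j \<omega>\<bar> / sqrt (n * ln n)" by auto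
      have "(\<bar>blf n (\<lambda>i j. 1 * X i j \<omega>) (\<lambda>k. if k = i then ?c else 0) (\<lambda>_. 1)\<bar> / ln n) ^ m \<le> G \<omega>"
        by (rule G(3)[OF \<omega>]) (use i in auto)
      moreover have "?c * \<bar>\<Sum>j<n. X i j \<omega>\<bar> / ln n = \<xi> \<omega>"
      proof -
        have "sqrt (ln n) / ln n = 1 / sqrt (ln n)" using ln1 by (simp add: real_div_sqrt field_simps)
        moreover have "?c * \<bar>\<Sum>j<n. X i j \<omega>\<bar> / ln n = \<bar>\<Sum>j<n. X i j \<omega>\<bar> / sqrt n * (sqrt (ln n) / ln n)"
          by simp
        ultimately show ?thesis unfolding i(2) by (simp add: real_sqrt_mult)
      qed
      ultimately show ?thesis using unit[OF i(1), of "\<lambda>i j. X i j \<omega>"] ln1 n0 by (simp add: abs_mult)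
    qed
    moreover have "(6::real) ^ m \<le> 76 ^ m" by (rule power_mono) auto
    ultimately show ?thesis using G(1,2) by (intro exI[of _ G]) auto
  qed
  have \<zeta>_mom: "\<exists>G. integrable P G \<and> expectation G \<le> 76 ^ m + 2 ^ m * fact m \<and> (\<forall>\<omega>\<in>space P. \<zeta> \<omega> ^ m \<le> G \<omega>)" for m
  proof -
    \<comment> \<open>The single pair has |y|^2 |z|^2 = 1, so the total sum, divided by n, has
      bounded moments without any logarithm.\<close>
    let ?F = "{(\<lambda>_::nat. 1 / real n, \<lambda>_::nat. 1::real)}"
    have "\<exists>G. integrable P G \<and> expectation G \<le> (2 * 2) ^ m + 2 ^ m * fact m \<and>
      (\<forall>\<omega>\<in>space P. 0 \<le> G \<omega> \<and> (\<forall>(y, z)\<in>?F. (\<bar>blf n (\<lambda>i j. 1 * X i j \<omega>) y z\<bar> / 1) ^ m \<le> G \<omega>))"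
    proof (rule blf_moment_dominator[OF one, where b = 1])
      fix y z :: "nat \<Rightarrow> real" assume "(y, z) \<in> ?F"
      then have "y = (\<lambda>_. 1 / real n)" "z = (\<lambda>_. 1)" by auto
      then show "(L2_set y {..<n})\<^sup>2 * (L2_set z {..<n})\<^sup>2 \<le> 1"
        using n0 by (simp add: L2_set_const power_mult_distrib power_divide power2_eq_square)
    next
      have "2 * exp (1/4) \<le> exp 1 * exp (1/4::real)"
        using exp_ge_add_one_self[of 1] by (intro mult_right_mono) auto
      also have "\<dots> \<le> exp 2" by (simp flip: exp_add)
      finally show "2 * real (card ?F) * exp (1 / 4) \<le> exp (2 * 1)" by simp
    qed auto
    then obtain G where G: "integrable P G" "expectation G \<le> 4 ^ m + 2 ^ m * fact m"
      "\<And>\<omega>. \<omega> \<in> space P \<Longrightarrow> \<bar>blf n (\<lambda>i j. X i j \<omega>) (\<lambda>_. 1 / real n) (\<lambda>_. 1)\<bar> ^ m \<le> G \<omega>"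
      by auto
    have "blf n (\<lambda>i j. X i j \<omega>) (\<lambda>_. 1 / real n) (\<lambda>_. 1) = (\<Sum>i<n. \<Sum>j<n. X i j \<omega>) / n" for \<omega>
      unfolding blf_def by (simp add: sum_divide_distrib)
    then have "\<zeta> \<omega> = \<bar>blf n (\<lambda>i j. X i j \<omega>) (\<lambda>_. 1 / real n) (\<lambda>_. 1)\<bar>" for \<omega>
      unfolding \<zeta>_def by simp
    moreover have "(4::real) ^ m \<le> 76 ^ m" by (rule power_mono) auto
    ultimately show ?thesis using G by (intro exI[of _ G]) auto
  qed
  define T where "T \<omega> = 1 + \<nu> \<omega> + \<rho> \<omega> + \<xi> \<omega> + \<zeta> \<omega>" for \<omega>
  have \<zeta>0: "0 \<le> \<zeta> \<omega>" for \<omega> unfolding \<zeta>_def by simp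
  have "noise_scale n r (\<lambda>i j. X i j \<omega>) (T \<omega>)" if \<omega>: "\<omega> \<in> space P" for \<omega>
  proof -
    have le: "1 \<le> T \<omega>" "\<nu> \<omega> \<le> T \<omega>" "\<rho> \<omega> \<le> T \<omega>" "\<xi> \<omega> \<le> T \<omega>" "\<zeta> \<omega> \<le> T \<omega>"
      unfolding T_def using \<nu>(1)[OF \<omega>] \<rho>(1)[OF \<omega>] \<xi>0[of \<omega>] \<zeta>0[of \<omega>] by auto
    have "\<bar>\<Sum>j<n. X i j \<omega>\<bar> \<le> sqrt (n * ln n) * T \<omega>" if "i < n" for i
    proof -
      have "\<bar>\<Sum>j<n. X i j \<omega>\<bar> / sqrt (n * ln n) \<le> T \<omega>" using \<xi>_ge[OF that, of \<omega>] le by linarith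
      then show ?thesis using root_pos by (simp add: pos_divide_le_eq mult.commute)
    qed
    moreover have "\<bar>\<Sum>i<n. \<Sum>j<n. X i j \<omega>\<bar> \<le> n * T \<omega>"
      using le(5) n0 unfolding \<zeta>_def by (simp add: pos_divide_le_eq mult.commute)
    moreover have "blf_bound n (\<lambda>i j. X i j \<omega>) (2 * sqrt n * T \<omega>)"
      by (rule blf_bound_mono[OF \<nu>(2)[OF \<omega>]]) (use le in \<open>auto intro: mult_left_mono\<close>)
    moreover have "blf_bound n (\<lambda>i j. r i j * X i j \<omega>) (2 * sqrt n * T \<omega>)"
      by (rule blf_bound_mono[OF \<rho>(2)[OF \<omega>]]) (use le in \<open>auto intro: mult_left_mono\<close>)
    ultimately show ?thesis unfolding noise_scale_def using le by auto
  qed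
  moreover have "\<exists>G. integrable P G \<and> expectation G \<le> noise_moment m \<and> (\<forall>\<omega>\<in>space P. T \<omega> ^ m \<le> G \<omega>)" for m
  proof -
    let ?c = "76 ^ m + 2 ^ m * fact m"
    obtain G1 where G1: "integrable P G1" "expectation G1 \<le> ?c" "\<forall>\<omega>\<in>space P. \<nu> \<omega> ^ m \<le> G1 \<omega>"
      using \<nu>(3) by blast
    obtain G2 where G2: "integrable P G2" "expectation G2 \<le> ?c" "\<forall>\<omega>\<in>space P. \<rho> \<omega> ^ m \<le> G2 \<omega>"
      using \<rho>(3) by blast
    obtain G3 where G3: "integrable P G3" "expectation G3 \<le> ?c" "\<forall>\<omega>\<in>space P. \<xi> \<omega> ^ m \<le> G3 \<omega>"
      using \<xi>_mom by blast
    obtain G4 where G4: "integrable P G4" "expectation G4 \<le> ?c" "\<forall>\<omega>\<in>space P. \<zeta> \<omega> ^ m \<le> G4 \<omega>"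
      using \<zeta>_mom by blast
    let ?G = "\<lambda>\<omega>. 5 ^ m * (1 + G1 \<omega> + G2 \<omega> + G3 \<omega> + G4 \<omega>)"
    have "integrable P ?G" using G1(1) G2(1) G3(1) G4(1) by simp
    moreover have "expectation ?G
      = 5 ^ m * (1 + expectation G1 + expectation G2 + expectation G3 + expectation G4)"
      using G1(1) G2(1) G3(1) G4(1) by (simp add: prob_space)
    then have "expectation ?G \<le> noise_moment m"
      unfolding noise_moment_def using G1(2) G2(2) G3(2) G4(2) by simp
    moreover have "T \<omega> ^ m \<le> ?G \<omega>" if \<omega>: "\<omega> \<in> space P" for \<omega>
    proof -
      have "T \<omega> ^ m \<le> 5 ^ m * (1 ^ m + \<nu> \<omega> ^ m + \<rho> \<omega> ^ m + \<xi> \<omega> ^ m + \<zeta> \<omega> ^ m)"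
        unfolding T_def by (rule power_sum5_le) (use \<nu>(1)[OF \<omega>] \<rho>(1)[OF \<omega>] \<xi>0 \<zeta>0 in auto)
      also have "\<dots> \<le> ?G \<omega>"
        using G1(3) G2(3) G3(3) G4(3) \<omega> by (intro mult_left_mono add_mono) auto
      finally show ?thesis .
    qed
    ultimately show ?thesis by blast
  qed
  ultimately show ?thesis by blast
qed

end

section \<open>Entries of the two matrices\<close>

definition mean_entry :: "nat \<Rightarrow> (nat \<Rightarrow> real) \<Rightarrow> (nat \<Rightarrow> nat \<Rightarrow> real) \<Rightarrow> nat \<Rightarrow> nat \<Rightarrow> real" where
  "mean_entry n q m i j = q i * q j * (1 + m i j / sqrt n)"

definition norm_adj_entry :: "real \<Rightarrow> nat \<Rightarrow> (nat \<Rightarrow> nat \<Rightarrow> real) \<Rightarrow> nat \<Rightarrow> nat \<Rightarrow> real" where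
  "norm_adj_entry \<alpha> n a i j =
     (let d = (\<lambda>i. \<Sum>j<n. a i j); D = (\<Sum>i<n. d i) in
      D powr \<alpha> / sqrt n * (d i powr (-\<alpha>) * (a i j - d i * d j / D) * d j powr (-\<alpha>)))"

text \<open>The entry at g i of the product of M with the weight vector \<open>c_bar\<close>,
  written as a q-weighted average over nodes.\<close>

definition signal_mean :: "nat \<Rightarrow> (nat \<Rightarrow> real) \<Rightarrow> (nat \<Rightarrow> nat \<Rightarrow> real) \<Rightarrow> nat \<Rightarrow> real" where
  "signal_mean n q m i = (\<Sum>j<n. m i j * q j) / (\<Sum>j<n. q j)"

text \<open>In order: the doubly centred community part with grand mean \<kappa>, the two cross
  terms produced by the entries -1 of \<open>Lambda_mat\<close>, and the normalized noise.\<close>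

definition signal_noise_entry ::
  "real \<Rightarrow> nat \<Rightarrow> (nat \<Rightarrow> real) \<Rightarrow> (nat \<Rightarrow> nat \<Rightarrow> real) \<Rightarrow> (nat \<Rightarrow> nat \<Rightarrow> real) \<Rightarrow> nat \<Rightarrow> nat \<Rightarrow> real" where
  "signal_noise_entry \<alpha> n q m x i j =
     (let S = (\<Sum>j<n. q j); \<mu> = signal_mean n q m; \<kappa> = (\<Sum>i<n. q i * \<mu> i) / S;
          u = (\<lambda>i. q i powr (-\<alpha>) * (\<Sum>j<n. x i j) / S) in
      q i powr (1 - \<alpha>) * q j powr (1 - \<alpha>) * (m i j - \<mu> i - \<mu> j + \<kappa>) / n
      - q i powr (1 - \<alpha>) / sqrt n * u j - u i * (q j powr (1 - \<alpha>) / sqrt n)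
      + q i powr (-\<alpha>) * x i j * q j powr (-\<alpha>) / sqrt n)"

section \<open>Entries of the matrix products\<close>

lemma mult_mat_index_sum:
  assumes "B \<in> carrier_mat a k" "E \<in> carrier_mat k b" "i < a" "j < b"
  shows "(B * E) $$ (i,j) = (\<Sum>l<k. B $$ (i,l) * E $$ (l,j))"
  using assms by (auto simp: scalar_prod_def lessThan_atLeast0 intro!: sum.cong)

lemma mat_of_col_mult_mat_of_row_index:
  "i < dim_vec v \<Longrightarrow> j < dim_vec w \<Longrightarrow> (mat_of_col v * mat_of_row w) $$ (i,j) = v $ i * w $ j"
  unfolding mat_of_col_def by (simp add: scalar_prod_def)

lemma mat_of_col_dim [simp]: "dim_row (mat_of_col v) = dim_vec v" "dim_col (mat_of_col v) = 1"
  unfolding mat_of_col_def by auto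

lemma ones_simps [simp]: "dim_vec (ones k) = k" "i < k \<Longrightarrow> ones k $ i = 1" "ones k \<in> carrier_vec k"
  unfolding ones_def by auto

lemma mat_of_col_carrier: "v \<in> carrier_vec k \<Longrightarrow> mat_of_col v \<in> carrier_mat k 1"
  unfolding mat_of_col_def by simp

lemma mat_of_row_carrier: "v \<in> carrier_vec k \<Longrightarrow> mat_of_row v \<in> carrier_mat 1 k"
  by simp

lemma mat_of_col_mult_mat_of_row_carrier:
  "v \<in> carrier_vec a \<Longrightarrow> w \<in> carrier_vec b \<Longrightarrow> mat_of_col v * mat_of_row w \<in> carrier_mat a b"
  by (rule mult_carrier_mat[OF mat_of_col_carrier mat_of_row_carrier])

lemma diag_powr_carrier: "v \<in> carrier_vec n \<Longrightarrow> diag_powr v s \<in> carrier_mat n n"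
  unfolding diag_powr_def by auto

lemma diag_powr_mult_mult_index:
  assumes v: "v \<in> carrier_vec n" and B: "B \<in> carrier_mat n n" and ij: "i < n" "j < n"
  shows "(diag_powr v s * B * diag_powr v s) $$ (i,j) = v $ i powr s * B $$ (i,j) * v $ j powr s"
proof -
  have D: "diag_powr v s = mat_diag n (\<lambda>i. v $ i powr s)" using v unfolding diag_powr_def by auto
  let ?E = "mat n n (\<lambda>(i,j). v $ i powr s * B $$ (i,j))"
  have "diag_powr v s * B * diag_powr v s = ?E * mat_diag n (\<lambda>i. v $ i powr s)"
    unfolding D using mat_diag_mult_left[OF B] by simp
  also have "\<dots> = mat n n (\<lambda>(i,j). ?E $$ (i,j) * v $ j powr s)"
    by (rule mat_diag_mult_right) simp
  finally show ?thesis using ij by simp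
qed

lemma norm_adj_index:
  assumes A: "A \<in> carrier_mat n n" and ij: "i < n" "j < n"
  shows "norm_adj \<alpha> n A $$ (i,j) = norm_adj_entry \<alpha> n (\<lambda>i j. A $$ (i,j)) i j"
proof -
  define d where "d = A *\<^sub>v ones n"
  have d: "d \<in> carrier_vec n" unfolding d_def ones_def by (rule mult_mat_vec_carrier[OF A]) simp
  have di: "d $ i = (\<Sum>j<n. A $$ (i,j))" if "i < n" for i
    unfolding d_def ones_def using A that by (simp add: scalar_prod_def lessThan_atLeast0)
  have D: "d \<bullet> ones n = (\<Sum>i<n. d $ i)"
    unfolding ones_def scalar_prod_def by (simp add: lessThan_atLeast0)
  let ?B = "A - (1 / (2 * ((1/2) * (d \<bullet> ones n)))) \<cdot>\<^sub>m (mat_of_col d * mat_of_row d)"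
  have B: "?B \<in> carrier_mat n n"
    using mat_of_col_mult_mat_of_row_carrier[OF d d] by (intro minus_carrier_mat smult_carrier_mat)
  have Bij: "?B $$ (i,j) = A $$ (i,j) - d $ i * d $ j / (\<Sum>i<n. d $ i)"
    using A d ij by (simp add: mat_of_col_mult_mat_of_row_index D del: index_mult_mat(1))
  have car: "diag_powr d (-\<alpha>) * ?B * diag_powr d (-\<alpha>) \<in> carrier_mat n n"
    by (intro mult_carrier_mat[of _ n n] diag_powr_carrier d B)
  have "norm_adj \<alpha> n A $$ (i,j)
    = (\<Sum>i<n. d $ i) powr \<alpha> / sqrt n * (d $ i powr (-\<alpha>) * ?B $$ (i,j) * d $ j powr (-\<alpha>))"
    unfolding norm_adj_def Let_def d_def[symmetric]
    using car ij diag_powr_mult_mult_index[OF d B ij, of "-\<alpha>"]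
    by (simp only: index_smult_mat(1) carrier_matD D) simp
  then show ?thesis
    unfolding norm_adj_entry_def Let_def Bij using ij by (simp add: di)
qed

lemma norm_adj_carrier:
  assumes A: "A \<in> carrier_mat n n"
  shows "norm_adj \<alpha> n A \<in> carrier_mat n n"
proof -
  have d: "A *\<^sub>v ones n \<in> carrier_vec n" unfolding ones_def by (rule mult_mat_vec_carrier[OF A]) simp
  show ?thesis
    unfolding norm_adj_def Let_def using A d
    by (intro smult_carrier_mat mult_carrier_mat[of _ n n] diag_powr_carrier minus_carrier_mat
        mult_carrier_mat[OF mat_of_col_carrier mat_of_row_carrier])
qed

text \<open>Among the first K columns, row i of \<open>U_mat\<close> is supported in column g i, so
  multiplying by it merely selects a community. The column with index K carries the noise vector u
  and meets only the border entries -1 of \<open>Lambda_mat\<close>, its corner being 0.\<close>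

lemma U_Lambda_U_index:
  fixes \<alpha> :: real
  assumes q: "q \<in> carrier_vec n" and g: "\<And>i. i < n \<Longrightarrow> g i < K" and M: "M \<in> carrier_mat K K"
    and M_sym: "M\<^sup>T = M" and X: "X \<in> carrier_mat n n" and ij: "i < n" "j < n"
  defines "S \<equiv> (\<Sum>j<n. q $ j)"
  defines "\<mu> \<equiv> signal_mean n (\<lambda>i. q $ i) (\<lambda>i j. M $$ (g i, g j))"
  defines "\<kappa> \<equiv> (\<Sum>i<n. q $ i * \<mu> i) / S"
  defines "u \<equiv> \<lambda>i. q $ i powr (-\<alpha>) * (\<Sum>j<n. X $$ (i,j)) / S"
  shows "(U_mat \<alpha> n K g q X * Lambda_mat n K g q M * (U_mat \<alpha> n K g q X)\<^sup>T) $$ (i,j)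
    = q $ i powr (1 - \<alpha>) * q $ j powr (1 - \<alpha>) * (M $$ (g i, g j) - \<mu> i - \<mu> j + \<kappa>) / n
      - q $ i powr (1 - \<alpha>) / sqrt n * u j - u i * (q $ j powr (1 - \<alpha>) / sqrt n)"
    and "U_mat \<alpha> n K g q X * Lambda_mat n K g q M * (U_mat \<alpha> n K g q X)\<^sup>T \<in> carrier_mat n n"
proof -
  define U where "U = U_mat \<alpha> n K g q X"
  define L where "L = Lambda_mat n K g q M"
  define c where "c = c_bar n K g q"
  define v where "v i = q $ i powr (1 - \<alpha>) / sqrt n" for i
  have S_eq: "q \<bullet> ones n = S" "ones n \<bullet> q = S"
    using q unfolding S_def ones_def scalar_prod_def by (auto simp: lessThan_atLeast0)
  have mem: "membership_mat n K g \<in> carrier_mat n K" unfolding membership_mat_def by simp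
  have Dq: "diag_powr q s \<in> carrier_mat n n" for s using q unfolding diag_powr_def by auto
  define ul where "ul = (1 / (q \<bullet> ones n)) \<cdot>\<^sub>v (diag_powr q (-\<alpha>) *\<^sub>v (X *\<^sub>v ones n))"
  have ul: "ul \<in> carrier_vec n" unfolding ul_def
    by (intro smult_carrier_vec[THEN iffD2] mult_mat_vec_carrier[OF Dq] mult_mat_vec_carrier[OF X]) simp
  have ul_i: "ul $ i = u i" if "i < n" for i
  proof -
    have XI: "(X *\<^sub>v ones n) $ k = (\<Sum>j<n. X $$ (k,j))" if "k < n" for k
      unfolding ones_def using X that by (simp add: scalar_prod_def lessThan_atLeast0)
    have "(diag_powr q (-\<alpha>) *\<^sub>v (X *\<^sub>v ones n)) $ i
      = (\<Sum>k<n. diag_powr q (-\<alpha>) $$ (i,k) * (X *\<^sub>v ones n) $ k)"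
      using Dq[of "-\<alpha>"] X that by (simp add: scalar_prod_def lessThan_atLeast0)
    also have "\<dots> = (\<Sum>k<n. if k = i then q $ i powr (-\<alpha>) * (X *\<^sub>v ones n) $ i else 0)"
      by (rule sum.cong) (use q that in \<open>auto simp: diag_powr_def mat_diag_def\<close>)
    finally show ?thesis unfolding ul_def u_def using Dq[of "-\<alpha>"] that by (simp add: S_eq XI)
  qed
  have U_car: "U \<in> carrier_mat n (Suc K)"
    unfolding U_def U_mat_def append_cols_def ul_def[symmetric]
    using mem Dq[of "1 - \<alpha>"] mat_of_col_carrier[OF ul] by (intro carrier_matI) auto
  have U1: "U $$ (i,k) = (if k = g i then v i else 0)" if "i < n" "k < K" for i k
  proof -
    have "(diag_powr q (1 - \<alpha>) * membership_mat n K g) $$ (i,k) = q $ i powr (1 - \<alpha>) * (if g i = k then 1 else 0)"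
      using q mem that unfolding diag_powr_def
      by (simp add: mat_diag_mult_left) (simp add: membership_mat_def)
    then show ?thesis
      unfolding U_def U_mat_def append_cols_def ul_def[symmetric] v_def
      using that mem Dq[of "1 - \<alpha>"] mat_of_col_carrier[OF ul] by auto
  qed
  have U2: "U $$ (i,K) = u i" if "i < n" for i
    unfolding U_def U_mat_def append_cols_def ul_def[symmetric]
    using that mem Dq[of "1 - \<alpha>"] mat_of_col_carrier[OF ul] ul ul_i by (auto simp: mat_of_col_def)
  have c_car: "c \<in> carrier_vec K" unfolding c_def c_bar_def
    by (intro smult_carrier_vec[THEN iffD2] mult_mat_vec_carrier[of _ K n]) (use mem q in auto)
  have c_k: "c $ k = (\<Sum>i<n. if g i = k then q $ i else 0) / S" if "k < K" for k
  proof -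
    have "((membership_mat n K g)\<^sup>T *\<^sub>v q) $ k = (\<Sum>i<n. (membership_mat n K g) $$ (i,k) * q $ i)"
      using that mem q by (simp add: scalar_prod_def lessThan_atLeast0)
    also have "\<dots> = (\<Sum>i<n. if g i = k then q $ i else 0)"
      by (rule sum.cong) (use that in \<open>auto simp: membership_mat_def\<close>)
    finally show ?thesis
      unfolding c_def c_bar_def S_eq using that mem by simp
  qed
  \<comment> \<open>The weight c k collects q over community k, so a c-weighted sum over communities
    is a q-weighted sum over nodes. Empty communities have weight 0, whatever the corresponding
    entries of M are.\<close>
  have c_sum: "(\<Sum>k<K. f k * c $ k) = (\<Sum>i<n. f (g i) * q $ i) / S" for f
  proof -
    have "(\<Sum>k<K. f k * c $ k) = (\<Sum>k<K. \<Sum>i<n. if g i = k then f (g i) * q $ i else 0) / S"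
      unfolding sum_divide_distrib
      by (rule sum.cong) (auto simp: c_k sum_distrib_left sum_divide_distrib intro!: sum.cong)
    also have "\<dots> = (\<Sum>i<n. \<Sum>k<K. if g i = k then f (g i) * q $ i else 0) / S"
      by (subst sum.swap) simp
    also have "\<dots> = (\<Sum>i<n. f (g i) * q $ i) / S"
      using g by simp
    finally show ?thesis .
  qed
  let ?W1 = "1\<^sub>m K - mat_of_col (ones K) * mat_of_row c"
  let ?W2 = "1\<^sub>m K - mat_of_col c * mat_of_row (ones K)"
  have W1_car: "?W1 \<in> carrier_mat K K"
    by (intro minus_carrier_mat mat_of_col_mult_mat_of_row_carrier c_car) simp
  have W2_car: "?W2 \<in> carrier_mat K K"
    by (intro minus_carrier_mat mat_of_col_mult_mat_of_row_carrier c_car) simp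
  have W1: "?W1 $$ (a,b) = (if a = b then 1 else 0) - c $ b" if "a < K" "b < K" for a b
    using that c_car by (simp add: mat_of_col_mult_mat_of_row_index del: index_mult_mat(1))
  have W2: "?W2 $$ (a,b) = (if a = b then 1 else 0) - c $ a" if "a < K" "b < K" for a b
    using that c_car by (simp add: mat_of_col_mult_mat_of_row_index del: index_mult_mat(1))
  \<comment> \<open>The left factor subtracts c-weighted column means and the right factor row
    means; the grand mean is thereby added back.\<close>
  define Q where "Q = ?W1 * M * ?W2"
  have W1M: "?W1 * M \<in> carrier_mat K K" using W1_car M by simp
  have Q_car: "Q \<in> carrier_mat K K" unfolding Q_def using W1M W2_car by simp
  have L_eq: "L = four_block_mat Q (- mat_of_col (ones K)) (- mat_of_row (ones K)) (0\<^sub>m 1 1)"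
    unfolding L_def Lambda_mat_def Let_def c_def[symmetric] Q_def ..
  have L_car: "L \<in> carrier_mat (Suc K) (Suc K)"
    unfolding L_eq using Q_car by (intro carrier_matI) auto
  have L1: "L $$ (k,l) = Q $$ (k,l)" if "k < K" "l < K" for k l
    unfolding L_eq using Q_car that by simp
  have L2: "L $$ (k,K) = -1" "L $$ (K,k) = -1" if "k < K" for k
    unfolding L_eq using Q_car that by (simp_all add: mat_of_col_def)
  have L3: "L $$ (K,K) = 0"
    unfolding L_eq using Q_car by simp
  have W1M_kb: "(?W1 * M) $$ (k,b) = M $$ (k,b) - (\<Sum>a<K. M $$ (a,b) * c $ a)" if "k < K" "b < K" for k b
  proof -
    have "(?W1 * M) $$ (k,b) = (\<Sum>a<K. ((if k = a then 1 else 0) - c $ a) * M $$ (a,b))"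
      using mult_mat_index_sum[OF W1_car M that] W1 that by (simp del: index_minus_mat index_mult_mat)
    also have "\<dots> = (\<Sum>a<K. (if k = a then M $$ (k,b) else 0) - M $$ (a,b) * c $ a)"
      by (rule sum.cong) (auto simp: algebra_simps)
    also have "\<dots> = M $$ (k,b) - (\<Sum>a<K. M $$ (a,b) * c $ a)"
      unfolding sum_subtractf using that by simp
    finally show ?thesis .
  qed
  have Q_kl: "Q $$ (k,l) = M $$ (k,l) - (\<Sum>a<K. M $$ (a,l) * c $ a) - (\<Sum>b<K. M $$ (k,b) * c $ b)
      + (\<Sum>b<K. (\<Sum>a<K. M $$ (a,b) * c $ a) * c $ b)" if "k < K" "l < K" for k l
  proof -
    have "Q $$ (k,l) = (\<Sum>b<K. (M $$ (k,b) - (\<Sum>a<K. M $$ (a,b) * c $ a)) * ((if b = l then 1 else 0) - c $ b))"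
      unfolding Q_def using mult_mat_index_sum[OF W1M W2_car that] W2 W1M_kb that
      by (simp del: index_minus_mat index_mult_mat)
    also have "\<dots> = (\<Sum>b<K. (if b = l then M $$ (k,l) - (\<Sum>a<K. M $$ (a,l) * c $ a) else 0)
        - M $$ (k,b) * c $ b + (\<Sum>a<K. M $$ (a,b) * c $ a) * c $ b)"
      by (rule sum.cong) (auto simp: algebra_simps)
    finally show ?thesis
      unfolding sum.distrib sum_subtractf using that by simp
  qed
  have M_swap: "M $$ (k,l) = M $$ (l,k)" if "k < K" "l < K" for k l
    using M_sym M that by (metis index_transpose_mat(1) carrier_matD)
  have \<mu>_eq: "(\<Sum>b<K. M $$ (g i,b) * c $ b) = \<mu> i" for i
    unfolding c_sum \<mu>_def signal_mean_def S_def ..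
  have \<mu>_eq': "(\<Sum>a<K. M $$ (a,g j) * c $ a) = \<mu> j" if "j < n" for j
    unfolding \<mu>_eq[symmetric] by (rule sum.cong) (use M_swap g[OF that] in auto)
  have \<kappa>_eq: "(\<Sum>b<K. (\<Sum>a<K. M $$ (a,b) * c $ a) * c $ b) = \<kappa>"
    unfolding c_sum[of "\<lambda>b. \<Sum>a<K. M $$ (a,b) * c $ a"] \<kappa>_def
    by (rule arg_cong[of _ _ "\<lambda>x. x / S"], rule sum.cong) (simp_all only: \<mu>_eq' lessThan_iff mult.commute[of "\<mu> _"])
  have Q_g: "Q $$ (g i, g j) = M $$ (g i, g j) - \<mu> j - \<mu> i + \<kappa>"
    using Q_kl[OF g[OF ij(1)] g[OF ij(2)]] unfolding \<mu>_eq \<mu>_eq'[OF ij(2)] \<kappa>_eq .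
  have UL_car: "U * L \<in> carrier_mat n (Suc K)" using U_car L_car by simp
  have UL1: "(U * L) $$ (i,l) = v i * Q $$ (g i,l) - u i" if "l < K" for l
  proof -
    have "(U * L) $$ (i,l) = (\<Sum>k<K. U $$ (i,k) * L $$ (k,l)) - u i"
      using mult_mat_index_sum[OF U_car L_car ij(1), of l] that L2 U2[OF ij(1)]
      by (simp add: sum.lessThan_Suc del: index_mult_mat)
    also have "(\<Sum>k<K. U $$ (i,k) * L $$ (k,l)) = (\<Sum>k<K. if k = g i then v i * Q $$ (g i,l) else 0)"
      by (rule sum.cong) (use that in \<open>auto simp: U1[OF ij(1)] L1\<close>)
    finally show ?thesis using g[OF ij(1)] by simp
  qed
  have UL2: "(U * L) $$ (i,K) = - v i"
  proof -
    have "(U * L) $$ (i,K) = (\<Sum>k<K. U $$ (i,k) * L $$ (k,K))"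
      using mult_mat_index_sum[OF U_car L_car ij(1), of K] L3
      by (simp add: sum.lessThan_Suc del: index_mult_mat)
    also have "\<dots> = (\<Sum>k<K. if k = g i then - v i else 0)"
      by (rule sum.cong) (auto simp: U1[OF ij(1)] L2)
    finally show ?thesis using g[OF ij(1)] by simp
  qed
  have Ut: "U\<^sup>T \<in> carrier_mat (Suc K) n" using U_car by simp
  have "(U * L * U\<^sup>T) $$ (i,j) = (\<Sum>l<Suc K. (U * L) $$ (i,l) * U $$ (j,l))"
    using mult_mat_index_sum[OF UL_car Ut ij] U_car ij by (simp del: index_mult_mat)
  also have "\<dots> = (\<Sum>l<K. if l = g j then (v i * Q $$ (g i, g j) - u i) * v j else 0) - v i * u j"
  proof -
    have "(\<Sum>l<K. (U * L) $$ (i,l) * U $$ (j,l))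
      = (\<Sum>l<K. if l = g j then (v i * Q $$ (g i, g j) - u i) * v j else 0)"
      by (rule sum.cong) (auto simp: UL1 U1[OF ij(2)] simp del: index_mult_mat)
    then show ?thesis unfolding sum.lessThan_Suc UL2 U2[OF ij(2)] by simp
  qed
  also have "\<dots> = v i * v j * Q $$ (g i, g j) - u i * v j - v i * u j"
    using g[OF ij(2)] by (simp add: algebra_simps)
  finally have "(U * L * U\<^sup>T) $$ (i,j) = v i * v j * Q $$ (g i, g j) - u i * v j - v i * u j" .
  then show "(U_mat \<alpha> n K g q X * Lambda_mat n K g q M * (U_mat \<alpha> n K g q X)\<^sup>T) $$ (i,j)
    = q $ i powr (1 - \<alpha>) * q $ j powr (1 - \<alpha>) * (M $$ (g i, g j) - \<mu> i - \<mu> j + \<kappa>) / n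
      - q $ i powr (1 - \<alpha>) / sqrt n * u j - u i * (q $ j powr (1 - \<alpha>) / sqrt n)"
    unfolding U_def L_def Q_g v_def by (simp add: algebra_simps)
  show "U_mat \<alpha> n K g q X * Lambda_mat n K g q M * (U_mat \<alpha> n K g q X)\<^sup>T \<in> carrier_mat n n"
    unfolding U_def[symmetric] L_def[symmetric] using UL_car Ut by simp
qed

section \<open>The blockmodel as an instance of symmetric noise\<close>

context dcsbm
begin

abbreviation "q_fun \<equiv> \<lambda>i. q $ i"
abbreviation "m_fun \<equiv> \<lambda>i j. M $$ (g i, g j)"

definition noise :: "nat \<Rightarrow> nat \<Rightarrow> 'a \<Rightarrow> real" where
  "noise i j \<omega> = A \<omega> $$ (i,j) - mean_entry n q_fun m_fun i j"

lemma M_index_sym: "i < n \<Longrightarrow> j < n \<Longrightarrow> m_fun i j = m_fun j i"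
  using M_sym M_carrier g_less by (metis index_transpose_mat(1) carrier_matD)

lemma mean_entry_sym: "i < n \<Longrightarrow> j < n \<Longrightarrow> mean_entry n q_fun m_fun i j = mean_entry n q_fun m_fun j i"
  unfolding mean_entry_def using M_index_sym by simp

lemma A_index_01: "\<omega> \<in> space P \<Longrightarrow> i < n \<Longrightarrow> j < n \<Longrightarrow> A \<omega> $$ (i,j) \<in> {0, 1}"
  using A_01 A_carrier by blast

lemma A_index_sym: "\<omega> \<in> space P \<Longrightarrow> i < n \<Longrightarrow> j < n \<Longrightarrow> A \<omega> $$ (i,j) = A \<omega> $$ (j,i)"
  using A_sym A_carrier by (metis index_transpose_mat(1) carrier_matD)

lemma mean_entry_eq: "i < n \<Longrightarrow> j < n \<Longrightarrow> q $ i * q $ j * C $$ (g i, g j) = mean_entry n q_fun m_fun i j"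
  unfolding mean_entry_def using C_M g_less by simp

text \<open>The model prescribes the law of the event that an entry equals 1. Since entries are 0 or
  1, the entry is the indicator of this event and its mean can be computed under the Bernoulli
  distribution.\<close>

lemma expectation_A_index_upper:
  assumes ij: "i \<le> j" "j < n"
  shows "random_variable borel (\<lambda>\<omega>. A \<omega> $$ (i,j))"
    and "expectation (\<lambda>\<omega>. A \<omega> $$ (i,j)) = mean_entry n q_fun m_fun i j"
proof -
  show rv: "random_variable borel (\<lambda>\<omega>. A \<omega> $$ (i,j))"
    using A_indep ij unfolding indep_vars_def by auto
  have rvb: "(\<lambda>\<omega>. A \<omega> $$ (i,j) = 1) \<in> P \<rightarrow>\<^sub>M count_space UNIV"
    using rv by measurable
  have "expectation (\<lambda>\<omega>. A \<omega> $$ (i,j)) = expectation (\<lambda>\<omega>. of_bool (A \<omega> $$ (i,j) = 1))"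
    by (rule Bochner_Integration.integral_cong) (use A_index_01[of _ i j] ij in auto)
  also have "\<dots> = (\<integral>b. of_bool b \<partial>distr P (count_space UNIV) (\<lambda>\<omega>. A \<omega> $$ (i,j) = 1))"
    by (rule integral_distr[symmetric, OF rvb]) simp
  also have "\<dots> = mean_entry n q_fun m_fun i j"
    unfolding A_bernoulli[OF ij] using valid_prob[OF ij] mean_entry_eq ij by auto
  finally show "expectation (\<lambda>\<omega>. A \<omega> $$ (i,j)) = mean_entry n q_fun m_fun i j" .
qed

lemma mean_mat_index:
  assumes ij: "i < n" "j < n"
  shows "mean_mat P n A $$ (i,j) = mean_entry n q_fun m_fun i j"
proof -
  have "expectation (\<lambda>\<omega>. A \<omega> $$ (i,j)) = mean_entry n q_fun m_fun i j"
  proof (cases "i \<le> j")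
    case True
    then show ?thesis using expectation_A_index_upper ij by auto
  next
    case False
    have "expectation (\<lambda>\<omega>. A \<omega> $$ (i,j)) = expectation (\<lambda>\<omega>. A \<omega> $$ (j,i))"
      by (rule Bochner_Integration.integral_cong) (use A_index_sym ij in auto)
    then show ?thesis using expectation_A_index_upper[of j i] False ij mean_entry_sym by auto
  qed
  then show ?thesis unfolding mean_mat_def using ij by simp
qed

lemma symmetric_noise_noise:
  "symmetric_noise P n noise (\<lambda>i j. - mean_entry n q_fun m_fun i j)"
proof
  show "noise i j \<omega> = noise j i \<omega>" if "\<omega> \<in> space P" "i < n" "j < n" for i j \<omega>
    unfolding noise_def using A_index_sym mean_entry_sym that by simp
  have "indep_vars (\<lambda>_. borel) (\<lambda>k \<omega>. (case k of (i, j) \<Rightarrow> \<lambda>\<omega>. A \<omega> $$ (i,j)) \<omega> - case_prod (mean_entry n q_fun m_fun) k) (upper_pairs n)"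
    by (rule indep_vars_compose2[where X = "\<lambda>(i,j) \<omega>. A \<omega> $$ (i,j)" and Y = "\<lambda>k x. x - case_prod (mean_entry n q_fun m_fun) k", OF A_indep]) simp
  then show "indep_vars (\<lambda>_. borel) (\<lambda>(i, j). noise i j) (upper_pairs n)"
    by (rule indep_vars_cong[THEN iffD1, rotated -1]) (auto simp: noise_def fun_eq_iff)
  show "noise i j \<omega> \<in> {- mean_entry n q_fun m_fun i j..- mean_entry n q_fun m_fun i j + 1}"
    if "\<omega> \<in> space P" "i \<le> j" "j < n" for i j \<omega>
    using A_index_01[of \<omega> i j] that unfolding noise_def by auto
  show "expectation (noise i j) = 0" if ij: "i \<le> j" "j < n" for i j
  proof -
    have "integrable P (\<lambda>\<omega>. A \<omega> $$ (i,j))"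
    proof (rule integrable_const_bound[of _ 1])
      show "AE \<omega> in P. norm (A \<omega> $$ (i,j)) \<le> 1"
      proof (rule AE_I2)
        fix \<omega> assume "\<omega> \<in> space P"
        then have "A \<omega> $$ (i,j) \<in> {0, 1}" using A_index_01 ij by auto
        then show "norm (A \<omega> $$ (i,j)) \<le> 1" by auto
      qed
    qed (rule expectation_A_index_upper(1)[OF ij])
    then show ?thesis
      unfolding noise_def using expectation_A_index_upper[OF ij] by (simp add: prob_space)
  qed
qed

lemma signal_plus_noise_index:
  assumes \<omega>: "\<omega> \<in> space P" and ij: "i < n" "j < n"
  shows "signal_plus_noise \<alpha> P n K g q M A \<omega> $$ (i,j)
    = signal_noise_entry \<alpha> n q_fun m_fun (\<lambda>i j. noise i j \<omega>) i j"
    and "signal_plus_noise \<alpha> P n K g q M A \<omega> \<in> carrier_mat n n"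
proof -
  define X where "X = A \<omega> - mean_mat P n A"
  have mean: "mean_mat P n A \<in> carrier_mat n n" unfolding mean_mat_def by simp
  have X: "X \<in> carrier_mat n n" unfolding X_def by (rule minus_carrier_mat[OF mean])
  have Xi: "X $$ (i,j) = noise i j \<omega>" if "i < n" "j < n" for i j
    unfolding X_def noise_def using A_carrier[OF \<omega>] mean that mean_mat_index by simp
  have D: "diag_powr q (-\<alpha>) * X * diag_powr q (-\<alpha>) \<in> carrier_mat n n"
    by (intro mult_carrier_mat[of _ n n] diag_powr_carrier q_carrier X)
  note UL = U_Lambda_U_index[where \<alpha> = \<alpha>, OF q_carrier g_less M_carrier M_sym X ij]
  show "signal_plus_noise \<alpha> P n K g q M A \<omega> \<in> carrier_mat n n"
    unfolding signal_plus_noise_def Let_def X_def[symmetric] using UL(2) D by auto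
  have s: "(\<Sum>k<n. X $$ (i,k)) = (\<Sum>k<n. noise i k \<omega>)" "(\<Sum>k<n. X $$ (j,k)) = (\<Sum>k<n. noise j k \<omega>)"
    using Xi ij by auto
  have "signal_plus_noise \<alpha> P n K g q M A \<omega> $$ (i,j)
    = (U_mat \<alpha> n K g q X * Lambda_mat n K g q M * (U_mat \<alpha> n K g q X)\<^sup>T) $$ (i,j)
     + 1 / sqrt n * (q $ i powr (-\<alpha>) * X $$ (i,j) * q $ j powr (-\<alpha>))"
    unfolding signal_plus_noise_def Let_def X_def[symmetric]
    using UL(2) D ij by (simp add: diag_powr_mult_mult_index[OF q_carrier X ij] del: index_mult_mat)
  also note UL(1)
  finally show "signal_plus_noise \<alpha> P n K g q M A \<omega> $$ (i,j)
    = signal_noise_entry \<alpha> n q_fun m_fun (\<lambda>i j. noise i j \<omega>) i j"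
    unfolding s Xi[OF ij] signal_noise_entry_def Let_def by simp
qed

end

section \<open>Expansion of the normalized adjacency matrix\<close>

text \<open>Bounds the derivative b s^(b-1) for s in [1/2, 3/2], at either sign of b - 1. Depending
  only on \<bar>b\<bar>, it serves the exponents \<alpha> and -\<alpha> alike.\<close>

definition powr_lip :: "real \<Rightarrow> real" where
  "powr_lip b = \<bar>b\<bar> * 2 powr (\<bar>b\<bar> + 1)"

lemma powr_lip_nonneg: "0 \<le> powr_lip b" unfolding powr_lip_def by simp

lemma powr_lip_minus: "powr_lip (- b) = powr_lip b" unfolding powr_lip_def by simp

lemma powr_one_add_diff_le:
  fixes t b :: real
  assumes t: "\<bar>t\<bar> \<le> 1/2"
  shows "\<bar>(1 + t) powr b - 1\<bar> \<le> powr_lip b * \<bar>t\<bar>"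
proof -
  have deriv_le: "\<bar>b * s powr (b - 1)\<bar> \<le> powr_lip b" if s: "1/2 \<le> s" "s \<le> 3/2" for s
  proof -
    have "s powr (b - 1) \<le> 2 powr (\<bar>b\<bar> + 1)"
    proof (cases "1 \<le> b")
      case True
      have "s powr (b - 1) \<le> 2 powr (b - 1)" using s True by (intro powr_mono2) auto
      also have "\<dots> \<le> 2 powr (\<bar>b\<bar> + 1)" by (intro powr_mono) auto
      finally show ?thesis .
    next
      case False
      have "s powr (b - 1) \<le> (1/2) powr (b - 1)" using s False by (intro powr_mono2') auto
      also have "\<dots> = 2 powr (1 - b)" by (simp add: powr_divide powr_minus_divide[symmetric])
      also have "\<dots> \<le> 2 powr (\<bar>b\<bar> + 1)" by (intro powr_mono) auto
      finally show ?thesis .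
    qed
    then show ?thesis unfolding powr_lip_def abs_mult by (intro mult_left_mono) auto
  qed
  have "norm ((1 + t) powr b - 1 powr b) \<le> powr_lip b * norm ((1 + t) - 1)"
  proof (rule field_differentiable_bound[of "{1/2..3/2::real}"])
    show "((\<lambda>s. s powr b) has_field_derivative b * s powr (b - 1)) (at s within {1/2..3/2})"
      if "s \<in> {1/2..3/2}" for s
      using that by (auto intro!: derivative_eq_intros)
    show "norm (b * s powr (b - 1)) \<le> powr_lip b" if "s \<in> {1/2..3/2}" for s
      using deriv_le that by simp
  qed (use t in auto)
  then show ?thesis by simp
qed

lemma powr_le_const_base:
  fixes a x b :: real
  assumes "0 < a" "a \<le> x" "x < 1"
  shows "x powr (- b) \<le> a powr (- \<bar>b\<bar>)"
proof -
  have "x powr (- b) \<le> x powr (- \<bar>b\<bar>)" using assms by (intro powr_mono') auto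
  also have "\<dots> \<le> a powr (- \<bar>b\<bar>)" using assms by (intro powr_mono2') auto
  finally show ?thesis .
qed

text \<open>One outcome of the model: \<open>x\<close> is the realized noise, \<open>r\<close> the
  sign pattern, and \<open>T\<close> the only trace of randomness in the bounds. The constants
  derived below depend on \<alpha>, \<open>B\<close> and \<open>qmin\<close> but not on the sample
  or on n.\<close>

locale blockmodel_sample =
  fixes n :: nat and \<alpha> B qmin T :: real and q :: "nat \<Rightarrow> real" and m x r :: "nat \<Rightarrow> nat \<Rightarrow> real"
  assumes n_ge_3: "3 \<le> n" and B_nonneg: "0 \<le> B" and qmin_pos: "0 < qmin"
    and q_bounds: "\<And>i. i < n \<Longrightarrow> qmin \<le> q i \<and> q i < 1"
    and m_bound: "\<And>i j. i < n \<Longrightarrow> j < n \<Longrightarrow> \<bar>m i j\<bar> \<le> B"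
    and adj_01: "\<And>i j. i < n \<Longrightarrow> j < n \<Longrightarrow> mean_entry n q m i j + x i j \<in> {0, 1}"
    and r_sign: "sign_array n r"
    and scale: "noise_scale n r x T"
begin

definition "S = (\<Sum>j<n. q j)"
abbreviation "\<mu> \<equiv> signal_mean n q m"
definition "\<kappa> = (\<Sum>i<n. q i * \<mu> i) / S"
definition "rs i = (\<Sum>j<n. x i j)"
definition "adj i j = mean_entry n q m i j + x i j"

text \<open>The relative fluctuations of the degrees and of the total degree:
  \<open>d i = q i * S * (1 + e i)\<close> and \<open>D = S\<^sup>2 * (1 + \<eta>)\<close>.\<close>

definition "e i = \<mu> i / sqrt n + rs i / (q i * S)"
definition "\<eta> = (\<Sum>i<n. q i * e i) / S"
definition "w i = q i powr (- \<alpha>)"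
definition "G0 i j = m i j / sqrt n - e i - e j + \<kappa> / sqrt n"
definition "G i j = 1 + m i j / sqrt n - (1 + e i) * (1 + e j) / (1 + \<eta>)"
definition "v i = (1 + e i) powr (- \<alpha>)"
definition "h = (1 + \<eta>) powr \<alpha>"
definition "\<tau> = sqrt (ln n / n)"
text \<open>Constants for the two norms of the degree fluctuation: the maximum of \<bar>e i\<bar> is
  at most X0 \<tau> T, its l2 norm at most E0 T. Next, W bounds the weights \<open>w\<close>, and V
  bounds the factors \<open>v\<close> once all \<bar>e i\<bar> \<le> 1/2.\<close>

definition "X0 = B + 1 / qmin\<^sup>2"
definition "E0 = B + 2 / qmin\<^sup>2"
definition "W = qmin powr (- \<bar>\<alpha>\<bar>)"
definition "V = 1 + powr_lip \<alpha>"

section \<open>Size estimates and exact factorizations for one sample\<close>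

lemma n_pos: "0 < real n" "1 \<le> real n" using n_ge_3 by auto

lemma sqrt_n: "0 < sqrt n" "1 \<le> sqrt n" "sqrt n * sqrt n = n" using n_ge_3 by auto

lemma q_pos: "i < n \<Longrightarrow> 0 < q i" using q_bounds qmin_pos by fastforce

lemma q_abs: "i < n \<Longrightarrow> \<bar>q i\<bar> = q i" "i < n \<Longrightarrow> 0 \<le> q i" "i < n \<Longrightarrow> q i \<noteq> 0"
  using q_pos by fastforce+

lemma S_bounds: "n * qmin \<le> S" "S \<le> n" "0 < S"
proof -
  show 1: "n * qmin \<le> S"
    using sum_mono[of "{..<n}" "\<lambda>_. qmin" q] q_bounds unfolding S_def by auto
  show "S \<le> n"
    using sum_mono[of "{..<n}" q "\<lambda>_. 1"] q_bounds unfolding S_def by force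
  have "0 < n * qmin" using n_pos qmin_pos by simp
  then show "0 < S" using 1 by linarith
qed

lemma T_ge_1: "1 \<le> T" using scale unfolding noise_scale_def by simp

lemma ln_n: "1 \<le> ln n"
proof -
  have "exp 1 \<le> (3::real)" using exp_le by simp
  also have "\<dots> \<le> real n" using n_ge_3 by simp
  finally show ?thesis using n_pos by (simp add: ln_ge_iff)
qed

text \<open>From ln n = 2 ln (sqrt n) \<le> 2 sqrt n follows \<tau>^2 \<le> 2 / sqrt n. The fourth
  power is what trades powers of n for powers of \<tau> in the crude case.\<close>

lemma \<tau>_bounds: "0 < \<tau>" "1 / sqrt n \<le> \<tau>" "\<tau> ^ 4 \<le> 4 / n"
proof -
  have "1 / n \<le> ln n / n" using ln_n n_pos by (intro divide_right_mono) auto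
  then have "sqrt (1 / n) \<le> \<tau>" unfolding \<tau>_def by simp
  then show *: "1 / sqrt n \<le> \<tau>" by (simp add: real_sqrt_divide)
  then show "0 < \<tau>" using sqrt_n by (meson less_le_trans zero_less_divide_1_iff)
  have "ln n = 2 * ln (sqrt n)" using n_pos by (simp add: ln_sqrt)
  also have "\<dots> \<le> 2 * sqrt n" using ln_le_minus_one[of "sqrt n"] sqrt_n by simp
  finally have "ln n / n \<le> 2 * sqrt n / n" using n_pos by (intro divide_right_mono) auto
  then have "(ln n / n)\<^sup>2 \<le> (2 * sqrt n / n)\<^sup>2" using ln_n n_pos by (intro power_mono) auto
  also have "\<dots> = 4 / n" using n_pos by (simp add: power_divide power_mult_distrib power2_eq_square)
  also have "(ln n / n)\<^sup>2 = (\<tau>\<^sup>2)\<^sup>2" unfolding \<tau>_def using ln_n n_pos by simp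
  finally show "\<tau> ^ 4 \<le> 4 / n" by simp
qed

lemma \<mu>_bound: "i < n \<Longrightarrow> \<bar>\<mu> i\<bar> \<le> B"
proof -
  assume i: "i < n"
  have "\<bar>\<Sum>j<n. m i j * q j\<bar> \<le> (\<Sum>j<n. \<bar>m i j * q j\<bar>)" by (rule sum_abs)
  also have "\<dots> \<le> (\<Sum>j<n. B * q j)"
    by (rule sum_mono) (use m_bound i q_abs B_nonneg in \<open>auto simp: abs_mult intro!: mult_mono\<close>)
  also have "\<dots> = B * S" unfolding S_def by (simp add: sum_distrib_left)
  finally show ?thesis
    unfolding signal_mean_def S_def[symmetric] using S_bounds(3) by (simp add: pos_divide_le_eq)
qed

lemma weighted_mean_abs_le:
  assumes "\<And>i. i < n \<Longrightarrow> \<bar>f i\<bar> \<le> c"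
  shows "\<bar>(\<Sum>i<n. q i * f i) / S\<bar> \<le> c"
proof -
  have "\<bar>\<Sum>i<n. q i * f i\<bar> \<le> (\<Sum>i<n. \<bar>q i * f i\<bar>)" by (rule sum_abs)
  also have "\<dots> \<le> (\<Sum>i<n. q i * c)"
    by (rule sum_mono) (use assms q_abs in \<open>auto simp: abs_mult intro!: mult_left_mono\<close>)
  also have "\<dots> = c * S" unfolding S_def by (simp add: sum_distrib_left mult.commute)
  finally show ?thesis using S_bounds(3) by (simp add: pos_divide_le_eq)
qed

lemma \<kappa>_bound: "\<bar>\<kappa>\<bar> \<le> B"
  unfolding \<kappa>_def by (rule weighted_mean_abs_le[OF \<mu>_bound])

lemma degree_eq: "i < n \<Longrightarrow> (\<Sum>j<n. adj i j) = q i * S * (1 + e i)"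
proof -
  assume i: "i < n"
  have "(\<Sum>j<n. adj i j) = q i * S + q i * (\<Sum>j<n. m i j * q j) / sqrt n + rs i"
    unfolding adj_def mean_entry_def rs_def S_def
    by (simp add: sum.distrib algebra_simps sum_distrib_left sum_divide_distrib)
  moreover have "(\<Sum>j<n. m i j * q j) = S * \<mu> i"
    unfolding signal_mean_def S_def[symmetric] using S_bounds(3) by simp
  ultimately show ?thesis
    unfolding e_def using q_pos[OF i] S_bounds(3) by (simp add: field_simps)
qed

lemma total_degree_eq: "(\<Sum>i<n. \<Sum>j<n. adj i j) = S * S * (1 + \<eta>)"
proof -
  have "(\<Sum>i<n. \<Sum>j<n. adj i j) = (\<Sum>i<n. q i * S * (1 + e i))"
    by (rule sum.cong) (auto simp: degree_eq)
  also have "\<dots> = S * (\<Sum>i<n. q i) + S * (\<Sum>i<n. q i * e i)"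
    by (simp add: algebra_simps sum.distrib sum_distrib_left)
  also have "\<dots> = S * S * (1 + \<eta>)"
    unfolding \<eta>_def using S_bounds(3) by (simp add: S_def[symmetric] field_simps)
  finally show ?thesis .
qed

text \<open>In the q-weighted mean of \<open>e\<close> the weight q i cancels the denominator of the
  noise part, leaving the total sum of the noise. Its order n makes \<eta> - \<kappa> / sqrt n of
  order 1/n.\<close>

lemma \<eta>_eq: "\<eta> = \<kappa> / sqrt n + (\<Sum>i<n. rs i) / (S * S)"
proof -
  have "(\<Sum>i<n. q i * e i) = (\<Sum>i<n. q i * \<mu> i / sqrt n + rs i / S)"
    by (rule sum.cong) (use q_abs S_bounds(3) in \<open>auto simp: e_def distrib_left\<close>)
  also have "\<dots> = (\<Sum>i<n. q i * \<mu> i) / sqrt n + (\<Sum>i<n. rs i) / S"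
    by (simp add: sum.distrib sum_divide_distrib)
  finally show ?thesis
    unfolding \<eta>_def \<kappa>_def using S_bounds(3) by (simp add: add_divide_distrib)
qed

text \<open>The two halves of -e i - e j play different parts: the \<mu>-terms are the centring of
  m, and the row-sum terms are the cross terms with the noise column.\<close>

lemma signal_noise_entry_eq:
  assumes ij: "i < n" "j < n"
  shows "signal_noise_entry \<alpha> n q m x i j = w i * w j * (1 / sqrt n) * (q i * q j * G0 i j + x i j)"
proof -
  have p: "q k powr (1 - \<alpha>) = q k * w k" if "k < n" for k
    using q_pos[OF that] unfolding w_def by (simp add: powr_diff powr_minus_divide)
  have G: "G0 i j = (m i j - \<mu> i - \<mu> j + \<kappa>) / sqrt n - rs i / (q i * S) - rs j / (q j * S)"
    unfolding G0_def e_def by (simp add: diff_divide_distrib add_divide_distrib)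
  have "q i * q j * G0 i j = q i * q j * ((m i j - \<mu> i - \<mu> j + \<kappa>) / sqrt n)
      - q j * (rs i / S) - q i * (rs j / S)"
    unfolding G using q_abs(3)[OF ij(1)] q_abs(3)[OF ij(2)] S_bounds(3) by (simp add: right_diff_distrib)
  then have "w i * w j * (1 / sqrt n) * (q i * q j * G0 i j + x i j)
    = w i * w j * (1 / sqrt n) * (q i * q j * ((m i j - \<mu> i - \<mu> j + \<kappa>) / sqrt n))
      - w i * w j * (1 / sqrt n) * (q j * (rs i / S)) - w i * w j * (1 / sqrt n) * (q i * (rs j / S))
      + w i * w j * (1 / sqrt n) * x i j"
    by (simp only: right_diff_distrib distrib_left)
  also have "w i * w j * (1 / sqrt n) * (q i * q j * (c / sqrt n)) = q i * w i * (q j * w j) * c / n" for c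
  proof -
    have "w i * w j * (1 / sqrt n) * (q i * q j * (c / sqrt n))
      = q i * w i * (q j * w j) * c / (sqrt n * sqrt n)" by simp
    then show ?thesis unfolding sqrt_n(3) .
  qed
  finally have "w i * w j * (1 / sqrt n) * (q i * q j * G0 i j + x i j)
    = q i * w i * (q j * w j) * (m i j - \<mu> i - \<mu> j + \<kappa>) / n
      - w i * w j * (1 / sqrt n) * (q j * (rs i / S)) - w i * w j * (1 / sqrt n) * (q i * (rs j / S))
      + w i * w j * (1 / sqrt n) * x i j" .
  then show ?thesis
    unfolding signal_noise_entry_def Let_def S_def[symmetric] \<kappa>_def[symmetric] p[OF ij(1)] p[OF ij(2)]
      rs_def[symmetric] w_def[symmetric] by (simp add: mult_ac)
qed

text \<open>With all factors of the degrees positive, the powers split; the power S^(2 \<alpha>) of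
  the total degree cancels the S^(-\<alpha>) of each of the two degrees.\<close>

lemma norm_adj_entry_eq:
  assumes ij: "i < n" "j < n" and pos: "-1 < e i" "-1 < e j" "-1 < \<eta>"
  shows "norm_adj_entry \<alpha> n adj i j = w i * w j * (1 / sqrt n) * (h * v i * v j * (q i * q j * G i j + x i j))"
proof -
  have dpow: "(q k * S * (1 + e k)) powr (- \<alpha>) = w k * S powr (- \<alpha>) * v k" if "k < n" "-1 < e k" for k
    using q_pos[OF that(1)] S_bounds(3) that(2) unfolding w_def v_def
    by (simp add: powr_mult)
  have Dpow: "(S * S * (1 + \<eta>)) powr \<alpha> = S powr \<alpha> * S powr \<alpha> * h"
    using S_bounds(3) pos(3) unfolding h_def by (simp add: powr_mult)
  have inv: "S powr \<alpha> * S powr (- \<alpha>) = 1"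
    using S_bounds(3) by (simp flip: powr_add)
  have "adj i j - q i * S * (1 + e i) * (q j * S * (1 + e j)) / (S * S * (1 + \<eta>))
      = q i * q j * G i j + x i j"
  proof -
    have "q i * S * (1 + e i) * (q j * S * (1 + e j)) / (S * S * (1 + \<eta>))
      = S * S * (q i * q j * ((1 + e i) * (1 + e j))) / (S * S * (1 + \<eta>))" by (simp only: mult_ac)
    also have "\<dots> = q i * q j * ((1 + e i) * (1 + e j) / (1 + \<eta>))"
      using S_bounds(3) by simp
    finally show ?thesis unfolding adj_def mean_entry_def G_def by (simp add: right_diff_distrib)
  qed
  then have "norm_adj_entry \<alpha> n adj i j = S powr \<alpha> * S powr \<alpha> * h / sqrt n *
      (w i * S powr (- \<alpha>) * v i * (q i * q j * G i j + x i j) * (w j * S powr (- \<alpha>) * v j))"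
    unfolding norm_adj_entry_def Let_def total_degree_eq degree_eq[OF ij(1)] degree_eq[OF ij(2)]
      dpow[OF ij(1) pos(1)] dpow[OF ij(2) pos(2)] Dpow by simp
  also have "\<dots> = (S powr \<alpha> * S powr (- \<alpha>)) * (S powr \<alpha> * S powr (- \<alpha>)) *
      (w i * w j * (1 / sqrt n) * (h * v i * v j * (q i * q j * G i j + x i j)))"
    by (simp add: mult_ac)
  finally show ?thesis unfolding inv by simp
qed

text \<open>The row sums are x applied to the all-ones vector, so their l2 norm is at most the
  operator norm times sqrt n. Unlike a bound through the largest row sum, this carries no
  logarithm.\<close>

lemma row_sums_L2: "L2_set rs {..<n} \<le> 2 * n * T"
proof (cases "L2_set rs {..<n} = 0")
  case True
  then show ?thesis using T_ge_1 by simp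
next
  case False
  have b: "blf_bound n x (2 * sqrt n * T)" using scale unfolding noise_scale_def by simp
  have "(L2_set rs {..<n})\<^sup>2 = (\<Sum>i<n. rs i * rs i)"
    unfolding L2_set_def by (simp add: sum_nonneg power2_eq_square)
  also have "\<dots> = blf n x rs (\<lambda>_. 1)"
    unfolding blf_def by (rule sum.cong) (auto simp: rs_def sum_distrib_left)
  also have "\<dots> \<le> 2 * sqrt n * T * L2_set rs {..<n} * L2_set (\<lambda>_. 1) {..<n}"
    using b unfolding blf_bound_def by (meson abs_le_D1)
  also have "\<dots> = L2_set rs {..<n} * (2 * (sqrt n * sqrt n) * T)"
    unfolding L2_set_const by simp
  finally have "L2_set rs {..<n} * L2_set rs {..<n} \<le> L2_set rs {..<n} * (2 * n * T)"
    unfolding sqrt_n by (simp add: power2_eq_square)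
  then show ?thesis using False L2_set_nonneg[of rs "{..<n}"] by (simp add: mult_le_cancel_left)
qed

lemma qS_ge: "i < n \<Longrightarrow> n * qmin\<^sup>2 \<le> q i * S"
proof -
  assume i: "i < n"
  have "qmin * (n * qmin) \<le> q i * S"
    using q_bounds[OF i] qmin_pos S_bounds n_pos by (intro mult_mono) auto
  then show ?thesis by (simp add: power2_eq_square mult_ac)
qed

lemma rs_ratio_le: "i < n \<Longrightarrow> \<bar>rs i / (q i * S)\<bar> \<le> \<bar>rs i\<bar> / (n * qmin\<^sup>2)"
  using qS_ge[of i] n_pos qmin_pos by (auto simp: abs_divide intro!: frac_le)

lemma e_L2: "L2_set e {..<n} \<le> E0 * T"
proof -
  have "L2_set e {..<n} \<le> L2_set (\<lambda>i. \<mu> i / sqrt n) {..<n} + L2_set (\<lambda>i. rs i / (q i * S)) {..<n}"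
    unfolding e_def by (rule L2_set_triangle_ineq)
  also have "L2_set (\<lambda>i. \<mu> i / sqrt n) {..<n} \<le> L2_set (\<lambda>i. B / sqrt n) {..<n}"
    by (rule L2_set_le_of_abs_le) (use \<mu>_bound sqrt_n in \<open>auto simp: abs_divide intro!: divide_right_mono\<close>)
  also have "\<dots> = B" unfolding L2_set_const using B_nonneg sqrt_n by simp
  also have "L2_set (\<lambda>i. rs i / (q i * S)) {..<n} \<le> 1 / (n * qmin\<^sup>2) * L2_set rs {..<n}"
    by (rule L2_set_abs_le_mult) (use rs_ratio_le n_pos qmin_pos in auto)
  also have "\<dots> \<le> 1 / (n * qmin\<^sup>2) * (2 * n * T)"
    using row_sums_L2 by (intro mult_left_mono) auto
  also have "\<dots> = 2 / qmin\<^sup>2 * T" using n_pos by simp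
  also have "B + 2 / qmin\<^sup>2 * T \<le> B * T + 2 / qmin\<^sup>2 * T"
    using T_ge_1 B_nonneg by (simp add: mult_le_cancel_left1)
  finally show ?thesis unfolding E0_def by (simp add: algebra_simps)
qed

lemma e_abs: "i < n \<Longrightarrow> \<bar>e i\<bar> \<le> X0 * \<tau> * T"
proof -
  assume i: "i < n"
  have rsi: "\<bar>rs i\<bar> \<le> sqrt (n * ln n) * T"
    using scale i unfolding noise_scale_def rs_def by auto
  have sq: "sqrt (n * ln n) / n = \<tau>"
  proof -
    have "sqrt (n * ln n) / n = sqrt n * sqrt (ln n) / (sqrt n * sqrt n)"
      unfolding sqrt_n(3) by (simp add: real_sqrt_mult)
    also have "\<dots> = sqrt (ln n) / sqrt n" using sqrt_n(1) by (simp only: mult_divide_mult_cancel_left)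
    also have "\<dots> = \<tau>" unfolding \<tau>_def by (simp add: real_sqrt_divide)
    finally show ?thesis .
  qed
  have "\<bar>e i\<bar> \<le> \<bar>\<mu> i / sqrt n\<bar> + \<bar>rs i / (q i * S)\<bar>" unfolding e_def by (rule abs_triangle_ineq)
  also have "\<bar>\<mu> i / sqrt n\<bar> \<le> B * (1 / sqrt n)"
    using \<mu>_bound[OF i] sqrt_n by (auto simp: abs_divide intro!: divide_right_mono)
  also have "\<dots> \<le> B * (\<tau> * T)"
  proof (rule mult_left_mono[OF _ B_nonneg])
    have "1 / sqrt n * 1 \<le> \<tau> * T" using \<tau>_bounds T_ge_1 by (intro mult_mono) auto
    then show "1 / sqrt n \<le> \<tau> * T" by simp
  qed
  also have "\<bar>rs i / (q i * S)\<bar> \<le> \<bar>rs i\<bar> / (n * qmin\<^sup>2)" by (rule rs_ratio_le[OF i])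
  also have "\<dots> \<le> sqrt (n * ln n) * T / (n * qmin\<^sup>2)"
    by (rule divide_right_mono[OF rsi]) simp
  also have "\<dots> = 1 / qmin\<^sup>2 * (sqrt (n * ln n) / n * T)" by simp
  finally show ?thesis unfolding sq X0_def by (simp add: algebra_simps)
qed

text \<open>Cauchy-Schwarz with the l2 bound on \<open>e\<close> shows that \<eta> is of order T /
  sqrt n, again without the logarithm that the maximum of \<bar>e i\<bar> would bring.\<close>

lemma \<eta>_L2: "n * \<bar>\<eta>\<bar> \<le> sqrt n * (E0 * T) / qmin"
proof -
  have "\<bar>\<Sum>i<n. q i * e i\<bar> \<le> (\<Sum>i<n. \<bar>q i\<bar> * \<bar>e i\<bar>)"
    using sum_abs[of "\<lambda>i. q i * e i" "{..<n}"] by (simp add: abs_mult)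
  also have "\<dots> \<le> L2_set q {..<n} * L2_set e {..<n}" by (rule L2_set_mult_ineq)
  also have "\<dots> \<le> sqrt n * (E0 * T)"
  proof (rule mult_mono[OF _ e_L2])
    have "L2_set q {..<n} \<le> L2_set (\<lambda>_. 1) {..<n}"
      by (rule L2_set_le_of_abs_le) (use q_bounds q_abs in \<open>auto simp: less_imp_le\<close>)
    then show "L2_set q {..<n} \<le> sqrt n" unfolding L2_set_const by simp
  qed auto
  finally have le: "\<bar>\<Sum>i<n. q i * e i\<bar> \<le> sqrt n * (E0 * T)" .
  have "\<bar>\<eta>\<bar> \<le> \<bar>\<Sum>i<n. q i * e i\<bar> / (n * qmin)"
    unfolding \<eta>_def abs_divide using S_bounds n_pos qmin_pos by (intro divide_left_mono) auto
  also have "\<dots> \<le> sqrt n * (E0 * T) / (n * qmin)"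
    using le n_pos qmin_pos by (intro divide_right_mono) auto
  finally show ?thesis using n_pos qmin_pos by (simp add: field_simps)
qed

lemma w_bounds: "i < n \<Longrightarrow> 0 \<le> w i" "i < n \<Longrightarrow> w i \<le> W"
  unfolding w_def W_def using powr_le_const_base[OF qmin_pos] q_bounds by auto

lemma W_nonneg: "0 \<le> W" unfolding W_def by simp

lemma V_ge_1: "1 \<le> V" unfolding V_def using powr_lip_nonneg by simp

lemma X0_nonneg: "0 \<le> X0" unfolding X0_def using B_nonneg by simp

lemma E0_nonneg: "0 \<le> E0" unfolding E0_def using B_nonneg by simp

text \<open>The coefficients of \<open>noise_part_bound\<close> and \<open>signal_part_bound\<close>
  after inserting \<xi> = X0 \<tau> T; there L = 3 * powr_lip \<alpha> * V^2, which explains the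
  multiples of 9.\<close>

definition "C_good = W\<^sup>2 * (6 * powr_lip \<alpha> * V\<^sup>2 * X0 + 3 * powr_lip \<alpha> * V\<^sup>2 * X0 * B
  + (9 * powr_lip \<alpha> * V\<^sup>2 + 3) * X0 * E0 / qmin + 1 / qmin\<^sup>2
  + 2 * (9 * powr_lip \<alpha> * V\<^sup>2 + 4) * X0 * E0)"

section \<open>The expansion when every \<bar>e i\<bar> is at most 1/2\<close>

lemma \<eta>_abs: "(\<And>i. i < n \<Longrightarrow> \<bar>e i\<bar> \<le> c) \<Longrightarrow> \<bar>\<eta>\<bar> \<le> c"
  unfolding \<eta>_def by (rule weighted_mean_abs_le)

lemma scale_factor_bounds:
  assumes \<xi>: "\<And>i. i < n \<Longrightarrow> \<bar>e i\<bar> \<le> \<xi>" and half: "\<xi> \<le> 1/2"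
  shows "\<bar>h - 1\<bar> \<le> powr_lip \<alpha> * \<xi>"
    and "i < n \<Longrightarrow> \<bar>v i - 1\<bar> \<le> powr_lip \<alpha> * \<xi>"
    and "i < n \<Longrightarrow> \<bar>v i\<bar> \<le> V"
    and "0 \<le> powr_lip \<alpha> * \<xi>"
proof -
  let ?L = "powr_lip \<alpha>"
  have \<xi>0: "0 \<le> \<xi>" using \<xi>[of 0] n_ge_3 by force
  have L0: "0 \<le> ?L" by (rule powr_lip_nonneg)
  then show "0 \<le> ?L * \<xi>" using \<xi>0 by simp
  have \<eta>\<xi>: "\<bar>\<eta>\<bar> \<le> \<xi>" using \<eta>_abs \<xi> by blast
  show "\<bar>h - 1\<bar> \<le> ?L * \<xi>" unfolding h_def
    by (rule order_trans[OF powr_one_add_diff_le]) (use \<eta>\<xi> half L0 in \<open>auto intro: mult_left_mono\<close>)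
  show v1: "\<bar>v i - 1\<bar> \<le> ?L * \<xi>" if "i < n" for i unfolding v_def powr_lip_minus[of \<alpha>, symmetric]
    by (rule order_trans[OF powr_one_add_diff_le])
      (use \<xi>[OF that] half powr_lip_nonneg in \<open>auto intro: mult_left_mono\<close>)
  have "?L * \<xi> \<le> ?L * 1" using half L0 by (intro mult_left_mono) auto
  then show "\<bar>v i\<bar> \<le> V" if "i < n" for i using v1[OF that] unfolding V_def by linarith
qed

lemma V_square_bounds: "V \<le> V\<^sup>2" "1 \<le> V\<^sup>2"
  using V_ge_1 by (auto simp: power2_eq_square mult_le_cancel_left1 mult_ge1_I)

text \<open>The factor telescopes: h v i v j - 1 = (h - 1) v i v j + (v i - 1) v j + (v j - 1). Each
  summand scales the signed noise diagonally, so its operator norm of order sqrt n is kept; the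
  Frobenius norm would be of order n. The 6 is 3 summands times the 2 in the operator norm
  bound.\<close>

lemma noise_part_bound:
  assumes \<xi>: "\<And>i. i < n \<Longrightarrow> \<bar>e i\<bar> \<le> \<xi>" and half: "\<xi> \<le> 1/2"
  shows "blf_bound n (\<lambda>i j. (h * v i * v j - 1) * (r i j * x i j)) (6 * powr_lip \<alpha> * V\<^sup>2 * \<xi> * (sqrt n * T))"
proof -
  let ?L = "powr_lip \<alpha>" and ?y = "\<lambda>i j. r i j * x i j"
  define c where "c = 2 * sqrt n * T"
  have c0: "0 \<le> c" unfolding c_def using T_ge_1 by simp
  have y: "blf_bound n ?y c" using scale unfolding noise_scale_def c_def by simp
  have h1: "\<bar>h - 1\<bar> \<le> ?L * \<xi>" and v1: "\<And>i. i < n \<Longrightarrow> \<bar>v i - 1\<bar> \<le> ?L * \<xi>"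
    and vV: "\<And>i. i < n \<Longrightarrow> \<bar>v i\<bar> \<le> V" and L\<xi>: "0 \<le> ?L * \<xi>"
    using scale_factor_bounds[of \<xi>] \<xi> half by blast+
  have V0: "0 \<le> V" using V_ge_1 by simp
  have "blf_bound n (\<lambda>i j. (h - 1) * (v i * v j * ?y i j)) (\<bar>h - 1\<bar> * (V * V * c))"
    by (intro blf_bound_cmult blf_bound_diag y c0 vV V0)
  moreover have "\<bar>h - 1\<bar> * (V * V * c) \<le> ?L * \<xi> * (V * V * c)"
    using h1 V0 c0 by (intro mult_right_mono) auto
  ultimately have 1: "blf_bound n (\<lambda>i j. (h - 1) * (v i * v j * ?y i j)) (?L * \<xi> * (V * V * c))"
    by (rule blf_bound_mono)
  have 2: "blf_bound n (\<lambda>i j. (v i - 1) * v j * ?y i j) (?L * \<xi> * V * c)"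
    by (intro blf_bound_diag y c0 vV v1 V0 L\<xi>)
  have 3: "blf_bound n (\<lambda>i j. 1 * (v j - 1) * ?y i j) (1 * (?L * \<xi>) * c)"
    by (rule blf_bound_diag[OF y c0]) (use v1 L\<xi> in auto)
  have eq: "(h - 1) * (v i * v j * ?y i j) + (v i - 1) * v j * ?y i j + 1 * (v j - 1) * ?y i j
      = (h * v i * v j - 1) * ?y i j" for i j
    by (simp add: algebra_simps)
  note VV = V_square_bounds
  have "?L * \<xi> * (V * V * c) + ?L * \<xi> * V * c + 1 * (?L * \<xi>) * c = (?L * \<xi> * c) * (V\<^sup>2 + V + 1)"
    by (simp add: algebra_simps power2_eq_square)
  also have "\<dots> \<le> (?L * \<xi> * c) * (3 * V\<^sup>2)"
    using VV L\<xi> c0 by (intro mult_left_mono) auto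
  also have "\<dots> = 6 * ?L * V\<^sup>2 * \<xi> * (sqrt n * T)" unfolding c_def by simp
  finally have "?L * \<xi> * (V * V * c) + ?L * \<xi> * V * c + 1 * (?L * \<xi>) * c \<le> 6 * ?L * V\<^sup>2 * \<xi> * (sqrt n * T)" .
  with blf_bound_add[OF blf_bound_add[OF 1 2] 3] show ?thesis
    unfolding eq by (rule blf_bound_mono)
qed

text \<open>The entrywise form of the same telescoping, for the signal part, where absolute values
  of entries suffice.\<close>

lemma factor_diff_le:
  assumes \<xi>: "\<And>i. i < n \<Longrightarrow> \<bar>e i\<bar> \<le> \<xi>" and half: "\<xi> \<le> 1/2" and ij: "i < n" "j < n"
  shows "\<bar>h * v i * v j - 1\<bar> \<le> 3 * powr_lip \<alpha> * V\<^sup>2 * \<xi>"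
proof -
  let ?L = "powr_lip \<alpha>"
  have h1: "\<bar>h - 1\<bar> \<le> ?L * \<xi>" and v1: "\<And>i. i < n \<Longrightarrow> \<bar>v i - 1\<bar> \<le> ?L * \<xi>"
    and vV: "\<And>i. i < n \<Longrightarrow> \<bar>v i\<bar> \<le> V" and L\<xi>: "0 \<le> ?L * \<xi>"
    using scale_factor_bounds[of \<xi>] \<xi> half by blast+
  have V0: "0 \<le> V" using V_ge_1 by simp
  note VV = V_square_bounds
  have "h * v i * v j - 1 = (h - 1) * (v i * v j) + (v i - 1) * v j + (v j - 1)"
    by (simp add: algebra_simps)
  then have "\<bar>h * v i * v j - 1\<bar> \<le> \<bar>(h - 1) * (v i * v j)\<bar> + \<bar>(v i - 1) * v j\<bar> + \<bar>v j - 1\<bar>"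
    by linarith
  then have "\<bar>h * v i * v j - 1\<bar> \<le> \<bar>h - 1\<bar> * (\<bar>v i\<bar> * \<bar>v j\<bar>) + \<bar>v i - 1\<bar> * \<bar>v j\<bar> + \<bar>v j - 1\<bar>"
    unfolding abs_mult .
  also have "\<dots> \<le> ?L * \<xi> * (V * V) + ?L * \<xi> * V + ?L * \<xi>"
    using h1 v1[OF ij(1)] v1[OF ij(2)] vV[OF ij(1)] vV[OF ij(2)] L\<xi> V0
    by (intro add_mono mult_mono) auto
  also have "\<dots> = ?L * \<xi> * (V\<^sup>2 + V + 1)" by (simp add: algebra_simps power2_eq_square)
  also have "\<dots> \<le> ?L * \<xi> * (3 * V\<^sup>2)" using VV L\<xi> by (intro mult_left_mono) auto
  finally show ?thesis by (simp add: mult_ac)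
qed

lemma ratio_bounds:
  assumes \<xi>: "\<And>i. i < n \<Longrightarrow> \<bar>e i\<bar> \<le> \<xi>" and half: "\<xi> \<le> 1/2" and ij: "i < n" "j < n"
  shows "\<bar>1 - (1 + e i) * (1 + e j) / (1 + \<eta>)\<bar> \<le> 3 * (\<bar>\<eta>\<bar> + \<bar>e i\<bar> + \<bar>e j\<bar>)"
proof -
  have \<eta>\<xi>: "\<bar>\<eta>\<bar> \<le> 1/2" using \<eta>_abs \<xi> half by (meson order_trans)
  have e: "\<bar>e i\<bar> \<le> 1/2" "\<bar>e j\<bar> \<le> 1/2" using \<xi>[OF ij(1)] \<xi>[OF ij(2)] half by auto
  have pos: "1/2 \<le> 1 + \<eta>" using \<eta>\<xi> by linarith
  have eq: "1 - (1 + e i) * (1 + e j) / (1 + \<eta>) = (\<eta> - e i - e j - e i * e j) / (1 + \<eta>)"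
    using pos by (simp add: field_simps)
  have "\<bar>1 - (1 + e i) * (1 + e j) / (1 + \<eta>)\<bar> = \<bar>\<eta> - e i - e j - e i * e j\<bar> / (1 + \<eta>)"
    unfolding eq using pos by (simp add: abs_divide)
  also have "\<dots> \<le> (\<bar>\<eta>\<bar> + \<bar>e i\<bar> + \<bar>e j\<bar> + \<bar>e i\<bar> * (1/2)) / (1/2)"
  proof (rule frac_le)
    have "\<bar>e i * e j\<bar> \<le> \<bar>e i\<bar> * (1/2)" unfolding abs_mult using e by (intro mult_left_mono) auto
    then show "\<bar>\<eta> - e i - e j - e i * e j\<bar> \<le> \<bar>\<eta>\<bar> + \<bar>e i\<bar> + \<bar>e j\<bar> + \<bar>e i\<bar> * (1/2)" by linarith
  qed (use pos in auto)
  also have "\<dots> \<le> 3 * (\<bar>\<eta>\<bar> + \<bar>e i\<bar> + \<bar>e j\<bar>)" by simp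
  finally show ?thesis .
qed

text \<open>Writing F G - G0 = (F - 1) G + (G - G0), every contribution is second order or is the
  small difference of \<eta> and \<kappa> / sqrt n. In products of fluctuations only one factor is
  replaced by the maximum \<xi>; the other stays as \<bar>\<eta>\<bar>, \<bar>e i\<bar> or \<bar>e
  j\<bar> for the later l2 estimate.\<close>

lemma signal_part_entry_le:
  assumes \<xi>: "\<And>i. i < n \<Longrightarrow> \<bar>e i\<bar> \<le> \<xi>" and half: "\<xi> \<le> 1/2" and ij: "i < n" "j < n"
  defines "L \<equiv> 3 * powr_lip \<alpha> * V\<^sup>2"
  shows "\<bar>h * v i * v j * G i j - G0 i j\<bar>
    \<le> (L * \<xi> * (B / sqrt n + 3 * \<bar>\<eta>\<bar>) + \<bar>\<Sum>i<n. rs i\<bar> / (S * S) + 3 * \<xi> * \<bar>\<eta>\<bar>)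
      + (3 * L + 4) * \<xi> * \<bar>e i\<bar> + (3 * L + 4) * \<xi> * \<bar>e j\<bar>"
proof -
  let ?s = "\<bar>\<eta>\<bar> + \<bar>e i\<bar> + \<bar>e j\<bar>" and ?R = "(1 + e i) * (1 + e j) / (1 + \<eta>)"
  have \<xi>0: "0 \<le> \<xi>" using \<xi>[of 0] n_ge_3 by force
  have \<eta>\<xi>: "\<bar>\<eta>\<bar> \<le> \<xi>" using \<eta>_abs \<xi> by blast
  have L0: "0 \<le> L" unfolding L_def using powr_lip_nonneg by simp
  have R: "\<bar>1 - ?R\<bar> \<le> 3 * ?s" by (rule ratio_bounds[OF \<xi> half ij])
  have "\<bar>m i j / sqrt n\<bar> \<le> B / sqrt n"
    using m_bound[OF ij] sqrt_n by (auto simp: abs_divide intro!: divide_right_mono)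
  then have G: "\<bar>G i j\<bar> \<le> B / sqrt n + 3 * ?s" unfolding G_def using R by linarith
  have F: "\<bar>h * v i * v j - 1\<bar> \<le> L * \<xi>" unfolding L_def by (rule factor_diff_le[OF \<xi> half ij])
  have 1: "\<bar>(h * v i * v j - 1) * G i j\<bar> \<le> L * \<xi> * (B / sqrt n + 3 * ?s)"
    unfolding abs_mult using F G L0 \<xi>0 by (intro mult_mono) auto
  have pos: "1 + \<eta> \<noteq> 0" using \<eta>\<xi> half by linarith
  \<comment> \<open>Since (1 + e i) (1 + e j) = ?R (1 + \<eta>), the linear terms e i + e j cancel
    against those of \<open>G0\<close>, up to \<eta> * ?R and the product e i * e j.\<close>
  have "(1 + e i) * (1 + e j) - ?R = ?R * \<eta>" using pos by (simp add: field_simps)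
  then have eq: "G i j - G0 i j = (\<eta> - \<kappa> / sqrt n) - \<eta> * (1 - ?R) - e i * e j"
    unfolding G_def G0_def by (simp add: algebra_simps)
  have "\<bar>\<eta> * (1 - ?R)\<bar> \<le> \<xi> * (3 * ?s)"
    unfolding abs_mult using \<eta>\<xi> R \<xi>0 by (intro mult_mono) auto
  moreover have "\<bar>e i * e j\<bar> \<le> \<xi> * \<bar>e j\<bar>"
    unfolding abs_mult using \<xi>[OF ij(1)] by (intro mult_right_mono) auto
  moreover have "\<bar>\<eta> - \<kappa> / sqrt n\<bar> = \<bar>\<Sum>i<n. rs i\<bar> / (S * S)"
    unfolding \<eta>_eq using S_bounds by (simp add: abs_divide)
  moreover have "\<bar>a - b - c\<bar> \<le> a' + b' + c'" if "\<bar>b\<bar> \<le> b'" "\<bar>c\<bar> \<le> c'" "\<bar>a\<bar> = a'" for a b c a' b' c' :: real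
    using that by linarith
  ultimately have 2: "\<bar>G i j - G0 i j\<bar> \<le> \<bar>\<Sum>i<n. rs i\<bar> / (S * S) + \<xi> * (3 * ?s) + \<xi> * \<bar>e j\<bar>"
    unfolding eq by blast
  have "h * v i * v j * G i j - G0 i j = (h * v i * v j - 1) * G i j + (G i j - G0 i j)"
    unfolding left_diff_distrib by simp
  then have "\<bar>h * v i * v j * G i j - G0 i j\<bar>
    \<le> L * \<xi> * (B / sqrt n + 3 * ?s) + (\<bar>\<Sum>i<n. rs i\<bar> / (S * S) + \<xi> * (3 * ?s) + \<xi> * \<bar>e j\<bar>)"
    by (simp only:) (rule order_trans[OF abs_triangle_ineq add_mono[OF 1 2]])
  moreover have "0 \<le> \<xi> * \<bar>e i\<bar>" using \<xi>0 by simp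
  ultimately show ?thesis by (simp add: algebra_simps)
qed

text \<open>Signs and the factors q i q j only shrink or preserve moduli, so the entry bound feeds
  directly into \<open>blf_bound_of_abs_le_sum\<close>. Both n \<bar>\<eta>\<bar> and sqrt n times
  the l2 norm of \<open>e\<close> are of order sqrt n, and the prefactor 1 / sqrt n of the matrices
  removes it.\<close>

lemma signal_part_bound:
  assumes \<xi>: "\<And>i. i < n \<Longrightarrow> \<bar>e i\<bar> \<le> \<xi>" and half: "\<xi> \<le> 1/2"
  defines "L \<equiv> 3 * powr_lip \<alpha> * V\<^sup>2"
  shows "blf_bound n (\<lambda>i j. r i j * (q i * q j * (h * v i * v j * G i j - G0 i j)))
    (sqrt n * (L * \<xi> * B + (3 * L + 3) * \<xi> * (E0 * T) / qmin + T / (qmin\<^sup>2 * sqrt n)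
      + 2 * (3 * L + 4) * \<xi> * (E0 * T)))"
proof -
  have \<xi>0: "0 \<le> \<xi>" using \<xi>[of 0] n_ge_3 by force
  have L0: "0 \<le> L" unfolding L_def using powr_lip_nonneg by simp
  define Z where "Z = \<bar>\<Sum>i<n. rs i\<bar> / (S * S)"
  define s where "s = L * \<xi> * (B / sqrt n + 3 * \<bar>\<eta>\<bar>) + Z + 3 * \<xi> * \<bar>\<eta>\<bar>"
  define u where "u i = (3 * L + 4) * \<xi> * \<bar>e i\<bar>" for i
  have Z0: "0 \<le> Z" unfolding Z_def using S_bounds by simp
  have s0: "0 \<le> s" unfolding s_def using L0 \<xi>0 B_nonneg Z0 by simp
  have u0: "0 \<le> u i" for i unfolding u_def using L0 \<xi>0 by simp
  have "blf_bound n (\<lambda>i j. r i j * (q i * q j * (h * v i * v j * G i j - G0 i j)))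
      (n * s + 2 * sqrt n * L2_set u {..<n})"
  proof (rule blf_bound_of_abs_le_sum[OF _ s0 u0])
    fix i j assume ij: "i < n" "j < n"
    have "\<bar>r i j\<bar> = 1" using r_sign ij unfolding sign_array_def by simp
    moreover have "\<bar>q i * q j\<bar> \<le> 1"
      unfolding abs_mult using q_bounds q_abs ij by (intro mult_le_one) (auto simp: less_imp_le)
    ultimately have "\<bar>r i j * (q i * q j * (h * v i * v j * G i j - G0 i j))\<bar>
      \<le> 1 * \<bar>h * v i * v j * G i j - G0 i j\<bar>"
      unfolding abs_mult[of "r i j"] abs_mult[of "q i * q j" "h * v i * v j * G i j - G0 i j"]
      by (simp only: mult_1) (rule mult_left_le_one_le, auto)
    also have "\<dots> \<le> s + u i + u j"
      using signal_part_entry_le[OF \<xi> half ij] unfolding s_def u_def Z_def L_def by simp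
    finally show "\<bar>r i j * (q i * q j * (h * v i * v j * G i j - G0 i j))\<bar> \<le> s + u i + u j" .
  qed
  moreover have "n * s + 2 * sqrt n * L2_set u {..<n} \<le>
    sqrt n * (L * \<xi> * B + (3 * L + 3) * \<xi> * (E0 * T) / qmin + T / (qmin\<^sup>2 * sqrt n)
      + 2 * (3 * L + 4) * \<xi> * (E0 * T))"
  proof -
    have "L2_set u {..<n} \<le> (3 * L + 4) * \<xi> * L2_set e {..<n}"
      by (rule L2_set_abs_le_mult) (use L0 \<xi>0 in \<open>auto simp: u_def abs_mult\<close>)
    also have "\<dots> \<le> (3 * L + 4) * \<xi> * (E0 * T)" using e_L2 L0 \<xi>0 by (intro mult_left_mono) auto
    finally have 1: "2 * sqrt n * L2_set u {..<n} \<le> 2 * sqrt n * ((3 * L + 4) * \<xi> * (E0 * T))"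
      by (intro mult_left_mono) auto
    have "(3 * L + 3) * \<xi> * (n * \<bar>\<eta>\<bar>) \<le> (3 * L + 3) * \<xi> * (sqrt n * (E0 * T) / qmin)"
      using \<eta>_L2 L0 \<xi>0 by (intro mult_left_mono) auto
    then have 2: "(3 * L + 3) * \<xi> * (n * \<bar>\<eta>\<bar>) \<le> sqrt n * ((3 * L + 3) * \<xi> * (E0 * T) / qmin)"
      by (simp add: mult_ac)
    have "\<bar>\<Sum>i<n. rs i\<bar> \<le> n * T" using scale unfolding noise_scale_def rs_def by auto
    then have "Z \<le> n * T / (n * qmin * (n * qmin))"
      unfolding Z_def using S_bounds n_pos qmin_pos by (intro frac_le mult_mono) auto
    then have "n * Z \<le> n * (n * T / (n * qmin * (n * qmin)))" using n_pos by (intro mult_left_mono) auto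
    also have "\<dots> = T / qmin\<^sup>2" using n_pos qmin_pos by (simp add: power2_eq_square field_simps)
    also have "\<dots> = sqrt n * (T / (qmin\<^sup>2 * sqrt n))" using sqrt_n by simp
    finally have 3: "n * Z \<le> sqrt n * (T / (qmin\<^sup>2 * sqrt n))" .
    have nB: "n * (B / sqrt n) = sqrt n * B"
    proof -
      have "n * (B / sqrt n) = sqrt n * (sqrt n * (B / sqrt n))" unfolding mult.assoc[symmetric] sqrt_n(3) ..
      also have "sqrt n * (B / sqrt n) = B" using sqrt_n(1) by simp
      finally show ?thesis .
    qed
    have "n * s = L * \<xi> * (n * (B / sqrt n)) + (3 * L + 3) * \<xi> * (n * \<bar>\<eta>\<bar>) + n * Z"
      unfolding s_def by (simp add: algebra_simps)
    then have "n * s \<le> sqrt n * (L * \<xi> * B) + sqrt n * ((3 * L + 3) * \<xi> * (E0 * T) / qmin)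
        + sqrt n * (T / (qmin\<^sup>2 * sqrt n))"
      unfolding nB using 2 3 by (simp add: mult_ac)
    then show ?thesis using 1 by (simp add: distrib_left mult_ac)
  qed
  ultimately show ?thesis by (rule blf_bound_mono)
qed

text \<open>One factor T comes from \<xi> = X0 \<tau> T, the other from the norm multiplied by
  \<xi>; terms with a single T are absorbed by T \<le> T^2. The total-noise term has no \<xi> and is
  covered by 1 / sqrt n \<le> \<tau>.\<close>

lemma blf_bound_good:
  assumes half: "X0 * \<tau> * T \<le> 1/2"
  shows "blf_bound n (\<lambda>i j. r i j * (norm_adj_entry \<alpha> n adj i j - signal_noise_entry \<alpha> n q m x i j))
    (C_good * \<tau> * T\<^sup>2)"
proof -
  define \<xi> where "\<xi> = X0 * \<tau> * T"
  define L where "L = 3 * powr_lip \<alpha> * V\<^sup>2"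
  have \<xi>: "\<bar>e i\<bar> \<le> \<xi>" if "i < n" for i unfolding \<xi>_def by (rule e_abs[OF that])
  have \<xi>0: "0 \<le> \<xi>" unfolding \<xi>_def using X0_nonneg \<tau>_bounds T_ge_1 by simp
  have h2: "\<xi> \<le> 1/2" using half unfolding \<xi>_def .
  have L0: "0 \<le> L" unfolding L_def using powr_lip_nonneg by simp
  let ?f = "\<lambda>i j. (h * v i * v j - 1) * (r i j * x i j) + r i j * (q i * q j * (h * v i * v j * G i j - G0 i j))"
  define N1 where "N1 = 6 * powr_lip \<alpha> * V\<^sup>2 * \<xi> * (sqrt n * T)"
  define N2 where "N2 = sqrt n * (L * \<xi> * B + (3 * L + 3) * \<xi> * (E0 * T) / qmin + T / (qmin\<^sup>2 * sqrt n)
      + 2 * (3 * L + 4) * \<xi> * (E0 * T))"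
  have "blf_bound n ?f (N1 + N2)"
    using blf_bound_add[OF noise_part_bound[OF \<xi> h2] signal_part_bound[OF \<xi> h2]]
    unfolding N1_def N2_def L_def .
  moreover have N0: "0 \<le> N1 + N2" unfolding N1_def N2_def
    using powr_lip_nonneg \<xi>0 T_ge_1 L0 B_nonneg E0_nonneg qmin_pos by (intro add_nonneg_nonneg mult_nonneg_nonneg) auto
  ultimately have "blf_bound n (\<lambda>i j. w i * w j * ?f i j) (W * W * (N1 + N2))"
    by (rule blf_bound_diag) (use w_bounds W_nonneg in auto)
  then have scaled: "blf_bound n (\<lambda>i j. 1 / sqrt n * (w i * w j * ?f i j)) (\<bar>1 / sqrt n\<bar> * (W * W * (N1 + N2)))"
    by (rule blf_bound_cmult)
  have entry: "r i j * (norm_adj_entry \<alpha> n adj i j - signal_noise_entry \<alpha> n q m x i j)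
      = 1 / sqrt n * (w i * w j * ?f i j)" if ij: "i < n" "j < n" for i j
  proof -
    have arrange: "R * (a * b * s * (f * f1 * f2 * (y * G + z)) - a * b * s * (y * G0 + z))
        = s * (a * b * ((f * f1 * f2 - 1) * (R * z) + R * (y * (f * f1 * f2 * G - G0))))"
      for R a b s f f1 f2 y G G0 z :: real
      by (simp add: algebra_simps)
    have pos: "-1 < e i" "-1 < e j" "-1 < \<eta>"
      using \<xi>[OF ij(1)] \<xi>[OF ij(2)] \<eta>_abs[OF \<xi>] h2 by auto
    show ?thesis
      unfolding norm_adj_entry_eq[OF ij pos] signal_noise_entry_eq[OF ij]
      by (rule arrange)
  qed
  have "blf_bound n (\<lambda>i j. r i j * (norm_adj_entry \<alpha> n adj i j - signal_noise_entry \<alpha> n q m x i j))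
    (\<bar>1 / sqrt n\<bar> * (W * W * (N1 + N2)))"
    by (rule iffD2[OF blf_bound_cong[OF entry] scaled])
  moreover have "\<bar>1 / sqrt n\<bar> * (W * W * (N1 + N2)) \<le> C_good * \<tau> * T\<^sup>2"
  proof -
    have TT: "T \<le> T\<^sup>2" using T_ge_1 by (simp add: power2_eq_square mult_le_cancel_left1)
    have \<xi>T: "\<xi> * T = X0 * (\<tau> * T\<^sup>2)" unfolding \<xi>_def by (simp add: power2_eq_square)
    have 1: "\<xi> \<le> X0 * (\<tau> * T\<^sup>2)"
      unfolding \<xi>_def using TT X0_nonneg \<tau>_bounds by (simp add: mult.assoc mult_left_mono)
    have LB: "L * B * \<xi> \<le> L * B * (X0 * (\<tau> * T\<^sup>2))"
      by (rule mult_left_mono[OF 1]) (use L0 B_nonneg in simp)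
    have "T * (1 / sqrt n) \<le> T\<^sup>2 * \<tau>"
      using TT \<tau>_bounds T_ge_1 by (intro mult_mono) auto
    then have 2: "1 / qmin\<^sup>2 * (T * (1 / sqrt n)) \<le> 1 / qmin\<^sup>2 * (T\<^sup>2 * \<tau>)"
      by (rule mult_left_mono) simp
    have arrange: "\<bar>1 / s\<bar> * (W * W * (c1 * \<xi> * (s * T) + s * (L * \<xi> * B + c2 * \<xi> * (E * T) / b + T / (b' * s)
        + c3 * \<xi> * (E * T))))
      = W\<^sup>2 * (c1 * (\<xi> * T) + L * B * \<xi> + c2 * E / b * (\<xi> * T) + 1 / b' * (T * (1 / s)) + c3 * E * (\<xi> * T))"
      if "0 < s" for s W c1 \<xi> T L B c2 E b b' c3 :: real
      using that by (simp add: distrib_left power2_eq_square mult_ac)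
    have "\<bar>1 / sqrt n\<bar> * (W * W * (N1 + N2)) = W\<^sup>2 * (6 * powr_lip \<alpha> * V\<^sup>2 * (\<xi> * T)
      + L * B * \<xi> + (3 * L + 3) * E0 / qmin * (\<xi> * T) + 1 / qmin\<^sup>2 * (T * (1 / sqrt n))
      + 2 * (3 * L + 4) * E0 * (\<xi> * T))"
      unfolding N1_def N2_def by (rule arrange[OF sqrt_n(1)])
    also have "\<dots> \<le> W\<^sup>2 * (6 * powr_lip \<alpha> * V\<^sup>2 * (X0 * (\<tau> * T\<^sup>2))
      + L * B * (X0 * (\<tau> * T\<^sup>2)) + (3 * L + 3) * E0 / qmin * (X0 * (\<tau> * T\<^sup>2)) + 1 / qmin\<^sup>2 * (T\<^sup>2 * \<tau>)
      + 2 * (3 * L + 4) * E0 * (X0 * (\<tau> * T\<^sup>2)))"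
      unfolding \<xi>T
      by (rule mult_left_mono[OF add_mono[OF add_mono[OF add_mono[OF add_mono[OF order_refl LB] order_refl] 2] order_refl]]) simp
    also have "\<dots> = C_good * \<tau> * T\<^sup>2"
      unfolding C_good_def L_def by (simp add: algebra_simps)
    finally show ?thesis .
  qed
  ultimately show ?thesis by (rule blf_bound_mono)
qed

end

section \<open>Polynomial bounds valid for every sample\<close>

context blockmodel_sample
begin

text \<open>An integer exponent, so that the crude bound is a natural power of n that can be matched
  with a power of \<tau>^4.\<close>

definition "N = nat \<lceil>\<bar>\<alpha>\<bar>\<rceil>"
text \<open>In \<open>G0\<close> the entry m, the constant \<kappa> and the two fluctuations
  contribute 4 B, and the row sums in the latter 2 (2 + B) / qmin^2; the final 2 + B bounds the
  noise entry.\<close>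

definition "C_signal = W\<^sup>2 * (4 * B + 2 * (2 + B) / qmin\<^sup>2 + 2 + B)"

lemma adj_bounds: "i < n \<Longrightarrow> j < n \<Longrightarrow> 0 \<le> adj i j" "i < n \<Longrightarrow> j < n \<Longrightarrow> adj i j \<le> 1"
  unfolding adj_def using adj_01[of i j] by auto

lemma inv_sqrt_le: "0 \<le> y \<Longrightarrow> y / sqrt n \<le> y"
  using sqrt_n by (simp add: pos_divide_le_eq mult_le_cancel_left1)

lemma mean_entry_abs_le: "i < n \<Longrightarrow> j < n \<Longrightarrow> \<bar>mean_entry n q m i j\<bar> \<le> 1 + B"
proof -
  assume ij: "i < n" "j < n"
  have "\<bar>m i j / sqrt n\<bar> \<le> B"
    using m_bound[OF ij] inv_sqrt_le[of "\<bar>m i j\<bar>"] by (simp add: abs_divide)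
  then have "\<bar>1 + m i j / sqrt n\<bar> \<le> 1 + B" by linarith
  moreover have "\<bar>q i * q j\<bar> \<le> 1"
    unfolding abs_mult using q_bounds q_abs ij by (intro mult_le_one) (auto simp: less_imp_le)
  ultimately have "\<bar>q i * q j\<bar> * \<bar>1 + m i j / sqrt n\<bar> \<le> 1 * (1 + B)"
    by (intro mult_mono) auto
  then show ?thesis unfolding mean_entry_def abs_mult[of "q i * q j"] by simp
qed

lemma x_abs_le: "i < n \<Longrightarrow> j < n \<Longrightarrow> \<bar>x i j\<bar> \<le> 2 + B"
  using adj_bounds[of i j] mean_entry_abs_le[of i j] unfolding adj_def by linarith

lemma e_abs_crude: "i < n \<Longrightarrow> \<bar>e i\<bar> \<le> B + (2 + B) / qmin\<^sup>2"
proof -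
  assume i: "i < n"
  have "\<bar>rs i\<bar> \<le> (\<Sum>j<n. \<bar>x i j\<bar>)" unfolding rs_def by (rule sum_abs)
  also have "\<dots> \<le> (\<Sum>j<n. 2 + B)" by (rule sum_mono) (use x_abs_le i in auto)
  finally have rsi: "\<bar>rs i\<bar> \<le> n * (2 + B)" by simp
  have "\<bar>rs i / (q i * S)\<bar> \<le> \<bar>rs i\<bar> / (n * qmin\<^sup>2)" by (rule rs_ratio_le[OF i])
  also have "\<dots> \<le> n * (2 + B) / (n * qmin\<^sup>2)" by (rule divide_right_mono[OF rsi]) simp
  also have "\<dots> = (2 + B) / qmin\<^sup>2" using n_pos by simp
  finally have "\<bar>rs i / (q i * S)\<bar> \<le> (2 + B) / qmin\<^sup>2" .
  moreover have "\<bar>\<mu> i / sqrt n\<bar> \<le> B"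
    using \<mu>_bound[OF i] inv_sqrt_le[of "\<bar>\<mu> i\<bar>"] by (simp add: abs_divide)
  ultimately show ?thesis unfolding e_def by linarith
qed

lemma signal_noise_entry_abs_le:
  assumes ij: "i < n" "j < n"
  shows "\<bar>signal_noise_entry \<alpha> n q m x i j\<bar> \<le> C_signal"
proof -
  let ?c = "4 * B + 2 * (2 + B) / qmin\<^sup>2"
  have "\<bar>m i j / sqrt n\<bar> \<le> B" "\<bar>\<kappa> / sqrt n\<bar> \<le> B"
    using m_bound[OF ij] inv_sqrt_le[of "\<bar>m i j\<bar>"] \<kappa>_bound inv_sqrt_le[of "\<bar>\<kappa>\<bar>"] by (simp_all add: abs_divide)
  then have "\<bar>G0 i j\<bar> \<le> ?c"
    using e_abs_crude[OF ij(1)] e_abs_crude[OF ij(2)] unfolding G0_def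
      times_divide_eq_right[symmetric] by linarith
  moreover have "\<bar>q i * q j\<bar> \<le> 1"
    unfolding abs_mult using q_bounds q_abs ij by (intro mult_le_one) (auto simp: less_imp_le)
  ultimately have "\<bar>q i * q j\<bar> * \<bar>G0 i j\<bar> \<le> 1 * ?c" by (intro mult_mono) auto
  then have "\<bar>q i * q j * G0 i j\<bar> \<le> ?c" unfolding abs_mult[of "q i * q j"] by simp
  then have a: "\<bar>q i * q j * G0 i j + x i j\<bar> \<le> ?c + 2 + B" using x_abs_le[OF ij] by linarith
  have b: "\<bar>w i * w j * (1 / sqrt n)\<bar> \<le> W * W * 1"
    unfolding abs_mult using w_bounds ij W_nonneg sqrt_n by (intro mult_mono) auto
  have "\<bar>signal_noise_entry \<alpha> n q m x i j\<bar> = \<bar>w i * w j * (1 / sqrt n)\<bar> * \<bar>q i * q j * G0 i j + x i j\<bar>"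
    unfolding signal_noise_entry_eq[OF ij] abs_mult[of "w i * w j * (1 / sqrt n)"] ..
  also have "\<dots> \<le> W * W * 1 * (?c + 2 + B)" by (rule mult_mono[OF b a]) (use W_nonneg in auto)
  finally show ?thesis unfolding C_signal_def by (simp add: power2_eq_square)
qed

lemma n_powr_le: "real n powr \<bar>\<alpha>\<bar> \<le> real n ^ N"
proof -
  have "real n powr \<bar>\<alpha>\<bar> \<le> real n powr real N" unfolding N_def using n_pos by (intro powr_mono) linarith+
  then show ?thesis using n_pos by (simp add: powr_realpow)
qed

text \<open>Degrees are integers. A degree 0 contributes 0 by the convention for powers, even at
  negative exponents, and any other degree is at least 1, so no small base can blow up.\<close>

lemma degree_powr_le:
  assumes "d = 0 \<or> 1 \<le> d" "d \<le> real n" shows "d powr (- \<alpha>) \<le> real n ^ N"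
proof (cases "d = 0")
  case True
  then show ?thesis using n_pos by simp
next
  case False
  then have d: "1 \<le> d" using assms by simp
  have "d powr (- \<alpha>) \<le> d powr \<bar>\<alpha>\<bar>" using d by (intro powr_mono) auto
  also have "\<dots> \<le> real n powr \<bar>\<alpha>\<bar>" using d assms by (intro powr_mono2) auto
  finally show ?thesis using n_powr_le by simp
qed

lemma total_degree_powr_le:
  assumes "d = 0 \<or> 1 \<le> d" "d \<le> real n ^ 2" shows "d powr \<alpha> \<le> real n ^ (2 * N)"
proof (cases "d = 0")
  case True
  then show ?thesis using n_pos by simp
next
  case False
  then have d: "1 \<le> d" using assms by simp
  have "d powr \<alpha> \<le> d powr \<bar>\<alpha>\<bar>" using d by (intro powr_mono) auto
  also have "\<dots> \<le> (real n ^ 2) powr \<bar>\<alpha>\<bar>" using d assms by (intro powr_mono2) auto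
  also have "\<dots> = (real n powr \<bar>\<alpha>\<bar>) ^ 2" using n_pos by (simp add: power2_eq_square powr_mult)
  also have "\<dots> \<le> (real n ^ N) ^ 2" using n_powr_le by (intro power_mono) auto
  finally show ?thesis by (simp add: power_mult[symmetric] mult.commute)
qed

lemma zero_or_ge_1_sum:
  fixes f :: "nat \<Rightarrow> real"
  assumes "\<And>i. i < k \<Longrightarrow> f i = 0 \<or> 1 \<le> f i"
  shows "(\<Sum>i<k. f i) = 0 \<or> 1 \<le> (\<Sum>i<k. f i)"
proof (cases "\<exists>i<k. 1 \<le> f i")
  case True
  then obtain i where i: "i < k" "1 \<le> f i" by blast
  have "f i \<le> (\<Sum>i<k. f i)" by (rule member_le_sum) (use assms i in force)+
  then show ?thesis using i by linarith
next
  case False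
  then show ?thesis using assms by (intro disjI1 sum.neutral) auto
qed

lemma norm_adj_entry_abs_le:
  assumes ij: "i < n" "j < n"
  shows "\<bar>norm_adj_entry \<alpha> n adj i j\<bar> \<le> 2 * real n ^ (4 * N + 2)"
proof -
  define d where "d i = (\<Sum>j<n. adj i j)" for i
  define D where "D = (\<Sum>i<n. d i)"
  have adj: "adj i j = 0 \<or> 1 \<le> adj i j" if "i < n" "j < n" for i j
    using adj_01[OF that] unfolding adj_def by auto
  have d: "d i = 0 \<or> 1 \<le> d i" if "i < n" for i
    unfolding d_def by (rule zero_or_ge_1_sum) (use adj that in auto)
  have d_le: "d i \<le> n" "0 \<le> d i" if "i < n" for i
    using sum_mono[of "{..<n}" "adj i" "\<lambda>_. 1"] adj_bounds that d[OF that] unfolding d_def by auto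
  have D: "D = 0 \<or> 1 \<le> D" unfolding D_def by (rule zero_or_ge_1_sum) (use d in auto)
  have D_le: "D \<le> real n ^ 2"
    using sum_mono[of "{..<n}" d "\<lambda>_. n"] d_le unfolding D_def by (auto simp: power2_eq_square)
  have "\<bar>d i * d j / D\<bar> \<le> real n * real n"
  \<comment> \<open>For the empty graph the quotient by D is 0 by the convention for
    division.\<close>
  proof (cases "D = 0")
    case False
    then have D1: "1 \<le> D" using D by simp
    have "\<bar>d i * d j / D\<bar> = d i * d j / D" using d_le ij D1 by simp
    also have "\<dots> \<le> d i * d j / 1" using d_le ij D1 by (intro divide_left_mono) auto
    also have "\<dots> \<le> real n * real n" using d_le ij by (auto intro: mult_mono)
    finally show ?thesis .
  qed simp
  moreover have "1 \<le> real n * real n" using n_pos by (intro mult_ge1_I) auto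
  ultimately have mid: "\<bar>adj i j - d i * d j / D\<bar> \<le> 2 * real n ^ 2"
    using adj_bounds[OF ij] unfolding power2_eq_square by linarith
  have pre: "\<bar>D powr \<alpha> / sqrt n\<bar> \<le> real n ^ (2 * N)"
    using total_degree_powr_le[OF D D_le] inv_sqrt_le[of "D powr \<alpha>"] by (simp add: abs_divide)
  have "\<bar>norm_adj_entry \<alpha> n adj i j\<bar> = \<bar>D powr \<alpha> / sqrt n\<bar> * (d i powr (-\<alpha>) * \<bar>adj i j - d i * d j / D\<bar> * d j powr (-\<alpha>))"
    unfolding norm_adj_entry_def Let_def d_def[symmetric] D_def[symmetric] abs_mult by simp
  also have "\<dots> \<le> real n ^ (2 * N) * (real n ^ N * (2 * real n ^ 2) * real n ^ N)"
    using pre mid degree_powr_le d d_le ij by (intro mult_mono) auto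
  also have "\<dots> = 2 * real n ^ (2 * N + N + 2 + N)" by (simp only: power_add mult_ac)
  finally show ?thesis by (simp add: algebra_simps)
qed

lemma C_signal_nonneg: "0 \<le> C_signal"
  using signal_noise_entry_abs_le[of 0 0] n_ge_3 by force

lemma blf_bound_crude:
  "blf_bound n (\<lambda>i j. r i j * (norm_adj_entry \<alpha> n adj i j - signal_noise_entry \<alpha> n q m x i j))
    ((2 + C_signal) * real n ^ (4 * N + 3))"
proof -
  let ?c = "(2 + C_signal) * real n ^ (4 * N + 2)"
  have "blf_bound n (\<lambda>i j. r i j * (norm_adj_entry \<alpha> n adj i j - signal_noise_entry \<alpha> n q m x i j)) (n * ?c)"
  proof (rule blf_bound_of_abs_le)
    fix i j assume ij: "i < n" "j < n"
    have "\<bar>r i j\<bar> = 1" using r_sign ij unfolding sign_array_def by simp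
    then have "\<bar>r i j * (norm_adj_entry \<alpha> n adj i j - signal_noise_entry \<alpha> n q m x i j)\<bar>
      = \<bar>norm_adj_entry \<alpha> n adj i j - signal_noise_entry \<alpha> n q m x i j\<bar>" by (simp add: abs_mult)
    also have "\<dots> \<le> 2 * real n ^ (4 * N + 2) + C_signal"
      using norm_adj_entry_abs_le[OF ij] signal_noise_entry_abs_le[OF ij] by linarith
    also have "\<dots> \<le> ?c"
    proof -
      have "C_signal * 1 \<le> C_signal * real n ^ (4 * N + 2)"
        using C_signal_nonneg n_pos by (intro mult_left_mono one_le_power)
      then show ?thesis by (simp add: distrib_right)
    qed
    finally show "\<bar>r i j * (norm_adj_entry \<alpha> n adj i j - signal_noise_entry \<alpha> n q m x i j)\<bar> \<le> ?c" .
  qed (use C_signal_nonneg in simp)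
  moreover have "n * ?c = (2 + C_signal) * real n ^ Suc (4 * N + 2)" by simp
  ultimately show ?thesis by (simp only: eval_nat_numeral add_Suc_right)
qed

text \<open>The exponent of n in \<open>blf_bound_crude\<close>. Of the 4 K + 1 powers of \<tau>
  gained later, 4 K cancel n^K and the last one is the claimed rate.\<close>

definition "K = 4 * N + 3"
definition "C_bound = C_good + (2 + C_signal) * 4 ^ K * (2 * X0) ^ (4 * K + 1)"

lemma C_good_nonneg: "0 \<le> C_good"
  unfolding C_good_def using powr_lip_nonneg X0_nonneg E0_nonneg B_nonneg qmin_pos
  by (intro mult_nonneg_nonneg add_nonneg_nonneg divide_nonneg_nonneg) auto

text \<open>When the degrees do not concentrate, the crude polynomial bound is compensated by
  \<open>1 \<le> (2 * X0 * \<tau> * T) ^ (4 * K + 1)\<close>, because \<open>\<tau> ^ 4 \<le> 4 / n\<close>.\<close>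

lemma blf_bound_all:
  "blf_bound n (\<lambda>i j. r i j * (norm_adj_entry \<alpha> n adj i j - signal_noise_entry \<alpha> n q m x i j))
    (C_bound * \<tau> * T ^ (4 * K + 1))"
proof (cases "X0 * \<tau> * T \<le> 1/2")
  case True
  have "T\<^sup>2 \<le> T ^ (4 * K + 1)" unfolding K_def using T_ge_1 by (intro power_increasing) auto
  moreover have "C_good \<le> C_bound" unfolding C_bound_def using C_signal_nonneg X0_nonneg by simp
  ultimately have "C_good * \<tau> * T\<^sup>2 \<le> C_bound * \<tau> * T ^ (4 * K + 1)"
    using \<tau>_bounds C_good_nonneg by (intro mult_mono mult_right_mono) auto
  then show ?thesis using blf_bound_good[OF True] by (rule blf_bound_mono[rotated])
next
  case False
  have "1 \<le> 2 * (X0 * \<tau> * T)" using False by simp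
  then have 1: "1 \<le> (2 * (X0 * \<tau> * T)) ^ (4 * K + 1)" by (rule one_le_power)
  have "\<tau> ^ (4 * K) \<le> (4 / n) ^ K"
    unfolding power_mult using \<tau>_bounds by (intro power_mono) auto
  then have "real n ^ K * \<tau> ^ (4 * K) \<le> real n ^ K * (4 / n) ^ K" by (intro mult_left_mono) auto
  also have "\<dots> = 4 ^ K" using n_pos by (simp flip: power_mult_distrib)
  finally have 2: "real n ^ K * \<tau> ^ (4 * K) \<le> 4 ^ K" .
  have "(2 + C_signal) * real n ^ K * 1 \<le> (2 + C_signal) * real n ^ K * (2 * (X0 * \<tau> * T)) ^ (4 * K + 1)"
    using 1 C_signal_nonneg by (intro mult_left_mono) auto
  also have "(2 * (X0 * \<tau> * T)) ^ (4 * K + 1) = (2 * X0) ^ (4 * K + 1) * T ^ (4 * K + 1) * \<tau> * \<tau> ^ (4 * K)"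
    by (simp add: power_mult_distrib)
  also have "(2 + C_signal) * real n ^ K * \<dots>
    = (real n ^ K * \<tau> ^ (4 * K)) * ((2 + C_signal) * (2 * X0) ^ (4 * K + 1) * T ^ (4 * K + 1) * \<tau>)"
    by (simp only: mult_ac)
  also have "\<dots> \<le> 4 ^ K * ((2 + C_signal) * (2 * X0) ^ (4 * K + 1) * T ^ (4 * K + 1) * \<tau>)"
    by (rule mult_right_mono[OF 2])
      (use C_signal_nonneg X0_nonneg T_ge_1 \<tau>_bounds in \<open>auto intro!: mult_nonneg_nonneg\<close>)
  also have "\<dots> = (2 + C_signal) * 4 ^ K * (2 * X0) ^ (4 * K + 1) * (\<tau> * T ^ (4 * K + 1))"
    by (simp only: mult_ac)
  also have "\<dots> \<le> C_bound * (\<tau> * T ^ (4 * K + 1))"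
    unfolding C_bound_def using C_good_nonneg \<tau>_bounds T_ge_1 by (intro mult_right_mono) auto
  finally have "(2 + C_signal) * real n ^ (4 * N + 3) \<le> C_bound * \<tau> * T ^ (4 * K + 1)"
    unfolding K_def by (simp add: mult_ac)
  with blf_bound_crude show ?thesis by (rule blf_bound_mono)
qed

end

section \<open>The moment bound\<close>

lemma sign_matrices_index:
  assumes R: "R \<in> sign_matrices n"
  shows "R \<in> carrier_mat n n" and "sign_array n (\<lambda>i j. R $$ (i,j))"
proof -
  show car: "R \<in> carrier_mat n n" using R unfolding sign_matrices_def by blast
  have "R $$ (i,j) \<in> {-1, 1}" if "i < n" "j < n" for i j
  proof -
    have "elements_mat R \<subseteq> {-1, 1}" using R unfolding sign_matrices_def by simp
    then show ?thesis using elements_matI[OF car that refl] by (rule subsetD)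
  qed
  moreover have "R $$ (i,j) = R $$ (j,i)" if "i < n" "j < n" for i j
  proof -
    have "R\<^sup>T = R" using R unfolding sign_matrices_def by simp
    then show ?thesis using car that by (metis index_transpose_mat(1) carrier_matD)
  qed
  moreover have "\<bar>y\<bar> = 1" if "y \<in> {-1, 1}" for y :: real using that by auto
  ultimately show "sign_array n (\<lambda>i j. R $$ (i,j))" unfolding sign_array_def by blast
qed

lemma minus_mat_index: "E \<in> carrier_mat n k \<Longrightarrow> i < n \<Longrightarrow> j < k \<Longrightarrow> (B - E) $$ (i,j) = B $$ (i,j) - E $$ (i,j)"
  by auto

lemma hadamard_index: "i < dim_row B \<Longrightarrow> j < dim_col B \<Longrightarrow> (B \<circ>\<^sub>H E) $$ (i,j) = B $$ (i,j) * E $$ (i,j)"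
  unfolding hadamard_def by simp

lemma hadamard_carrier: "B \<in> carrier_mat n k \<Longrightarrow> B \<circ>\<^sub>H E \<in> carrier_mat n k"
  unfolding hadamard_def by auto

lemma Lp_norm_nonneg: "0 \<le> Lp_norm P p Y"
  unfolding Lp_norm_def by simp

lemma noise_moment_nonneg: "0 \<le> noise_moment m"
  unfolding noise_moment_def by simp

text \<open>The integrand of an \<open>L\<^sub>p\<close> norm need not be measurable here: a pointwise majorant
  suffices because the integral of a non-integrable function is \<open>0\<close>.\<close>

lemma (in prob_space) Lp_norm_le_of_dominated:
  assumes p: "0 < p" and c: "0 \<le> c" and mom: "0 \<le> b"
    and G: "integrable M G" "expectation G \<le> b"
    and Y: "\<And>\<omega>. \<omega> \<in> space M \<Longrightarrow> \<bar>Y \<omega>\<bar> ^ p \<le> c ^ p * G \<omega>"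
  shows "Lp_norm M p Y \<le> c * b powr (1 / p)"
proof -
  have "(\<integral>\<omega>. \<bar>Y \<omega>\<bar> ^ p \<partial>M) \<le> (\<integral>\<omega>. c ^ p * G \<omega> \<partial>M)"
  proof (rule integral_mono')
    show "0 \<le> c ^ p * G \<omega>" if "\<omega> \<in> space M" for \<omega>
      by (rule order_trans[OF _ Y[OF that]]) simp
  qed (use G Y in auto)
  also have "\<dots> = c ^ p * expectation G" using G by simp
  also have "\<dots> \<le> c ^ p * b" using G c by (intro mult_left_mono) auto
  finally have "Lp_norm M p Y \<le> (c ^ p * b) powr (1 / p)"
    unfolding Lp_norm_def by (intro powr_mono2) auto
  also have "\<dots> = (c ^ p) powr (1 / p) * b powr (1 / p)" using c mom by (simp add: powr_mult)
  also have "(c ^ p) powr (1 / p) = c"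
    using c p by (cases "c = 0") (auto simp: powr_powr zero_power simp flip: powr_realpow)
  finally show ?thesis .
qed

text \<open>The matrix Y is prescribed by its entries, so one statement covers the plain difference
  (r = 1) and every signed one, with a constant that involves neither n, K nor r. The moment of
  order k p appears because the pointwise bound contains T^k.\<close>

lemma (in dcsbm) Lp_norm_op_norm_diff_le:
  fixes \<alpha> Mmax qmin qmax :: real and p :: nat
  assumes p: "0 < p" and Mmax: "0 < Mmax" and qmin: "0 < qmin" and n: "3 \<le> n"
    and wd: "weakly_distinguishable Mmax n g M" and mdh: "mild_degree_heterogeneity qmin qmax n q"
    and r: "sign_array n r"
    and Y: "\<And>\<omega>. \<omega> \<in> space P \<Longrightarrow> Y \<omega> \<in> carrier_mat n n"
    and Y_index: "\<And>\<omega> i j. \<omega> \<in> space P \<Longrightarrow> i < n \<Longrightarrow> j < n \<Longrightarrow>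
      Y \<omega> $$ (i,j) = r i j * (norm_adj \<alpha> n (A \<omega>) $$ (i,j) - signal_plus_noise \<alpha> P n K g q M A \<omega> $$ (i,j))"
  shows "Lp_norm P p (\<lambda>\<omega>. op_norm (Y \<omega>)) \<le>
    (blockmodel_sample.C_bound \<alpha> Mmax qmin * noise_moment ((4 * blockmodel_sample.K \<alpha> + 1) * p) powr (1 / p))
      * (ln n / n) powr (1/2)"
proof -
  define k where "k = 4 * blockmodel_sample.K \<alpha> + 1"
  define C where "C = blockmodel_sample.C_bound \<alpha> Mmax qmin"
  interpret symmetric_noise P n noise "\<lambda>i j. - mean_entry n q_fun m_fun i j"
    by (rule symmetric_noise_noise)
  obtain T where T: "\<And>\<omega>. \<omega> \<in> space P \<Longrightarrow> noise_scale n r (\<lambda>i j. noise i j \<omega>) (T \<omega>)"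
    and T_mom: "\<And>m. \<exists>G. integrable P G \<and> expectation G \<le> noise_moment m \<and> (\<forall>\<omega>\<in>space P. T \<omega> ^ m \<le> G \<omega>)"
    using noise_scale_exists[OF r n] by blast
  obtain G where G: "integrable P G" "expectation G \<le> noise_moment (k * p)"
    and TG: "\<And>\<omega>. \<omega> \<in> space P \<Longrightarrow> T \<omega> ^ (k * p) \<le> G \<omega>"
    using T_mom[of "k * p"] by blast
  have \<tau>0: "0 \<le> sqrt (ln n / n)" using n by simp
  have bound: "0 \<le> C \<and> 0 \<le> op_norm (Y \<omega>) \<and> op_norm (Y \<omega>) \<le> C * sqrt (ln n / n) * T \<omega> ^ k"
    if \<omega>: "\<omega> \<in> space P" for \<omega>
  proof -
    interpret S: blockmodel_sample n \<alpha> Mmax qmin "T \<omega>" q_fun m_fun "\<lambda>i j. noise i j \<omega>" r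
    proof
      show "qmin \<le> q $ i \<and> q $ i < 1" if "i < n" for i
        using mdh q_range[OF that] that unfolding mild_degree_heterogeneity_def by auto
      show "\<bar>M $$ (g i, g j)\<bar> \<le> Mmax" if "i < n" "j < n" for i j
        using wd that unfolding weakly_distinguishable_def by auto
      show "mean_entry n q_fun m_fun i j + noise i j \<omega> \<in> {0, 1}" if "i < n" "j < n" for i j
        using A_index_01[OF \<omega> that] unfolding noise_def by simp
    qed (use n Mmax qmin r T[OF \<omega>] in auto)
    have adj: "S.adj = (\<lambda>i j. A \<omega> $$ (i,j))"
      by (intro ext, unfold S.adj_def) (simp add: noise_def)
    have C0: "0 \<le> C"
      unfolding C_def S.C_bound_def using S.C_good_nonneg S.C_signal_nonneg S.X0_nonneg by simp
    have "blf_bound n (\<lambda>i j. r i j * (norm_adj_entry \<alpha> n S.adj i j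
        - signal_noise_entry \<alpha> n q_fun m_fun (\<lambda>i j. noise i j \<omega>) i j)) (C * sqrt (ln n / n) * T \<omega> ^ k)"
      using S.blf_bound_all unfolding C_def k_def S.\<tau>_def .
    moreover have "Y \<omega> $$ (i,j) = r i j * (norm_adj_entry \<alpha> n S.adj i j
        - signal_noise_entry \<alpha> n q_fun m_fun (\<lambda>i j. noise i j \<omega>) i j)" if "i < n" "j < n" for i j
      unfolding Y_index[OF \<omega> that] adj
      using norm_adj_index[OF A_carrier[OF \<omega>] that] signal_plus_noise_index(1)[OF \<omega> that] by simp
    ultimately have "blf_bound n (\<lambda>i j. Y \<omega> $$ (i,j)) (C * sqrt (ln n / n) * T \<omega> ^ k)"
      using blf_bound_cong[of n "\<lambda>i j. Y \<omega> $$ (i,j)"] by simp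
    from op_norm_le_of_blf_bound[OF Y[OF \<omega>] this] show ?thesis
      using C0 \<tau>0 S.T_ge_1 by auto
  qed
  \<comment> \<open>The sign of C is read off at one outcome; a probability space has a
    point.\<close>
  have C0: "0 \<le> C" using bound not_empty by auto
  have "Lp_norm P p (\<lambda>\<omega>. op_norm (Y \<omega>)) \<le> C * sqrt (ln n / n) * noise_moment (k * p) powr (1 / p)"
  proof (rule Lp_norm_le_of_dominated[OF p _ noise_moment_nonneg G])
    fix \<omega> assume \<omega>: "\<omega> \<in> space P"
    have "\<bar>op_norm (Y \<omega>)\<bar> ^ p \<le> (C * sqrt (ln n / n) * T \<omega> ^ k) ^ p"
      using bound[OF \<omega>] by (intro power_mono) auto
    also have "\<dots> = (C * sqrt (ln n / n)) ^ p * T \<omega> ^ (k * p)"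
      by (simp add: power_mult_distrib power_mult)
    also have "\<dots> \<le> (C * sqrt (ln n / n)) ^ p * G \<omega>"
      using TG[OF \<omega>] C0 \<tau>0 by (intro mult_left_mono) auto
    finally show "\<bar>op_norm (Y \<omega>)\<bar> ^ p \<le> (C * sqrt (ln n / n)) ^ p * G \<omega>" .
  qed (use C0 \<tau>0 in auto)
  moreover have "(ln n / n) powr (1/2) = sqrt (ln n / n)" using n by (intro powr_half_sqrt) simp
  ultimately show ?thesis unfolding C_def k_def by (simp add: mult_ac)
qed

theorem theorem6p2:
  fixes \<alpha> Mmax qmin qmax :: real and p :: nat
  assumes "0 < p" and "0 < Mmax" and "0 < qmin" and "qmin \<le> qmax" and "qmax < 1"
  shows
    "(\<exists>c>0. \<exists>N>0. \<forall>(P :: nat \<Rightarrow> 'a measure) K g q C M A.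
        dcsbm_sequence Mmax qmin qmax P K g q C M A \<longrightarrow>
        (\<forall>n\<ge>N.
          \<bar>Lp_norm (P n) p (\<lambda>\<omega>. op_norm
              (norm_adj \<alpha> n (A n \<omega>)
               - signal_plus_noise \<alpha> (P n) n (K n) (g n) (q n) (M n) (A n) \<omega>))\<bar>
          \<le> c * (ln (real n) / real n) powr (1/2))) \<and>
     (\<exists>c>0. \<exists>N>0. \<forall>(P :: nat \<Rightarrow> 'a measure) K g q C M A.
        dcsbm_sequence Mmax qmin qmax P K g q C M A \<longrightarrow>
        (\<forall>n\<ge>N.
          \<bar>SUP R \<in> sign_matrices n. Lp_norm (P n) p (\<lambda>\<omega>. op_norm
              (R \<circ>\<^sub>H norm_adj \<alpha> n (A n \<omega>)
               - R \<circ>\<^sub>H signal_plus_noise \<alpha> (P n) n (K n) (g n) (q n) (M n) (A n) \<omega>))\<bar>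
          \<le> c * (ln (real n) / real n) powr (1/2)))"
proof -
  \<comment> \<open>Fixed before any model sequence is chosen, hence uniform over all of them; the
    absolute value and the added 1 make it positive.\<close>
  define c where "c = \<bar>blockmodel_sample.C_bound \<alpha> Mmax qmin *
    noise_moment ((4 * blockmodel_sample.K \<alpha> + 1) * p) powr (1 / p)\<bar> + 1"
  have c: "0 < c" unfolding c_def by linarith
  have main: "Lp_norm (P n) p (\<lambda>\<omega>. op_norm (Y \<omega>)) \<le> c * (ln (real n) / real n) powr (1/2)"
    if seq: "dcsbm_sequence Mmax qmin qmax P K g q C M A" and n: "3 \<le> n" and r: "sign_array n r"
      and Y: "\<And>\<omega>. \<omega> \<in> space (P n) \<Longrightarrow> Y \<omega> \<in> carrier_mat n n"
      and Y_index: "\<And>\<omega> i j. \<omega> \<in> space (P n) \<Longrightarrow> i < n \<Longrightarrow> j < n \<Longrightarrow> Y \<omega> $$ (i,j)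
        = r i j * (norm_adj \<alpha> n (A n \<omega>) $$ (i,j)
          - signal_plus_noise \<alpha> (P n) n (K n) (g n) (q n) (M n) (A n) \<omega> $$ (i,j))"
    for P :: "nat \<Rightarrow> 'a measure" and K g q C M A n Y r
  proof -
    interpret dcsbm "P n" n "K n" "g n" "q n" "C n" "M n" "A n"
      using seq n unfolding dcsbm_sequence_def by auto
    have "weakly_distinguishable Mmax n (g n) (M n)" "mild_degree_heterogeneity qmin qmax n (q n)"
      using seq n unfolding dcsbm_sequence_def by auto
    from Lp_norm_op_norm_diff_le[OF assms(1-3) n this r Y Y_index]
    show ?thesis
      by (rule order_trans) (auto simp: c_def intro!: mult_right_mono)
  qed
  have index: "norm_adj \<alpha> n (A n \<omega>) \<in> carrier_mat n n"
      "signal_plus_noise \<alpha> (P n) n (K n) (g n) (q n) (M n) (A n) \<omega> \<in> carrier_mat n n"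
    if seq: "dcsbm_sequence Mmax qmin qmax P K g q C M A" and n: "3 \<le> n" and \<omega>: "\<omega> \<in> space (P n)"
    for P :: "nat \<Rightarrow> 'a measure" and K g q C M A n \<omega>
  proof -
    interpret dcsbm "P n" n "K n" "g n" "q n" "C n" "M n" "A n"
      using seq n unfolding dcsbm_sequence_def by auto
    have "0 < n" using n by simp
    show "norm_adj \<alpha> n (A n \<omega>) \<in> carrier_mat n n" by (rule norm_adj_carrier[OF A_carrier[OF \<omega>]])
    show "signal_plus_noise \<alpha> (P n) n (K n) (g n) (q n) (M n) (A n) \<omega> \<in> carrier_mat n n"
      by (rule signal_plus_noise_index(2)[OF \<omega> \<open>0 < n\<close> \<open>0 < n\<close>])
  qed
  have first: "\<bar>Lp_norm (P n) p (\<lambda>\<omega>. op_norm (norm_adj \<alpha> n (A n \<omega>)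
      - signal_plus_noise \<alpha> (P n) n (K n) (g n) (q n) (M n) (A n) \<omega>))\<bar>
    \<le> c * (ln (real n) / real n) powr (1/2)"
    if seq: "dcsbm_sequence Mmax qmin qmax P K g q C M A" and n: "3 \<le> n"
    for P :: "nat \<Rightarrow> 'a measure" and K g q C M A n
    unfolding abs_of_nonneg[OF Lp_norm_nonneg]
    by (rule main[OF seq n, where r = "\<lambda>_ _. 1"])
      (auto simp: sign_array_def minus_mat_index[OF index(2)[OF seq n]] intro!: minus_carrier_mat index(2)[OF seq n])
  have second: "\<bar>SUP R \<in> sign_matrices n. Lp_norm (P n) p (\<lambda>\<omega>. op_norm (R \<circ>\<^sub>H norm_adj \<alpha> n (A n \<omega>)
      - R \<circ>\<^sub>H signal_plus_noise \<alpha> (P n) n (K n) (g n) (q n) (M n) (A n) \<omega>))\<bar>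
    \<le> c * (ln (real n) / real n) powr (1/2)"
    if seq: "dcsbm_sequence Mmax qmin qmax P K g q C M A" and n: "3 \<le> n"
    for P :: "nat \<Rightarrow> 'a measure" and K g q C M A n
  proof -
    let ?f = "\<lambda>R. Lp_norm (P n) p (\<lambda>\<omega>. op_norm (R \<circ>\<^sub>H norm_adj \<alpha> n (A n \<omega>)
      - R \<circ>\<^sub>H signal_plus_noise \<alpha> (P n) n (K n) (g n) (q n) (M n) (A n) \<omega>))"
    have le: "?f R \<le> c * (ln (real n) / real n) powr (1/2)" if R: "R \<in> sign_matrices n" for R
    proof (rule main[OF seq n sign_matrices_index(2)[OF R]])
      fix \<omega> i j assume \<omega>: "\<omega> \<in> space (P n)"
      note car = sign_matrices_index(1)[OF R] index[OF seq n \<omega>]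
      show "R \<circ>\<^sub>H norm_adj \<alpha> n (A n \<omega>)
        - R \<circ>\<^sub>H signal_plus_noise \<alpha> (P n) n (K n) (g n) (q n) (M n) (A n) \<omega> \<in> carrier_mat n n"
        by (intro minus_carrier_mat hadamard_carrier car)
      assume ij: "i < n" "j < n"
      show "(R \<circ>\<^sub>H norm_adj \<alpha> n (A n \<omega>)
        - R \<circ>\<^sub>H signal_plus_noise \<alpha> (P n) n (K n) (g n) (q n) (M n) (A n) \<omega>) $$ (i,j)
        = R $$ (i,j) * (norm_adj \<alpha> n (A n \<omega>) $$ (i,j)
          - signal_plus_noise \<alpha> (P n) n (K n) (g n) (q n) (M n) (A n) \<omega> $$ (i,j))"
        unfolding minus_mat_index[OF hadamard_carrier[OF car(1)] ij]
        using car(1) ij by (simp add: hadamard_index right_diff_distrib)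
    qed
    have one: "mat n n (\<lambda>_. 1) \<in> sign_matrices n"
      unfolding sign_matrices_def by auto
    have "(SUP R \<in> sign_matrices n. ?f R) \<le> c * (ln (real n) / real n) powr (1/2)"
      by (rule cSUP_least) (use one le in auto)
    \<comment> \<open>A real supremum needs a nonempty, bounded family: the all-ones matrix is a
      member, and the uniform bound \<open>le\<close> gives boundedness. Its nonnegative value also
      shows that the absolute value around the supremum is harmless.\<close>
    moreover have "?f (mat n n (\<lambda>_. 1)) \<le> (SUP R \<in> sign_matrices n. ?f R)"
      by (rule cSUP_upper[OF one]) (use le in \<open>auto intro!: bdd_aboveI2\<close>)
    then have "0 \<le> (SUP R \<in> sign_matrices n. ?f R)"
      by (rule order_trans[OF Lp_norm_nonneg])
    ultimately show ?thesis by simp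
  qed
  show ?thesis
    using first second c by (intro conjI exI[of _ c] exI[of _ "3::nat"]) auto
qed

end
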